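(* Let $T$ be any presentable theory extending $\mathrm{ECA}_0$ and let $[\alpha]_T$ be the formalised one-M\"unchhausen predicate defined via iterated one-M\"unchhausen classes. Then \[ \mathrm{ACA}_0 + \mathsf{wo}(\beta) + \exists X\, 1\text{-}\mathsf{IMC}(X, \beta) \vdash \forall \alpha{\preceq}\beta \Big[ [\alpha]_T \varphi \leftrightarrow \Box_T \varphi \vee \exists \psi \, \exists \gamma \big( \gamma \prec \alpha \wedge \langle\gamma\rangle_T \psi \wedge \Box_T( \langle\gamma\rangle_T \psi \to \varphi ) \big) \Big]. \]
   Context: Work in second-order arithmetic. $\mathrm{ECA}_0$ is like $\mathrm{ACA}_0$ but with comprehension restricted to $\Delta^0_0$ formulas. An ordinal notation system for an ordinal $\Lambda$ with ordering $\prec$ is fixed, and all ordinal quantifiers range below $\Lambda$; $\mathsf{wo}(\beta)$ expresses that $\prec$ restricted to elements $\preceq\beta$ is a well-order. $\Box_T$ is the standard $\Sigma^0_1$ provability predicate of $T$. The formula $1\text{-}\mathsf{IMC}(X,\gamma)$ (iterated one-M\"unchhausen class) is defined by the fixpoint theorem so that $\mathrm{ECA}_0$ proves $1\text{-}\mathsf{IMC}(X,\gamma)\leftrightarrow \forall\alpha{\preceq}\gamma\ \forall\varphi\ \big[\langle\alpha,\varphi\rangle\in X\leftrightarrow \Box_T\varphi\vee\exists\beta{\prec}\alpha\,\exists\psi\,\big(\langle\beta,\neg\psi\rangle\notin X\wedge\Box_T[\exists X(1\text{-}\mathsf{IMC}(X,\dot\beta)\wedge\langle\dot\beta,\neg\dot\psi\rangle\notin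 X)\to\varphi]\big)\big]$. Then $[\alpha]_T\varphi:=\forall X(1\text{-}\mathsf{IMC}(X,\alpha)\to\langle\alpha,\varphi\rangle\in X)$ and $\langle\alpha\rangle_T\varphi:=\neg[\alpha]_T\neg\varphi$. Here $\beta,\varphi$ are free in the displayed statement. *)

theory Defs
  imports "HOL-Library.Nat_Bijection"
begin

section \<open>The language of second-order arithmetic\<close>

text \<open>
  Number variables and set variables are two separate families of de Bruijn indices.  The
  signature is \<open>0, 1, +, \<cdot>, 2\<^sup>x, =, <, \<in>\<close>; equality is between numbers only.  Negation,
  conjunction and the two universal quantifiers are primitive, everything else is the usual
  classical abbreviation.
\<close>

datatype tm =
    Var nat
  | Zero
  | Unit
  | Add tm tm (infixl "\<^bold>+" 65)
  | Mul tm tm (infixl "\<^bold>*" 70)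
  | Exp2 tm

datatype fm =
    Eq tm tm (infix "\<^bold>=" 50)
  | Less tm tm (infix "\<^bold><" 50)
  | Mem tm nat (infix "\<^bold>\<in>" 50)
  | Neg fm ("\<^bold>\<not> _" [40] 40)
  | And fm fm (infixr "\<^bold>\<and>" 35)
  | All fm ("\<^bold>\<forall> _" [10] 10)
  | AllS fm ("\<^bold>\<forall>\<^sub>2 _" [10] 10)

abbreviation Imp :: "fm \<Rightarrow> fm \<Rightarrow> fm" (infixr "\<^bold>\<longrightarrow>" 25)
  where "A \<^bold>\<longrightarrow> B \<equiv> \<^bold>\<not> (A \<^bold>\<and> \<^bold>\<not> B)"

abbreviation (input) Or :: "fm \<Rightarrow> fm \<Rightarrow> fm" (infixr "\<^bold>\<or>" 30)
  where "A \<^bold>\<or> B \<equiv> \<^bold>\<not> (\<^bold>\<not> A \<^bold>\<and> \<^bold>\<not> B)"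

abbreviation Iff :: "fm \<Rightarrow> fm \<Rightarrow> fm" (infixr "\<^bold>\<longleftrightarrow>" 25)
  where "A \<^bold>\<longleftrightarrow> B \<equiv> (A \<^bold>\<longrightarrow> B) \<^bold>\<and> (B \<^bold>\<longrightarrow> A)"

abbreviation Ex :: "fm \<Rightarrow> fm" ("\<^bold>\<exists> _" [10] 10)
  where "\<^bold>\<exists> A \<equiv> \<^bold>\<not> (\<^bold>\<forall> \<^bold>\<not> A)"

abbreviation ExS :: "fm \<Rightarrow> fm" ("\<^bold>\<exists>\<^sub>2 _" [10] 10)
  where "\<^bold>\<exists>\<^sub>2 A \<equiv> \<^bold>\<not> (\<^bold>\<forall>\<^sub>2 \<^bold>\<not> A)"

primrec subst_tm :: "(nat \<Rightarrow> tm) \<Rightarrow> tm \<Rightarrow> tm" where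
  "subst_tm \<sigma> (Var i) = \<sigma> i"
| "subst_tm \<sigma> Zero = Zero"
| "subst_tm \<sigma> Unit = Unit"
| "subst_tm \<sigma> (t \<^bold>+ u) = subst_tm \<sigma> t \<^bold>+ subst_tm \<sigma> u"
| "subst_tm \<sigma> (t \<^bold>* u) = subst_tm \<sigma> t \<^bold>* subst_tm \<sigma> u"
| "subst_tm \<sigma> (Exp2 t) = Exp2 (subst_tm \<sigma> t)"

abbreviation shift :: "nat \<Rightarrow> tm \<Rightarrow> tm"
  where "shift n \<equiv> subst_tm (\<lambda>i. Var (i + n))"

abbreviation lift_tm :: "tm \<Rightarrow> tm"
  where "lift_tm \<equiv> subst_tm (\<lambda>i. Var (Suc i))"

text \<open>Simultaneous substitution of terms for number variables and renaming of set variables.\<close>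

primrec subst :: "(nat \<Rightarrow> tm) \<Rightarrow> (nat \<Rightarrow> nat) \<Rightarrow> fm \<Rightarrow> fm" where
  "subst \<sigma> \<rho> (t \<^bold>= u) = (subst_tm \<sigma> t \<^bold>= subst_tm \<sigma> u)"
| "subst \<sigma> \<rho> (t \<^bold>< u) = (subst_tm \<sigma> t \<^bold>< subst_tm \<sigma> u)"
| "subst \<sigma> \<rho> (t \<^bold>\<in> n) = (subst_tm \<sigma> t \<^bold>\<in> \<rho> n)"
| "subst \<sigma> \<rho> (\<^bold>\<not> A) = (\<^bold>\<not> subst \<sigma> \<rho> A)"
| "subst \<sigma> \<rho> (A \<^bold>\<and> B) = (subst \<sigma> \<rho> A \<^bold>\<and> subst \<sigma> \<rho> B)"
| "subst \<sigma> \<rho> (\<^bold>\<forall> A) = (\<^bold>\<forall> subst (case_nat (Var 0) (\<lambda>i. lift_tm (\<sigma> i))) \<rho> A)"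
| "subst \<sigma> \<rho> (\<^bold>\<forall>\<^sub>2 A) = (\<^bold>\<forall>\<^sub>2 subst \<sigma> (case_nat 0 (\<lambda>n. Suc (\<rho> n))) A)"

abbreviation lift :: "fm \<Rightarrow> fm"
  where "lift \<equiv> subst (\<lambda>i. Var (Suc i)) (\<lambda>n. n)"
abbreviation liftS :: "fm \<Rightarrow> fm"
  where "liftS \<equiv> subst Var Suc"
abbreviation inst :: "tm \<Rightarrow> fm \<Rightarrow> fm"
  where "inst t \<equiv> subst (case_nat t Var) (\<lambda>n. n)"
abbreviation instS :: "nat \<Rightarrow> fm \<Rightarrow> fm"
  where "instS n \<equiv> subst Var (case_nat n (\<lambda>m. m))"

text \<open>\<open>app A ts ns\<close> is \<open>A(t\<^sub>0, t\<^sub>1, \<dots>; X\<^sub>n\<^sub>0, \<dots>)\<close> for a formula whose free variables are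
  among the first \<open>length ts\<close> number variables and the first \<open>length ns\<close> set variables.\<close>

definition app :: "fm \<Rightarrow> tm list \<Rightarrow> nat list \<Rightarrow> fm" where
  "app A ts ns = subst (\<lambda>i. if i < length ts then ts ! i else Var i)
                       (\<lambda>n. if n < length ns then ns ! n else n) A"

primrec closed_tm :: "nat \<Rightarrow> tm \<Rightarrow> bool" where
  "closed_tm m (Var i) = (i < m)"
| "closed_tm m Zero = True"
| "closed_tm m Unit = True"
| "closed_tm m (t \<^bold>+ u) = (closed_tm m t \<and> closed_tm m u)"
| "closed_tm m (t \<^bold>* u) = (closed_tm m t \<and> closed_tm m u)"
| "closed_tm m (Exp2 t) = closed_tm m t"

text \<open>All free number variables are below \<open>m\<close>, all free set variables below \<open>k\<close>.\<close>

primrec closed_fm :: "nat \<Rightarrow> nat \<Rightarrow> fm \<Rightarrow> bool" where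
  "closed_fm m k (t \<^bold>= u) = (closed_tm m t \<and> closed_tm m u)"
| "closed_fm m k (t \<^bold>< u) = (closed_tm m t \<and> closed_tm m u)"
| "closed_fm m k (t \<^bold>\<in> n) = (closed_tm m t \<and> n < k)"
| "closed_fm m k (\<^bold>\<not> A) = closed_fm m k A"
| "closed_fm m k (A \<^bold>\<and> B) = (closed_fm m k A \<and> closed_fm m k B)"
| "closed_fm m k (\<^bold>\<forall> A) = closed_fm (Suc m) k A"
| "closed_fm m k (\<^bold>\<forall>\<^sub>2 A) = closed_fm m (Suc k) A"

abbreviation sentence :: "fm \<Rightarrow> bool"
  where "sentence \<equiv> closed_fm 0 0"

definition BAll :: "tm \<Rightarrow> fm \<Rightarrow> fm" where
  "BAll t A = (\<^bold>\<forall> Var 0 \<^bold>< lift_tm t \<^bold>\<longrightarrow> A)"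
definition BEx :: "tm \<Rightarrow> fm \<Rightarrow> fm" where
  "BEx t A = (\<^bold>\<not> BAll t (\<^bold>\<not> A))"

inductive delta00 :: "fm \<Rightarrow> bool" where
  "delta00 (t \<^bold>= u)"
| "delta00 (t \<^bold>< u)"
| "delta00 (t \<^bold>\<in> n)"
| "delta00 A \<Longrightarrow> delta00 (\<^bold>\<not> A)"
| "delta00 A \<Longrightarrow> delta00 B \<Longrightarrow> delta00 (A \<^bold>\<and> B)"
| "delta00 A \<Longrightarrow> delta00 (BAll t A)"

inductive sigma01 :: "fm \<Rightarrow> bool" where
  "delta00 A \<Longrightarrow> sigma01 A"
| "sigma01 A \<Longrightarrow> sigma01 (\<^bold>\<exists> A)"

primrec arithmetical :: "fm \<Rightarrow> bool" where
  "arithmetical (t \<^bold>= u) = True"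
| "arithmetical (t \<^bold>< u) = True"
| "arithmetical (t \<^bold>\<in> n) = True"
| "arithmetical (\<^bold>\<not> A) = arithmetical A"
| "arithmetical (A \<^bold>\<and> B) = (arithmetical A \<and> arithmetical B)"
| "arithmetical (\<^bold>\<forall> A) = arithmetical A"
| "arithmetical (\<^bold>\<forall>\<^sub>2 A) = False"

text \<open>Truth in the standard model, with set variables ranging over all sets of numbers.\<close>

primrec eval :: "(nat \<Rightarrow> nat) \<Rightarrow> tm \<Rightarrow> nat" where
  "eval e (Var i) = e i"
| "eval e Zero = 0"
| "eval e Unit = 1"
| "eval e (t \<^bold>+ u) = eval e t + eval e u"
| "eval e (t \<^bold>* u) = eval e t * eval e u"
| "eval e (Exp2 t) = 2 ^ eval e t"

primrec sat :: "(nat \<Rightarrow> nat) \<Rightarrow> (nat \<Rightarrow> nat set) \<Rightarrow> fm \<Rightarrow> bool" where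
  "sat e E (t \<^bold>= u) = (eval e t = eval e u)"
| "sat e E (t \<^bold>< u) = (eval e t < eval e u)"
| "sat e E (t \<^bold>\<in> n) = (eval e t \<in> E n)"
| "sat e E (\<^bold>\<not> A) = (\<not> sat e E A)"
| "sat e E (A \<^bold>\<and> B) = (sat e E A \<and> sat e E B)"
| "sat e E (\<^bold>\<forall> A) = (\<forall>x. sat (case_nat x e) E A)"
| "sat e E (\<^bold>\<forall>\<^sub>2 A) = (\<forall>X. sat e (case_nat X E) A)"


section \<open>Derivability\<close>

text \<open>A Hilbert calculus with modus ponens as its only rule; all generalisations of the schemes
  are logical axioms.  Free variables of hypotheses are therefore parameters.\<close>

inductive scheme :: "fm \<Rightarrow> bool" where
  "scheme (A \<^bold>\<longrightarrow> B \<^bold>\<longrightarrow> A)"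
| "scheme ((A \<^bold>\<longrightarrow> B \<^bold>\<longrightarrow> C) \<^bold>\<longrightarrow> (A \<^bold>\<longrightarrow> B) \<^bold>\<longrightarrow> A \<^bold>\<longrightarrow> C)"
| "scheme ((\<^bold>\<not> A \<^bold>\<longrightarrow> \<^bold>\<not> B) \<^bold>\<longrightarrow> B \<^bold>\<longrightarrow> A)"
| "scheme (A \<^bold>\<and> B \<^bold>\<longrightarrow> A)"
| "scheme (A \<^bold>\<and> B \<^bold>\<longrightarrow> B)"
| "scheme (A \<^bold>\<longrightarrow> B \<^bold>\<longrightarrow> A \<^bold>\<and> B)"
| "scheme ((\<^bold>\<forall> A) \<^bold>\<longrightarrow> inst t A)"
| "scheme ((\<^bold>\<forall> A \<^bold>\<longrightarrow> B) \<^bold>\<longrightarrow> (\<^bold>\<forall> A) \<^bold>\<longrightarrow> (\<^bold>\<forall> B))"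
| "scheme (A \<^bold>\<longrightarrow> (\<^bold>\<forall> lift A))"
| "scheme ((\<^bold>\<forall>\<^sub>2 A) \<^bold>\<longrightarrow> instS n A)"
| "scheme ((\<^bold>\<forall>\<^sub>2 A \<^bold>\<longrightarrow> B) \<^bold>\<longrightarrow> (\<^bold>\<forall>\<^sub>2 A) \<^bold>\<longrightarrow> (\<^bold>\<forall>\<^sub>2 B))"
| "scheme (A \<^bold>\<longrightarrow> (\<^bold>\<forall>\<^sub>2 liftS A))"
| "scheme (t \<^bold>= t)"
| "scheme (t \<^bold>= u \<^bold>\<longrightarrow> inst t A \<^bold>\<longrightarrow> inst u A)"

inductive logical_axiom :: "fm \<Rightarrow> bool" where
  "scheme A \<Longrightarrow> logical_axiom A"
| "logical_axiom A \<Longrightarrow> logical_axiom (\<^bold>\<forall> A)"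
| "logical_axiom A \<Longrightarrow> logical_axiom (\<^bold>\<forall>\<^sub>2 A)"

inductive derives :: "fm set \<Rightarrow> fm \<Rightarrow> bool" (infix "\<turnstile>" 15) for \<Gamma> where
  hyp: "A \<in> \<Gamma> \<Longrightarrow> \<Gamma> \<turnstile> A"
| logic: "logical_axiom A \<Longrightarrow> \<Gamma> \<turnstile> A"
| mp: "\<Gamma> \<turnstile> A \<^bold>\<longrightarrow> B \<Longrightarrow> \<Gamma> \<turnstile> A \<Longrightarrow> \<Gamma> \<turnstile> B"


section \<open>The theories\<close>

definition closures :: "fm set \<Rightarrow> fm set" where
  "closures \<A> = {(AllS ^^ k) ((All ^^ m) A) | k m A. A \<in> \<A> \<and> closed_fm m k A}"

definition basic_axioms :: "fm set" where
  "basic_axioms = (let x = Var 0; y = Var 1 in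
    { \<^bold>\<not> x \<^bold>+ Unit \<^bold>= Zero,
      x \<^bold>+ Unit \<^bold>= y \<^bold>+ Unit \<^bold>\<longrightarrow> x \<^bold>= y,
      x \<^bold>+ Zero \<^bold>= x,
      x \<^bold>+ (y \<^bold>+ Unit) \<^bold>= (x \<^bold>+ y) \<^bold>+ Unit,
      x \<^bold>* Zero \<^bold>= Zero,
      x \<^bold>* (y \<^bold>+ Unit) \<^bold>= x \<^bold>* y \<^bold>+ x,
      Exp2 Zero \<^bold>= Unit,
      Exp2 (x \<^bold>+ Unit) \<^bold>= Exp2 x \<^bold>+ Exp2 x,
      \<^bold>\<not> x \<^bold>< Zero,
      x \<^bold>< y \<^bold>+ Unit \<^bold>\<longleftrightarrow> x \<^bold>< y \<^bold>\<or> x \<^bold>= y,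
      Zero \<^bold>\<in> 0 \<^bold>\<and> (\<^bold>\<forall> x \<^bold>\<in> 0 \<^bold>\<longrightarrow> x \<^bold>+ Unit \<^bold>\<in> 0) \<^bold>\<longrightarrow> (\<^bold>\<forall> x \<^bold>\<in> 0) })"

text \<open>\<open>\<exists>X \<forall>x (x \<in> X \<longleftrightarrow> A(x))\<close>, where \<open>x\<close> is number variable \<open>0\<close> of \<open>A\<close> and \<open>X\<close> is not free
  in \<open>A\<close>; all further variables of \<open>A\<close> are parameters.\<close>

definition comprehension :: "fm \<Rightarrow> fm" where
  "comprehension A = (\<^bold>\<exists>\<^sub>2 \<^bold>\<forall> Var 0 \<^bold>\<in> 0 \<^bold>\<longleftrightarrow> liftS A)"

definition ECA0 :: "fm set" where
  "ECA0 = closures (basic_axioms \<union> comprehension ` {A. delta00 A})"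

definition ACA0 :: "fm set" where
  "ACA0 = closures (basic_axioms \<union> comprehension ` {A. arithmetical A})"


section \<open>Goedel numbering\<close>

text \<open>Both codings are bijections (see \<open>bij_tcode\<close>, \<open>bij_code\<close> below), so inside arithmetic a
  quantifier over formulas is just a number quantifier.\<close>

primrec tcode :: "tm \<Rightarrow> nat" where
  "tcode Zero = 0"
| "tcode Unit = 1"
| "tcode (Var i) = 4 * i + 2"
| "tcode (Exp2 t) = 4 * tcode t + 3"
| "tcode (t \<^bold>+ u) = 4 * prod_encode (tcode t, tcode u) + 4"
| "tcode (t \<^bold>* u) = 4 * prod_encode (tcode t, tcode u) + 5"

primrec code :: "fm \<Rightarrow> nat" where
  "code (t \<^bold>= u) = 7 * prod_encode (tcode t, tcode u)"
| "code (t \<^bold>< u) = 7 * prod_encode (tcode t, tcode u) + 1"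
| "code (t \<^bold>\<in> n) = 7 * prod_encode (tcode t, n) + 2"
| "code (\<^bold>\<not> A) = 7 * code A + 3"
| "code (A \<^bold>\<and> B) = 7 * prod_encode (code A, code B) + 4"
| "code (\<^bold>\<forall> A) = 7 * code A + 5"
| "code (\<^bold>\<forall>\<^sub>2 A) = 7 * code A + 6"

primrec num :: "nat \<Rightarrow> tm" where
  "num 0 = Zero"
| "num (Suc n) = num n \<^bold>+ Unit"

definition neg_tm :: "tm \<Rightarrow> tm" where
  "neg_tm p = num 7 \<^bold>* p \<^bold>+ num 3"

text \<open>\<open>code_exp\<close> describes the code of a composite expression in terms of given codes:
  \<open>Unary a b c\<close> stands for \<open>a \<cdot> c + b\<close> and \<open>Binary a b c d\<close> for \<open>a \<cdot> prod_encode (c, d) + b\<close>.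
  \<open>is_code n c z\<close> says that \<open>z\<close> has the value of \<open>c\<close>, whose terms are to be shifted by \<open>n\<close>;
  since \<open>prod_encode\<close> is not a term, it uses
  \<open>2 \<cdot> prod_encode (x, y) = (x + y) (x + y + 1) + 2 x\<close>.\<close>

datatype code_exp = Tm tm | Unary nat nat code_exp | Binary nat nat code_exp code_exp

abbreviation "cVar \<equiv> Unary 4 2"
abbreviation "cExp \<equiv> Unary 4 3"
abbreviation "cAdd \<equiv> Binary 4 4"
abbreviation "cMul \<equiv> Binary 4 5"
abbreviation "cEq \<equiv> Binary 7 0"
abbreviation "cLess \<equiv> Binary 7 1"
abbreviation "cMem \<equiv> Binary 7 2"
abbreviation "cNeg \<equiv> Unary 7 3"
abbreviation "cAnd \<equiv> Binary 7 4"
abbreviation "cAll \<equiv> Unary 7 5"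
abbreviation "cAllS \<equiv> Unary 7 6"
abbreviation "cImp a b \<equiv> cNeg (cAnd a (cNeg b))"

text \<open>\<open>bexs n t A\<close>: there are \<open>n\<close> numbers \<open>\<le> t\<close> (variables \<open>0, \<dots>, n - 1\<close>) with \<open>A\<close>.\<close>

primrec bexs :: "nat \<Rightarrow> tm \<Rightarrow> fm \<Rightarrow> fm" where
  "bexs 0 t A = A"
| "bexs (Suc n) t A = BEx (t \<^bold>+ Unit) (bexs n (lift_tm t) A)"

primrec is_code :: "nat \<Rightarrow> code_exp \<Rightarrow> tm \<Rightarrow> fm" where
  "is_code n (Tm t) z = (z \<^bold>= shift n t)"
| "is_code n (Unary a b c) z =
    bexs 1 z (is_code (n + 1) c (Var 0) \<^bold>\<and> shift 1 z \<^bold>= num a \<^bold>* Var 0 \<^bold>+ num b)"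
| "is_code n (Binary a b c d) z =
    bexs 2 z (is_code (n + 2) c (Var 1) \<^bold>\<and> is_code (n + 2) d (Var 0) \<^bold>\<and>
      num 2 \<^bold>* shift 2 z \<^bold>=
        num a \<^bold>* ((Var 1 \<^bold>+ Var 0) \<^bold>* (Var 1 \<^bold>+ Var 0 \<^bold>+ Unit) \<^bold>+ num 2 \<^bold>* Var 1) \<^bold>+ num (2 * b))"

abbreviation has_code :: "tm \<Rightarrow> code_exp \<Rightarrow> fm" (infix "\<^bold>\<equiv>" 50)
  where "z \<^bold>\<equiv> c \<equiv> is_code 0 c z"


section \<open>The provability predicate\<close>

text \<open>Pairing of numbers by \<open>(i + j)\<^sup>2 + i\<close>, as usual in second-order arithmetic; finite sets
  are coded by binary expansions: \<open>x \<epsilon> s\<close> iff \<open>s = (2q + 1) 2\<^sup>x + r\<close> for some \<open>q\<close> and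
  \<open>r < 2\<^sup>x\<close>.\<close>

definition pr :: "tm \<Rightarrow> tm \<Rightarrow> tm" where
  "pr t u = (t \<^bold>+ u) \<^bold>* (t \<^bold>+ u) \<^bold>+ t"

definition elt :: "tm \<Rightarrow> tm \<Rightarrow> fm" (infix "\<^bold>\<epsilon>" 50) where
  "x \<^bold>\<epsilon> s = BEx (s \<^bold>+ Unit) (BEx (Exp2 (shift 1 x))
     (shift 2 s \<^bold>= (num 2 \<^bold>* Var 1 \<^bold>+ Unit) \<^bold>* Exp2 (shift 2 x) \<^bold>+ Var 0))"

definition tup :: "nat \<Rightarrow> tm \<Rightarrow> tm \<Rightarrow> tm \<Rightarrow> tm \<Rightarrow> tm" where
  "tup i o' k x y = pr (num i) (pr o' (pr k (pr x y)))"

text \<open>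
  Substitutions are arithmetised by a code \<open>w\<close> of a finite set of quintuples
  \<open>\<langle>i, o, k, x, y\<rangle>\<close> which is closed under the recursion equations read backwards.  Here
  \<open>k\<close> is the number of quantifiers passed, and \<open>y\<close> is the result of applying to \<open>x\<close>

  \<^item> \<open>i = 0\<close> (terms \<open>x\<close>), \<open>i = 1\<close> (formulas \<open>x\<close>): the lifting if \<open>o = 0\<close>, and the
    instantiation by the term with code \<open>t\<close> if \<open>o = t + 1\<close>;
  \<^item> \<open>i = 2\<close> (formulas \<open>x\<close>): the lifting of set variables if \<open>o = 0\<close>, and the instantiation by
    set variable \<open>n\<close> if \<open>o = n + 1\<close>.

  In the first case \<open>t\<close> has itself to be lifted when passing a quantifier.
\<close>

definition tm_step :: "tm \<Rightarrow> tm \<Rightarrow> tm \<Rightarrow> tm \<Rightarrow> tm \<Rightarrow> fm" where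
  "tm_step w o' k x y =
    ((x \<^bold>= Zero \<^bold>\<and> y \<^bold>= Zero) \<^bold>\<or> (x \<^bold>= Unit \<^bold>\<and> y \<^bold>= Unit) \<^bold>\<or>
     bexs 1 x (let i = Var 0; o' = shift 1 o'; k = shift 1 k; x = shift 1 x; y = shift 1 y in
       x \<^bold>\<equiv> cVar (Tm i) \<^bold>\<and>
       ((i \<^bold>< k \<^bold>\<and> y \<^bold>= x) \<^bold>\<or>
        (o' \<^bold>= Zero \<^bold>\<and> \<^bold>\<not> i \<^bold>< k \<^bold>\<and> y \<^bold>\<equiv> cVar (Tm (i \<^bold>+ Unit))) \<^bold>\<or>
        (o' \<^bold>= y \<^bold>+ Unit \<^bold>\<and> i \<^bold>= k) \<^bold>\<or>
        (\<^bold>\<not> o' \<^bold>= Zero \<^bold>\<and> k \<^bold>< i \<^bold>\<and> y \<^bold>+ num 4 \<^bold>\<equiv> cVar (Tm i)))) \<^bold>\<or>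
     bexs 4 (x \<^bold>+ y) (let a = Var 3; a' = Var 2; b = Var 1; b' = Var 0; w = shift 4 w;
         o' = shift 4 o'; k = shift 4 k; x = shift 4 x; y = shift 4 y in
       tup 0 o' k a b \<^bold>\<epsilon> w \<^bold>\<and>
       ((x \<^bold>\<equiv> cExp (Tm a) \<^bold>\<and> y \<^bold>\<equiv> cExp (Tm b)) \<^bold>\<or>
        (tup 0 o' k a' b' \<^bold>\<epsilon> w \<^bold>\<and>
         ((x \<^bold>\<equiv> cAdd (Tm a) (Tm a') \<^bold>\<and> y \<^bold>\<equiv> cAdd (Tm b) (Tm b')) \<^bold>\<or>
          (x \<^bold>\<equiv> cMul (Tm a) (Tm a') \<^bold>\<and> y \<^bold>\<equiv> cMul (Tm b) (Tm b')))))))"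

definition fm_step :: "tm \<Rightarrow> tm \<Rightarrow> tm \<Rightarrow> tm \<Rightarrow> tm \<Rightarrow> fm" where
  "fm_step w o' k x y =
    bexs 4 (x \<^bold>+ y) (let a = Var 3; a' = Var 2; b = Var 1; b' = Var 0; w = shift 4 w;
        o' = shift 4 o'; k = shift 4 k; x = shift 4 x; y = shift 4 y in
      (tup 0 o' k a b \<^bold>\<epsilon> w \<^bold>\<and>
       ((x \<^bold>\<equiv> cMem (Tm a) (Tm a') \<^bold>\<and> y \<^bold>\<equiv> cMem (Tm b) (Tm a')) \<^bold>\<or>
        (tup 0 o' k a' b' \<^bold>\<epsilon> w \<^bold>\<and>
         ((x \<^bold>\<equiv> cEq (Tm a) (Tm a') \<^bold>\<and> y \<^bold>\<equiv> cEq (Tm b) (Tm b')) \<^bold>\<or>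
          (x \<^bold>\<equiv> cLess (Tm a) (Tm a') \<^bold>\<and> y \<^bold>\<equiv> cLess (Tm b) (Tm b')))))) \<^bold>\<or>
      (tup 1 o' k a b \<^bold>\<epsilon> w \<^bold>\<and>
       ((x \<^bold>\<equiv> cNeg (Tm a) \<^bold>\<and> y \<^bold>\<equiv> cNeg (Tm b)) \<^bold>\<or>
        (x \<^bold>\<equiv> cAllS (Tm a) \<^bold>\<and> y \<^bold>\<equiv> cAllS (Tm b)) \<^bold>\<or>
        (tup 1 o' k a' b' \<^bold>\<epsilon> w \<^bold>\<and>
         x \<^bold>\<equiv> cAnd (Tm a) (Tm a') \<^bold>\<and> y \<^bold>\<equiv> cAnd (Tm b) (Tm b')))) \<^bold>\<or>
      (x \<^bold>\<equiv> cAll (Tm a) \<^bold>\<and> y \<^bold>\<equiv> cAll (Tm b) \<^bold>\<and>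
       ((o' \<^bold>= Zero \<^bold>\<and> tup 1 o' (k \<^bold>+ Unit) a b \<^bold>\<epsilon> w) \<^bold>\<or>
        bexs 2 w (let t = Var 1; t' = Var 0; w = shift 2 w; o' = shift 2 o'; k = shift 2 k;
            a = shift 2 a; b = shift 2 b in
          o' \<^bold>= t \<^bold>+ Unit \<^bold>\<and> tup 0 Zero Zero t t' \<^bold>\<epsilon> w \<^bold>\<and>
          tup 1 (t' \<^bold>+ Unit) (k \<^bold>+ Unit) a b \<^bold>\<epsilon> w))))"

definition fmS_step :: "tm \<Rightarrow> tm \<Rightarrow> tm \<Rightarrow> tm \<Rightarrow> tm \<Rightarrow> fm" where
  "fmS_step w o' k x y =
    bexs 4 (x \<^bold>+ y) (let a = Var 3; a' = Var 2; b = Var 1; b' = Var 0; w = shift 4 w;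
        o' = shift 4 o'; k = shift 4 k; x = shift 4 x; y = shift 4 y in
      (y \<^bold>= x \<^bold>\<and> (x \<^bold>\<equiv> cEq (Tm a) (Tm a') \<^bold>\<or> x \<^bold>\<equiv> cLess (Tm a) (Tm a'))) \<^bold>\<or>
      (x \<^bold>\<equiv> cMem (Tm a) (Tm a') \<^bold>\<and> y \<^bold>\<equiv> cMem (Tm a) (Tm b') \<^bold>\<and>
       ((a' \<^bold>< k \<^bold>\<and> b' \<^bold>= a') \<^bold>\<or>
        (o' \<^bold>= Zero \<^bold>\<and> \<^bold>\<not> a' \<^bold>< k \<^bold>\<and> b' \<^bold>= a' \<^bold>+ Unit) \<^bold>\<or>
        (o' \<^bold>= b' \<^bold>+ Unit \<^bold>\<and> a' \<^bold>= k) \<^bold>\<or>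
        (\<^bold>\<not> o' \<^bold>= Zero \<^bold>\<and> k \<^bold>< a' \<^bold>\<and> a' \<^bold>= b' \<^bold>+ Unit))) \<^bold>\<or>
      (tup 2 o' k a b \<^bold>\<epsilon> w \<^bold>\<and>
       ((x \<^bold>\<equiv> cNeg (Tm a) \<^bold>\<and> y \<^bold>\<equiv> cNeg (Tm b)) \<^bold>\<or>
        (x \<^bold>\<equiv> cAll (Tm a) \<^bold>\<and> y \<^bold>\<equiv> cAll (Tm b)) \<^bold>\<or>
        (tup 2 o' k a' b' \<^bold>\<epsilon> w \<^bold>\<and>
         x \<^bold>\<equiv> cAnd (Tm a) (Tm a') \<^bold>\<and> y \<^bold>\<equiv> cAnd (Tm b) (Tm b')))) \<^bold>\<or>
      (x \<^bold>\<equiv> cAllS (Tm a) \<^bold>\<and> y \<^bold>\<equiv> cAllS (Tm b) \<^bold>\<and>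
       ((o' \<^bold>= Zero \<^bold>\<and> tup 2 o' (k \<^bold>+ Unit) a b \<^bold>\<epsilon> w) \<^bold>\<or>
        (\<^bold>\<not> o' \<^bold>= Zero \<^bold>\<and> tup 2 (o' \<^bold>+ Unit) (k \<^bold>+ Unit) a b \<^bold>\<epsilon> w))))"

definition subst_ok :: "tm \<Rightarrow> fm" where
  "subst_ok w = BAll w (let u = Var 0; w = shift 1 w in u \<^bold>\<epsilon> w \<^bold>\<longrightarrow>
    bexs 4 u (let o' = Var 3; k = Var 2; x = Var 1; y = Var 0; u = shift 4 u; w = shift 4 w in
      (u \<^bold>= tup 0 o' k x y \<^bold>\<and> tm_step w o' k x y) \<^bold>\<or>
      (u \<^bold>= tup 1 o' k x y \<^bold>\<and> fm_step w o' k x y) \<^bold>\<or>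
      (u \<^bold>= tup 2 o' k x y \<^bold>\<and> fmS_step w o' k x y)))"

definition is_scheme :: "tm \<Rightarrow> tm \<Rightarrow> fm" where
  "is_scheme w y = bexs 5 (w \<^bold>+ y) (let A = Tm (Var 4); B = Tm (Var 3); C = Tm (Var 2);
      a = Var 4; b = Var 3; c = Var 2; t = Var 1; u = Var 0;
      w = shift 5 w; y = shift 5 y in
    y \<^bold>\<equiv> cImp A (cImp B A) \<^bold>\<or>
    y \<^bold>\<equiv> cImp (cImp A (cImp B C)) (cImp (cImp A B) (cImp A C)) \<^bold>\<or>
    y \<^bold>\<equiv> cImp (cImp (cNeg A) (cNeg B)) (cImp B A) \<^bold>\<or>
    y \<^bold>\<equiv> cImp (cAnd A B) A \<^bold>\<or>
    y \<^bold>\<equiv> cImp (cAnd A B) B \<^bold>\<or>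
    y \<^bold>\<equiv> cImp A (cImp B (cAnd A B)) \<^bold>\<or>
    (y \<^bold>\<equiv> cImp (cAll A) B \<^bold>\<and> tup 1 (t \<^bold>+ Unit) Zero a b \<^bold>\<epsilon> w) \<^bold>\<or>
    y \<^bold>\<equiv> cImp (cAll (cImp A B)) (cImp (cAll A) (cAll B)) \<^bold>\<or>
    (y \<^bold>\<equiv> cImp A (cAll B) \<^bold>\<and> tup 1 Zero Zero a b \<^bold>\<epsilon> w) \<^bold>\<or>
    (y \<^bold>\<equiv> cImp (cAllS A) B \<^bold>\<and> tup 2 (t \<^bold>+ Unit) Zero a b \<^bold>\<epsilon> w) \<^bold>\<or>
    y \<^bold>\<equiv> cImp (cAllS (cImp A B)) (cImp (cAllS A) (cAllS B)) \<^bold>\<or>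
    (y \<^bold>\<equiv> cImp A (cAllS B) \<^bold>\<and> tup 2 Zero Zero a b \<^bold>\<epsilon> w) \<^bold>\<or>
    y \<^bold>\<equiv> cEq (Tm t) (Tm t) \<^bold>\<or>
    (y \<^bold>\<equiv> cImp (cEq (Tm t) (Tm u)) (cImp B C) \<^bold>\<and>
      tup 1 (t \<^bold>+ Unit) Zero a b \<^bold>\<epsilon> w \<^bold>\<and> tup 1 (u \<^bold>+ Unit) Zero a c \<^bold>\<epsilon> w))"

text \<open>\<open>s\<close> codes a finite set of logical axioms.\<close>

definition logic_ok :: "tm \<Rightarrow> tm \<Rightarrow> fm" where
  "logic_ok w s = BAll s (let y = Var 0; w = shift 1 w; s = shift 1 s in y \<^bold>\<epsilon> s \<^bold>\<longrightarrow>
    is_scheme w y \<^bold>\<or>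
    bexs 1 y (let z = Var 0; y = shift 1 y; s = shift 1 s in
      z \<^bold>\<epsilon> s \<^bold>\<and> (y \<^bold>\<equiv> cAll (Tm z) \<^bold>\<or> y \<^bold>\<equiv> cAllS (Tm z))))"

text \<open>\<open>p\<close> codes a finite set of pairs \<open>\<langle>i, y\<rangle>\<close> (``formula \<open>y\<close> occurs in line \<open>i\<close>''), each
  of which is an axiom of the theory numerated by \<open>\<tau>\<close>, an element of \<open>s\<close>, or
  follows by modus ponens from formulas in earlier lines.\<close>

definition proof_ok :: "fm \<Rightarrow> tm \<Rightarrow> tm \<Rightarrow> fm" where
  "proof_ok \<tau> s p = BAll p (let v = Var 0; s = shift 1 s; p = shift 1 p in v \<^bold>\<epsilon> p \<^bold>\<longrightarrow>
    bexs 2 v (let i = Var 1; y = Var 0; v = shift 2 v; s = shift 2 s; p = shift 2 p in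
      v \<^bold>= pr i y \<^bold>\<and>
      (app \<tau> [y] [] \<^bold>\<or> y \<^bold>\<epsilon> s \<^bold>\<or>
       bexs 4 p (let j = Var 3; k = Var 2; z = Var 1; c = Var 0;
           i = shift 4 i; y = shift 4 y; p = shift 4 p in
         j \<^bold>< i \<^bold>\<and> k \<^bold>< i \<^bold>\<and> c \<^bold>\<equiv> cImp (Tm z) (Tm y) \<^bold>\<and> pr j z \<^bold>\<epsilon> p \<^bold>\<and> pr k c \<^bold>\<epsilon> p))))"

definition box :: "fm \<Rightarrow> tm \<Rightarrow> fm" where
  "box \<tau> x = (\<^bold>\<exists> \<^bold>\<exists> \<^bold>\<exists> (let w = Var 2; s = Var 1; p = Var 0; x = shift 3 x in
    subst_ok w \<^bold>\<and> logic_ok w s \<^bold>\<and> proof_ok \<tau> s p \<^bold>\<and>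
    bexs 1 p (pr (Var 0) (shift 1 x) \<^bold>\<epsilon> shift 1 p)))"

text \<open>\<open>u\<close> is the code of \<open>num m\<close>, witnessed by a finite set of pairs \<open>\<langle>i, tcode (num i)\<rangle>\<close>.\<close>

definition is_num :: "tm \<Rightarrow> tm \<Rightarrow> fm" where
  "is_num m u = (\<^bold>\<exists> (let s = Var 0; m = shift 1 m; u = shift 1 u in
    pr m u \<^bold>\<epsilon> s \<^bold>\<and>
    BAll s (let v = Var 0; s = shift 1 s in v \<^bold>\<epsilon> s \<^bold>\<longrightarrow>
      v \<^bold>= pr Zero Zero \<^bold>\<or>
      bexs 3 v (let i = Var 2; x = Var 1; y = Var 0; v = shift 3 v; s = shift 3 s in
        v \<^bold>= pr (i \<^bold>+ Unit) y \<^bold>\<and> pr i x \<^bold>\<epsilon> s \<^bold>\<and> y \<^bold>\<equiv> cAdd (Tm x) (Tm Unit)))))"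

text \<open>\<open>z\<close> is the code of \<open>A(a, b)\<close> with the numerals of the numbers \<open>a\<close>, \<open>b\<close> (dot notation).\<close>

definition is_dotted :: "fm \<Rightarrow> tm \<Rightarrow> tm \<Rightarrow> tm \<Rightarrow> fm" where
  "is_dotted A a b z = (\<^bold>\<exists> \<^bold>\<exists> \<^bold>\<exists> \<^bold>\<exists> (let w = Var 3; x = Var 2; u = Var 1; v = Var 0;
      a = shift 4 a; b = shift 4 b; z = shift 4 z in
    is_num a u \<^bold>\<and> is_num b v \<^bold>\<and> subst_ok w \<^bold>\<and>
    tup 1 (u \<^bold>+ Unit) Zero (num (code A)) x \<^bold>\<epsilon> w \<^bold>\<and> tup 1 (v \<^bold>+ Unit) Zero x z \<^bold>\<epsilon> w))"

text \<open>\<open>\<box>(A(a, b) \<longrightarrow> f)\<close>, where \<open>a\<close>, \<open>b\<close> are dotted and \<open>f\<close> is the code of a formula.\<close>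

definition box_imp :: "fm \<Rightarrow> fm \<Rightarrow> tm \<Rightarrow> tm \<Rightarrow> tm \<Rightarrow> fm" where
  "box_imp \<tau> A a b f = (\<^bold>\<exists> \<^bold>\<exists> (let z = Var 1; c = Var 0 in
    is_dotted A (shift 2 a) (shift 2 b) z \<^bold>\<and> c \<^bold>\<equiv> cImp (Tm z) (Tm (shift 2 f)) \<^bold>\<and> box \<tau> c))"


section \<open>Presentable theories and ordinal notations\<close>

text \<open>\<open>\<tau>\<close> is an elementary (\<open>\<Delta>\<^sup>0\<^sub>0\<close>) definition of the set of axioms of \<open>T\<close>.\<close>

definition presentation :: "fm \<Rightarrow> fm set \<Rightarrow> bool" where
  "presentation \<tau> T \<longleftrightarrow> delta00 \<tau> \<and> closed_fm 1 0 \<tau> \<and> (\<forall>A\<in>T. sentence A) \<and>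
     (\<forall>A. A \<in> T \<longleftrightarrow> sat (\<lambda>_. code A) (\<lambda>_. {}) \<tau>)"

text \<open>
  An ordinal notation system is given by its reflexive ordering \<open>le\<close>; the notations are the
  \<open>x\<close> with \<open>x \<preceq> x\<close>.  The order type of the well-order in the last clause is \<open>\<Lambda>\<close>.  Quantifiers
  over ordinals need no further relativisation, since all of them are bounded by \<open>\<preceq>\<close> or \<open>\<prec>\<close>.
  As usual, the ordering is elementary and provably linear.
\<close>

definition preceq :: "fm \<Rightarrow> tm \<Rightarrow> tm \<Rightarrow> fm" where
  "preceq le s t = app le [s, t] []"
definition prec :: "fm \<Rightarrow> tm \<Rightarrow> tm \<Rightarrow> fm" where
  "prec le s t = (preceq le s t \<^bold>\<and> \<^bold>\<not> s \<^bold>= t)"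

definition ordinal_notation :: "fm \<Rightarrow> bool" where
  "ordinal_notation le \<longleftrightarrow> delta00 le \<and> closed_fm 2 0 le \<and>
     (let x = Var 0; y = Var 1; z = Var 2 in
       (ECA0 \<turnstile> preceq le x y \<^bold>\<longrightarrow> preceq le x x \<^bold>\<and> preceq le y y) \<and>
       (ECA0 \<turnstile> preceq le x y \<^bold>\<and> preceq le y z \<^bold>\<longrightarrow> preceq le x z) \<and>
       (ECA0 \<turnstile> preceq le x y \<^bold>\<and> preceq le y x \<^bold>\<longrightarrow> x \<^bold>= y) \<and>
       (ECA0 \<turnstile> preceq le x x \<^bold>\<and> preceq le y y \<^bold>\<longrightarrow> preceq le x y \<^bold>\<or> preceq le y x)) \<and>
     Well_order {(m, n). sat (case_nat m (\<lambda>_. n)) (\<lambda>_. {}) le}"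

text \<open>\<open>\<prec>\<close> restricted to \<open>{x. x \<preceq> b}\<close> is a strict linear order, and every subset
  \<open>X\<close> (set variable \<open>0\<close>) meeting \<open>{x. x \<preceq> b}\<close> has a least element there.\<close>

definition wo :: "fm \<Rightarrow> tm \<Rightarrow> fm" where
  "wo le b =
    ((\<^bold>\<forall> \<^bold>\<forall> \<^bold>\<forall> (let x = Var 2; y = Var 1; z = Var 0; b = shift 3 b in
       preceq le x b \<^bold>\<and> preceq le y b \<^bold>\<and> preceq le z b \<^bold>\<longrightarrow>
       \<^bold>\<not> prec le x x \<^bold>\<and>
       (prec le x y \<^bold>\<and> prec le y z \<^bold>\<longrightarrow> prec le x z) \<^bold>\<and>
       (prec le x y \<^bold>\<or> x \<^bold>= y \<^bold>\<or> prec le y x))) \<^bold>\<and>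
     (\<^bold>\<forall>\<^sub>2 (\<^bold>\<exists> preceq le (Var 0) (shift 1 b) \<^bold>\<and> Var 0 \<^bold>\<in> 0) \<^bold>\<longrightarrow>
       (\<^bold>\<exists> preceq le (Var 0) (shift 1 b) \<^bold>\<and> Var 0 \<^bold>\<in> 0 \<^bold>\<and>
         (\<^bold>\<forall> preceq le (Var 0) (shift 2 b) \<^bold>\<and> prec le (Var 0) (Var 1) \<^bold>\<longrightarrow> \<^bold>\<not> Var 0 \<^bold>\<in> 0))))"


section \<open>Iterated one-Muenchhausen classes\<close>

text \<open>In \<open>imc\<close>, number variable \<open>0\<close> is the ordinal and set variable \<open>0\<close> the class.\<close>

definition IMC :: "fm \<Rightarrow> nat \<Rightarrow> tm \<Rightarrow> fm" where
  "IMC imc X a = app imc [a] [X]"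

text \<open>\<open>\<exists>X (1-IMC(X, \<beta>) \<and> \<langle>\<beta>, \<not>\<psi>\<rangle> \<notin> X)\<close>, where \<open>\<beta>\<close>, \<open>\<psi>\<close> are number variables \<open>0\<close>, \<open>1\<close>.\<close>

definition oracle_fm :: "fm \<Rightarrow> fm" where
  "oracle_fm imc = (\<^bold>\<exists>\<^sub>2 IMC imc 0 (Var 0) \<^bold>\<and> \<^bold>\<not> pr (Var 0) (neg_tm (Var 1)) \<^bold>\<in> 0)"

text \<open>The right-hand side of the fixpoint equation, with \<open>X\<close> set variable \<open>0\<close> and \<open>\<gamma>\<close> number
  variable \<open>0\<close>.  The bound variables are, from outside to inside, \<open>\<alpha>\<close>, \<open>\<phi>\<close>, \<open>\<beta>\<close>, \<open>\<psi>\<close>.\<close>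

definition IMC_rhs :: "fm \<Rightarrow> fm \<Rightarrow> fm \<Rightarrow> fm" where
  "IMC_rhs \<tau> le imc =
    (\<^bold>\<forall> (let \<alpha> = Var 0; \<gamma> = Var 1 in preceq le \<alpha> \<gamma>) \<^bold>\<longrightarrow>
      (\<^bold>\<forall> (let \<phi> = Var 0; \<alpha> = Var 1 in pr \<alpha> \<phi> \<^bold>\<in> 0 \<^bold>\<longleftrightarrow>
        box \<tau> \<phi> \<^bold>\<or>
        (\<^bold>\<exists> (let \<beta> = Var 0; \<alpha> = Var 2 in prec le \<beta> \<alpha>) \<^bold>\<and>
          (\<^bold>\<exists> (let \<psi> = Var 0; \<beta> = Var 1; \<phi> = Var 2 in
            \<^bold>\<not> pr \<beta> (neg_tm \<psi>) \<^bold>\<in> 0 \<^bold>\<and> box_imp \<tau> (oracle_fm imc) \<beta> \<psi> \<phi>))))))"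

definition IMC_formula :: "fm \<Rightarrow> fm \<Rightarrow> fm \<Rightarrow> bool" where
  "IMC_formula \<tau> le imc \<longleftrightarrow> closed_fm 1 1 imc \<and>
     (ECA0 \<turnstile> IMC imc 0 (Var 0) \<^bold>\<longleftrightarrow> IMC_rhs \<tau> le imc)"

text \<open>\<open>[a] f\<close> and \<open>\<langle>a\<rangle> f\<close>, where \<open>a\<close> and \<open>f\<close> denote an ordinal and the code of a formula.\<close>

definition mbox :: "fm \<Rightarrow> tm \<Rightarrow> tm \<Rightarrow> fm" where
  "mbox imc a f = (\<^bold>\<forall>\<^sub>2 IMC imc 0 a \<^bold>\<longrightarrow> pr a f \<^bold>\<in> 0)"

definition mdia :: "fm \<Rightarrow> tm \<Rightarrow> tm \<Rightarrow> fm" where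
  "mdia imc a f = (\<^bold>\<not> mbox imc a (neg_tm f))"


section \<open>Correctness of the arithmetisation in the standard model\<close>

text \<open>Nothing from here on is used by the definitions above.  The results are \<open>bij_code\<close> (every
  number is the code of exactly one formula), \<open>sat_box\<close> and \<open>sat_box_imp\<close> (\<open>box\<close> and \<open>box_imp\<close> define
  provability in the presented theory) and \<open>sigma01_box\<close>.\<close>

lemma prod_encode_ge: "m \<le> prod_encode (m, n)" "n \<le> prod_encode (m, n)"
  by (rule le_prod_encode_1 le_prod_encode_2)+

lemma double_prod_encode: "2 * prod_encode (m, n) = (m + n) * (m + n + 1) + 2 * m"
proof -
  have "2 * triangle (m + n) = (m + n) * (m + n + 1)"
    unfolding triangle_def by (subst dvd_mult_div_cancel) auto
  then show ?thesis by (simp add: prod_encode_def)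
qed

lemma inj_tcode: "tcode t = tcode u \<Longrightarrow> t = u"
proof (induction t arbitrary: u)
  case (Var x) then show ?case by (cases u) (auto, presburger+)
next
  case Zero then show ?case by (cases u) auto
next
  case Unit then show ?case by (cases u) auto
next
  case (Add t1 t2) then show ?case by (cases u) (auto, presburger+)
next
  case (Mul t1 t2) then show ?case by (cases u) (auto, presburger+)
next
  case (Exp2 t) then show ?case by (cases u) (auto, presburger+)
qed

lemma surj_tcode: "\<exists>t. tcode t = n"
proof (induction n rule: less_induct)
  case (less n)
  have *: "\<exists>t u. tcode t = fst (prod_decode p) \<and> tcode u = snd (prod_decode p)" if "p < n" for p
  proof -
    obtain a b where ab: "prod_decode p = (a, b)" by (cases "prod_decode p")
    then have "p = prod_encode (a, b)" by (metis prod_decode_inverse)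
    then have "a \<le> p" "b \<le> p" using prod_encode_ge by auto
    then show ?thesis using less that ab by (metis fst_conv le_less_trans snd_conv)
  qed
  have "n = 0 \<or> n = 1 \<or> (\<exists>i. n = 4 * i + 2) \<or> (\<exists>i. n = 4 * i + 3) \<or>
      (\<exists>i. n = 4 * i + 4) \<or> (\<exists>i. n = 4 * i + 5)" by presburger
  then consider "n = 0" | "n = 1" | i where "n = 4 * i + 2" | i where "n = 4 * i + 3"
    | i where "n = 4 * i + 4" | i where "n = 4 * i + 5" by blast
  then show ?case
  proof cases
    case 1 then show ?thesis by (metis tcode.simps(1))
  next
    case 2 then show ?thesis by (metis tcode.simps(2))
  next
    case 3 then show ?thesis by (metis tcode.simps(3))
  next
    case (4 i) then obtain t where "tcode t = i" using less[of i] by auto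
    then show ?thesis using 4 by (metis tcode.simps(4))
  next
    case (5 i)
    then obtain t u where "tcode t = fst (prod_decode i)" "tcode u = snd (prod_decode i)" using *[of i] by auto
    then have "tcode (t \<^bold>+ u) = n" using 5 by simp
    then show ?thesis by blast
  next
    case (6 i)
    then obtain t u where "tcode t = fst (prod_decode i)" "tcode u = snd (prod_decode i)" using *[of i] by auto
    then have "tcode (t \<^bold>* u) = n" using 6 by simp
    then show ?thesis by blast
  qed
qed

theorem bij_tcode: "bij tcode"
  unfolding bij_def inj_def surj_def using inj_tcode surj_tcode by metis

lemma inj_code: "code A = code B \<Longrightarrow> A = B"
proof (induction A arbitrary: B)
  case (Eq t u) then show ?case by (cases B) (auto dest: inj_tcode, presburger+)
next
  case (Less t u) then show ?case by (cases B) (auto dest: inj_tcode, presburger+)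
next
  case (Mem t n) then show ?case by (cases B) (auto dest: inj_tcode, presburger+)
next
  case (Neg A) then show ?case by (cases B) (auto, presburger+)
next
  case (And A1 A2) then show ?case by (cases B) (auto, presburger+)
next
  case (All A) then show ?case by (cases B) (auto, presburger+)
next
  case (AllS A) then show ?case by (cases B) (auto, presburger+)
qed

lemma surj_code: "\<exists>A. code A = n"
proof (induction n rule: less_induct)
  case (less n)
  define p where "p = n div 7"
  obtain a b where "prod_decode p = (a, b)" by (cases "prod_decode p")
  then have p: "p = prod_encode (a, b)" by (metis prod_decode_inverse)
  have ab: "a \<le> p" "b \<le> p" using prod_encode_ge by (auto simp: p)
  obtain t where t: "tcode t = a" using surj_tcode by blast
  obtain u where u: "tcode u = b" using surj_tcode by blast
  have n: "n = 7 * p + n mod 7" by (simp add: p_def)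
  have r: "n mod 7 < 7" by simp
  consider "n mod 7 = 0" | "n mod 7 = 1" | "n mod 7 = 2" | "n mod 7 = 3" | "n mod 7 = 4"
    | "n mod 7 = 5" | "n mod 7 = 6" using r by linarith
  then show ?case
  proof cases
    case 1 then have "code (t \<^bold>= u) = n" using n p t u by simp
    then show ?thesis by blast
  next
    case 2 then have "code (t \<^bold>< u) = n" using n p t u by simp
    then show ?thesis by blast
  next
    case 3 then have "code (t \<^bold>\<in> b) = n" using n p t by simp
    then show ?thesis by blast
  next
    case 4 then obtain A where "code A = p" using less[of p] n by auto
    then have "code (\<^bold>\<not> A) = n" using 4 n by simp
    then show ?thesis by blast
  next
    case 5 then have "a < n" "b < n" using ab n by auto
    then obtain A B where "code A = a" "code B = b" using less by metis
    then have "code (A \<^bold>\<and> B) = n" using 5 n p by simp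
    then show ?thesis by blast
  next
    case 6 then obtain A where "code A = p" using less[of p] n by auto
    then have "code (\<^bold>\<forall> A) = n" using 6 n by simp
    then show ?thesis by blast
  next
    case 7 then obtain A where "code A = p" using less[of p] n by auto
    then have "code (\<^bold>\<forall>\<^sub>2 A) = n" using 7 n by simp
    then show ?thesis by blast
  qed
qed

theorem bij_code: "bij code"
  unfolding bij_def inj_def surj_def using inj_code surj_code by metis

lemma tcode_eq_iff [simp]: "tcode t = tcode u \<longleftrightarrow> t = u"
  using inj_tcode by auto
lemma code_eq_iff [simp]: "code t = code u \<longleftrightarrow> t = u"
  using inj_code by auto

lemma eval_subst [simp]: "eval e (subst_tm \<sigma> t) = eval (\<lambda>i. eval e (\<sigma> i)) t"
  by (induction t) auto

lemma sat_subst: "sat e E (subst \<sigma> \<rho> A) = sat (\<lambda>i. eval e (\<sigma> i)) (\<lambda>n. E (\<rho> n)) A"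
proof (induction A arbitrary: \<sigma> \<rho> e E)
  case (All A)
  have "(\<lambda>i. eval (case_nat x e) (case_nat (Var 0) (\<lambda>i. lift_tm (\<sigma> i)) i)) =
     case_nat x (\<lambda>i. eval e (\<sigma> i))" for x
    by (rule ext) (simp split: nat.split)
  then show ?case by (simp add: All)
next
  case (AllS A)
  have "(\<lambda>n. case_nat X E (case_nat 0 (\<lambda>n. Suc (\<rho> n)) n)) = case_nat X (\<lambda>n. E (\<rho> n))" for X
    by (rule ext) (simp split: nat.split)
  then show ?case by (simp add: AllS)
qed auto

lemma eval_closed: "closed_tm m t \<Longrightarrow> (\<And>i. i < m \<Longrightarrow> e i = e' i) \<Longrightarrow> eval e t = eval e' t"
  by (induction t) auto

lemma sat_closed: "closed_fm m k A \<Longrightarrow> (\<And>i. i < m \<Longrightarrow> e i = e' i) \<Longrightarrow>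
  (\<And>n. n < k \<Longrightarrow> E n = E' n) \<Longrightarrow> sat e E A = sat e' E' A"
proof (induction A arbitrary: m k e e' E E')
  case (All A)
  have "sat (case_nat x e) E A = sat (case_nat x e') E' A" for x
    using All.prems by (intro All.IH[of "Suc m" k]) (auto split: nat.split)
  then show ?case by simp
next
  case (AllS A)
  have "sat e (case_nat X E) A = sat e' (case_nat X E') A" for X
    using AllS.prems by (intro AllS.IH[of m "Suc k"]) (auto split: nat.split)
  then show ?case by simp
next
  case (Eq t u) then show ?case using eval_closed[of m t e e'] eval_closed[of m u e e'] by simp
next
  case (Less t u) then show ?case using eval_closed[of m t e e'] eval_closed[of m u e e'] by simp
next
  case (Mem t n) then show ?case using eval_closed[of m t e e'] by simp
next
  case (Neg A) show ?case using Neg.IH[of m k e e' E E'] Neg.prems by simp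
next
  case (And A B) show ?case
    using And.IH(1)[of m k e e' E E'] And.IH(2)[of m k e e' E E'] And.prems by simp
qed

lemma eval_num [simp]: "eval e (num n) = n"
  by (induction n) auto

lemma sat_BAll [simp]: "sat e E (BAll t A) = (\<forall>x<eval e t. sat (case_nat x e) E A)"
  by (auto simp: BAll_def)

lemma sat_BEx [simp]: "sat e E (BEx t A) = (\<exists>x<eval e t. sat (case_nat x e) E A)"
  by (auto simp: BEx_def)

lemma sat_bexs:
  "sat e E (bexs 1 t A) = (\<exists>a\<le>eval e t. sat (case_nat a e) E A)"
  "sat e E (bexs (Suc 0) t A) = (\<exists>a\<le>eval e t. sat (case_nat a e) E A)"
  "sat e E (bexs 2 t A) =
    (\<exists>a\<le>eval e t. \<exists>b\<le>eval e t. sat (case_nat b (case_nat a e)) E A)"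
  "sat e E (bexs 3 t A) =
    (\<exists>a\<le>eval e t. \<exists>b\<le>eval e t. \<exists>c\<le>eval e t. sat (case_nat c (case_nat b (case_nat a e))) E A)"
  "sat e E (bexs 4 t A) =
    (\<exists>a\<le>eval e t. \<exists>b\<le>eval e t. \<exists>c\<le>eval e t. \<exists>d\<le>eval e t.
      sat (case_nat d (case_nat c (case_nat b (case_nat a e)))) E A)"
  "sat e E (bexs 5 t A) =
    (\<exists>a\<le>eval e t. \<exists>b\<le>eval e t. \<exists>c\<le>eval e t. \<exists>d\<le>eval e t. \<exists>f\<le>eval e t.
      sat (case_nat f (case_nat d (case_nat c (case_nat b (case_nat a e))))) E A)"
  by (simp_all add: numeral_eq_Suc less_Suc_eq_le)

primrec cval :: "(nat \<Rightarrow> nat) \<Rightarrow> code_exp \<Rightarrow> nat" where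
  "cval e (Tm t) = eval e t"
| "cval e (Unary a b c) = a * cval e c + b"
| "cval e (Binary a b c d) = a * prod_encode (cval e c, cval e d) + b"

primrec cgood :: "code_exp \<Rightarrow> bool" where
  "cgood (Tm t) = True"
| "cgood (Unary a b c) = (a \<noteq> 0 \<and> cgood c)"
| "cgood (Binary a b c d) = (a \<noteq> 0 \<and> cgood c \<and> cgood d)"

lemma nth_env:
  "case_nat a e 0 = (a::nat)" "case_nat a e (Suc n) = e n" "case_nat a e 1 = e 0"
  "case_nat a e (numeral k) = e (pred_numeral k)"
  by (simp_all add: numeral_eq_Suc)

lemma env_shift:
  "case_nat a e (i + numeral k) = e (i + pred_numeral k)"
  "case_nat a e (Suc (i + n)) = e (i + n)"
  by (simp_all add: numeral_eq_Suc)

lemma sat_is_code: "cgood c \<Longrightarrow> sat e E (is_code n c z) \<longleftrightarrow> eval e z = cval (\<lambda>i. e (i + n)) c"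
proof (induction c arbitrary: n z e)
  case (Tm t) then show ?case by simp
next
  case (Unary a b c)
  have "x \<le> a * x + b" for x using Unary.prems
    by (cases a) auto
  then show ?case using Unary by (auto simp: sat_bexs less_Suc_eq_le)
next
  case (Binary a b c d)
  define P where "P = prod_encode (cval (\<lambda>i. e (i + n)) c, cval (\<lambda>i. e (i + n)) d)"
  have aP: "P \<le> a * P" using Binary.prems by (cases a) auto
  have cgs: "cgood c" "cgood d" using Binary.prems by auto
  have le: "cval (\<lambda>i. e (i + n)) c \<le> P" "cval (\<lambda>i. e (i + n)) d \<le> P"
    by (simp_all add: P_def prod_encode_ge)
  have bd: "cval (\<lambda>i. e (i + n)) c \<le> a * P + b" "cval (\<lambda>i. e (i + n)) d \<le> a * P + b"
    using le aP by linarith+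
  have dbl: "2 * z = a * ((x + y) * (x + y + 1) + 2 * x) + 2 * b \<longleftrightarrow> z = a * prod_encode (x, y) + b"
    for x y z :: nat
  proof -
    have "a * ((x + y) * (x + y + 1) + 2 * x) + 2 * b = 2 * (a * prod_encode (x, y) + b)"
      unfolding double_prod_encode[symmetric] by simp
    then show ?thesis by (simp only: mult_cancel1) simp
  qed
  show ?case (is "?L = ?R")
  proof
    assume ?L then show ?R
      using cgs by (auto simp: sat_bexs Binary.IH nth_env env_shift dbl[simplified])
  next
    assume R: ?R
    show ?L unfolding is_code.simps sat_bexs
      apply (rule exI[of _ "cval (\<lambda>i. e (i + n)) c"], rule conjI, use bd R in \<open>simp add: P_def\<close>)
      apply (rule exI[of _ "cval (\<lambda>i. e (i + n)) d"], rule conjI, use bd R in \<open>simp add: P_def\<close>)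
      using cgs R double_prod_encode[of "cval (\<lambda>i. e (i + n)) c" "cval (\<lambda>i. e (i + n)) d"]
      by (auto simp: Binary.IH nth_env env_shift algebra_simps)
  qed
qed

declare is_code.simps [simp del] bexs.simps [simp del]

lemma sat_has_code [simp]: "cgood c \<Longrightarrow> sat e E (z \<^bold>\<equiv> c) \<longleftrightarrow> eval e z = cval e c"
  by (simp add: sat_is_code)

lemma sat_elt [simp]: "sat e E (x \<^bold>\<epsilon> s) \<longleftrightarrow> eval e x \<in> set_decode (eval e s)"
proof -
  have "(\<exists>q<Suc s. \<exists>r<2 ^ x. s = (2 * q + 1) * 2 ^ x + r) \<longleftrightarrow> x \<in> set_decode s" for x s :: nat
  proof
    assume "\<exists>q<Suc s. \<exists>r<2 ^ x. s = (2 * q + 1) * 2 ^ x + r"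
    then obtain q r where "r < 2 ^ x" "s = (2 * q + 1) * 2 ^ x + r" by blast
    then have "s div 2 ^ x = 2 * q + 1"
      by (intro div_nat_eqI) (simp_all add: algebra_simps)
    then show "x \<in> set_decode s" by (simp add: set_decode_def)
  next
    assume "x \<in> set_decode s"
    then have "odd (s div 2 ^ x)" by (simp add: set_decode_def)
    then obtain q where q: "s div 2 ^ x = 2 * q + 1" by (metis oddE)
    have s: "s = (2 * q + 1) * 2 ^ x + s mod 2 ^ x" by (metis div_mult_mod_eq q)
    have "q \<le> s div 2 ^ x" using q by simp
    also have "\<dots> \<le> s" by simp
    finally show "\<exists>q<Suc s. \<exists>r<2 ^ x. s = (2 * q + 1) * 2 ^ x + r"
      using s by (metis less_Suc_eq_le mod_less_divisor zero_less_numeral zero_less_power)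
  qed
  from this[of "eval e s" "eval e x"] show ?thesis
    by (simp add: elt_def nth_env numeral_2_eq_2)
qed

definition pairn :: "nat \<Rightarrow> nat \<Rightarrow> nat" where "pairn m n = (m + n) * (m + n) + m"

lemma pairn_inj [simp]: "pairn a b = pairn c d \<longleftrightarrow> a = c \<and> b = d"
proof
  assume eq: "pairn a b = pairn c d"
  have *: "\<not> a + b < c + d" if "pairn a b = pairn c d" for a b c d
  proof
    assume "a + b < c + d"
    then have "Suc (a + b) * Suc (a + b) \<le> (c + d) * (c + d)"
      by (intro mult_le_mono) auto
    then show False using that unfolding pairn_def by simp
  qed
  from *[OF eq] *[OF eq[symmetric]] have "a + b = c + d" by simp
  with eq show "a = c \<and> b = d" by (simp add: pairn_def)
qed simp

lemma pairn_ge: "m \<le> pairn m n" "n \<le> pairn m n"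
  by (simp_all add: pairn_def algebra_simps) (metis le_add1 le_square mult.commute order_trans add.assoc le_add2)

definition tupn where "tupn i j k x y = pairn i (pairn j (pairn k (pairn x y)))"

lemma tupn_inj [simp]: "tupn i j k x y = tupn i' j' k' x' y' \<longleftrightarrow> i = i' \<and> j = j' \<and> k = k' \<and> x = x' \<and> y = y'"
  by (simp add: tupn_def)

lemma tupn_ge: "j \<le> tupn i j k x y" "k \<le> tupn i j k x y" "x \<le> tupn i j k x y" "y \<le> tupn i j k x y"
  unfolding tupn_def by (meson pairn_ge order_trans)+

lemma eval_pr [simp]: "eval e (pr t u) = pairn (eval e t) (eval e u)"
  by (simp add: pr_def pairn_def)

lemma eval_tup [simp]: "eval e (tup i j k x y) = tupn i (eval e j) (eval e k) (eval e x) (eval e y)"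
  by (simp add: tup_def tupn_def)

definition tm_stepH where
  "tm_stepH S j k x y \<longleftrightarrow> (x = 0 \<and> y = 0) \<or> (x = 1 \<and> y = 1) \<or>
    (\<exists>i\<le>x. x = 4 * i + 2 \<and> ((i < k \<and> y = x) \<or> (j = 0 \<and> \<not> i < k \<and> y = 4 * (i + 1) + 2) \<or>
       (j = y + 1 \<and> i = k) \<or> (j \<noteq> 0 \<and> k < i \<and> y + 4 = 4 * i + 2))) \<or>
    (\<exists>a\<le>x+y. \<exists>a'\<le>x+y. \<exists>b\<le>x+y. \<exists>b'\<le>x+y. tupn 0 j k a b \<in> S \<and>
      ((x = 4 * a + 3 \<and> y = 4 * b + 3) \<or>
       (tupn 0 j k a' b' \<in> S \<and>
         ((x = 4 * prod_encode (a, a') + 4 \<and> y = 4 * prod_encode (b, b') + 4) \<or>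
          (x = 4 * prod_encode (a, a') + 5 \<and> y = 4 * prod_encode (b, b') + 5)))))"

definition fm_stepH where
  "fm_stepH S j k x y \<longleftrightarrow>
    (\<exists>a\<le>x+y. \<exists>a'\<le>x+y. \<exists>b\<le>x+y. \<exists>b'\<le>x+y.
      (tupn 0 j k a b \<in> S \<and>
       ((x = 7 * prod_encode (a, a') + 2 \<and> y = 7 * prod_encode (b, a') + 2) \<or>
        (tupn 0 j k a' b' \<in> S \<and>
         ((x = 7 * prod_encode (a, a') \<and> y = 7 * prod_encode (b, b')) \<or>
          (x = 7 * prod_encode (a, a') + 1 \<and> y = 7 * prod_encode (b, b') + 1))))) \<or>
      (tupn 1 j k a b \<in> S \<and>
       ((x = 7 * a + 3 \<and> y = 7 * b + 3) \<or>
        (x = 7 * a + 6 \<and> y = 7 * b + 6) \<or>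
        (tupn 1 j k a' b' \<in> S \<and>
          x = 7 * prod_encode (a, a') + 4 \<and> y = 7 * prod_encode (b, b') + 4))) \<or>
      (x = 7 * a + 5 \<and> y = 7 * b + 5 \<and>
       ((j = 0 \<and> tupn 1 j (k + 1) a b \<in> S) \<or>
        (\<exists>t\<le>set_encode S. \<exists>t'\<le>set_encode S. j = t + 1 \<and> tupn 0 0 0 t t' \<in> S \<and>
           tupn 1 (t' + 1) (k + 1) a b \<in> S))))"

definition fmS_stepH where
  "fmS_stepH S j k x y \<longleftrightarrow>
    (\<exists>a\<le>x+y. \<exists>a'\<le>x+y. \<exists>b\<le>x+y. \<exists>b'\<le>x+y.
      (y = x \<and> (x = 7 * prod_encode (a, a') \<or> x = 7 * prod_encode (a, a') + 1)) \<or>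
      (x = 7 * prod_encode (a, a') + 2 \<and> y = 7 * prod_encode (a, b') + 2 \<and>
       ((a' < k \<and> b' = a') \<or> (j = 0 \<and> \<not> a' < k \<and> b' = a' + 1) \<or> (j = b' + 1 \<and> a' = k) \<or>
        (j \<noteq> 0 \<and> k < a' \<and> a' = b' + 1))) \<or>
      (tupn 2 j k a b \<in> S \<and>
       ((x = 7 * a + 3 \<and> y = 7 * b + 3) \<or>
        (x = 7 * a + 5 \<and> y = 7 * b + 5) \<or>
        (tupn 2 j k a' b' \<in> S \<and>
          x = 7 * prod_encode (a, a') + 4 \<and> y = 7 * prod_encode (b, b') + 4))) \<or>
      (x = 7 * a + 6 \<and> y = 7 * b + 6 \<and>
       ((j = 0 \<and> tupn 2 j (k + 1) a b \<in> S) \<or> (j \<noteq> 0 \<and> tupn 2 (j + 1) (k + 1) a b \<in> S))))"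

lemma env1: "case_nat a e (i + 1) = e i" "(4::nat) \<noteq> 0" "(7::nat) \<noteq> 0" by simp_all
lemmas sat_only = sat.simps eval.simps eval_num eval_pr eval_tup eval_subst sat_elt
  sat_has_code cval.simps cgood.simps Let_def sat_bexs nth_env env_shift
  pred_numeral_simps add_0_right BitM.simps simp_thms env1 numeral_eq_iff num.distinct num.inject
  zero_neq_numeral

lemma sat_tm_step: "sat e E (tm_step w j k x y) \<longleftrightarrow>
   tm_stepH (set_decode (eval e w)) (eval e j) (eval e k) (eval e x) (eval e y)"
  unfolding tm_step_def tm_stepH_def
  by (simp only: sat_only de_Morgan_conj not_not de_Morgan_disj set_decode_inverse)

lemma sat_fm_step: "sat e E (fm_step w j k x y) \<longleftrightarrow>
   fm_stepH (set_decode (eval e w)) (eval e j) (eval e k) (eval e x) (eval e y)"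
  unfolding fm_step_def fm_stepH_def
  by (simp only: sat_only de_Morgan_conj not_not de_Morgan_disj set_decode_inverse)

lemma sat_fmS_step: "sat e E (fmS_step w j k x y) \<longleftrightarrow>
   fmS_stepH (set_decode (eval e w)) (eval e j) (eval e k) (eval e x) (eval e y)"
  unfolding fmS_step_def fmS_stepH_def
  by (simp only: sat_only de_Morgan_conj not_not de_Morgan_disj set_decode_inverse)

definition okH :: "nat set \<Rightarrow> bool" where
  "okH S \<longleftrightarrow> (\<forall>u\<in>S. \<exists>j k x y. (u = tupn 0 j k x y \<and> tm_stepH S j k x y) \<or>
     (u = tupn 1 j k x y \<and> fm_stepH S j k x y) \<or> (u = tupn 2 j k x y \<and> fmS_stepH S j k x y))"

lemma set_decode_less: "x \<in> set_decode s \<Longrightarrow> x < s"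
proof -
  assume "x \<in> set_decode s"
  then have "s div 2 ^ x \<noteq> 0" unfolding set_decode_def by (metis (mono_tags, lifting) even_zero mem_Collect_eq)
  then have "2 ^ x \<le> s" by (metis div_less leI)
  then show "x < s" by (meson less_exp less_le_trans)
qed

lemma sat_subst_ok: "sat e E (subst_ok w) \<longleftrightarrow> okH (set_decode (eval e w))"
proof -
  have b: "(\<exists>j\<le>u. \<exists>k\<le>u. \<exists>x\<le>u. \<exists>y\<le>u. P j k x y) \<longleftrightarrow> (\<exists>j k x y. P j k x y)"
    if "\<And>j k x y. P j k x y \<Longrightarrow> \<exists>i. u = tupn i j k x y" for P :: "nat \<Rightarrow> nat \<Rightarrow> nat \<Rightarrow> nat \<Rightarrow> bool" and u
    using that tupn_ge by metis
  have "sat e E (subst_ok w) \<longleftrightarrow> (\<forall>u<eval e w. u \<in> set_decode (eval e w) \<longrightarrow>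
    (\<exists>j\<le>u. \<exists>k\<le>u. \<exists>x\<le>u. \<exists>y\<le>u.
     let S = set_decode (eval e w) in (u = tupn 0 j k x y \<and> tm_stepH S j k x y) \<or>
     (u = tupn 1 j k x y \<and> fm_stepH S j k x y) \<or> (u = tupn 2 j k x y \<and> fmS_stepH S j k x y)))"
    by (simp add: subst_ok_def Let_def sat_bexs nth_env env_shift sat_tm_step sat_fm_step sat_fmS_step)
  also have "\<dots> \<longleftrightarrow> okH (set_decode (eval e w))"
    unfolding okH_def Let_def by (subst b, blast) (use set_decode_less in blast)
  finally show ?thesis .
qed

definition "tdec = inv tcode"
lemma tdec [simp]: "tdec (tcode t) = t" "tcode (tdec n) = n"
  using bij_tcode by (simp_all add: tdec_def bij_is_inj bij_is_surj surj_f_inv_f)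

definition sg :: "nat \<Rightarrow> nat \<Rightarrow> nat \<Rightarrow> tm" where
  "sg j k i = (if i < k then Var i else if j = 0 then Var (Suc i)
     else if i = k then tdec (j - 1) else Var (i - 1))"
definition jl :: "nat \<Rightarrow> nat" where
  "jl j = (if j = 0 then 0 else Suc (tcode (lift_tm (tdec (j - 1)))))"
definition rh :: "nat \<Rightarrow> nat \<Rightarrow> nat \<Rightarrow> nat" where
  "rh j k i = (if i < k then i else if j = 0 then Suc i else if i = k then j - 1 else i - 1)"

lemma sg_up: "case_nat (Var 0) (\<lambda>i. lift_tm (sg j k i)) = sg (jl j) (Suc k)"
  by (rule ext) (auto simp: sg_def jl_def split: nat.split)
lemma rh_up: "case_nat 0 (\<lambda>i. Suc (rh j k i)) = rh (if j = 0 then 0 else Suc j) (Suc k)"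
  by (rule ext) (auto simp: rh_def split: nat.split)
lemma id_up: "case_nat 0 Suc = (\<lambda>n. n)" "case_nat (Var 0) (\<lambda>i. Var (Suc i)) = Var"
  by (rule ext, simp split: nat.split)+
lemma subst_Var: "subst_tm Var t = t" by (induction t) auto
lemma sg0: "sg 0 0 = (\<lambda>i. Var (Suc i))" "sg (Suc (tcode t)) 0 = case_nat t Var" "rh 0 0 = Suc"
  "rh (Suc n) 0 = case_nat n (\<lambda>m. m)"
  by (rule ext, auto simp: sg_def rh_def split: nat.split)+

abbreviation (input) "F0 j k \<equiv> subst_tm (sg j k)"
abbreviation (input) "F1 j k \<equiv> subst (sg j k) (\<lambda>n. n)"
abbreviation (input) "F2 j k \<equiv> subst Var (rh j k)"

lemma peq [simp]: "prod_encode p = prod_encode q \<longleftrightarrow> p = q"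
  using inj_prod_encode[of UNIV] by (auto simp: inj_on_def)

lemma tm_stepE:
  assumes "tm_stepH S j k x y"
  obtains (zero) "x = 0" "y = 0" | (unit) "x = 1" "y = 1"
  | (var) i where "x = 4 * i + 2" "y = tcode (sg j k i)"
  | (exp) a b where "tupn 0 j k a b \<in> S" "x = 4 * a + 3" "y = 4 * b + 3"
  | (add) a a' b b' where "tupn 0 j k a b \<in> S" "tupn 0 j k a' b' \<in> S"
      "x = 4 * prod_encode (a, a') + 4" "y = 4 * prod_encode (b, b') + 4"
  | (mul) a a' b b' where "tupn 0 j k a b \<in> S" "tupn 0 j k a' b' \<in> S"
      "x = 4 * prod_encode (a, a') + 5" "y = 4 * prod_encode (b, b') + 5"
proof -
  have "y = tcode (sg j k i)" if "x = 4 * i + 2"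
   "(i < k \<and> y = x) \<or> (j = 0 \<and> \<not> i < k \<and> y = 4 * (i + 1) + 2) \<or>
       (j = y + 1 \<and> i = k) \<or> (j \<noteq> 0 \<and> k < i \<and> y + 4 = 4 * i + 2)" for i
    using that(2)
  proof (elim disjE conjE)
    assume "j \<noteq> 0" "k < i" "y + 4 = 4 * i + 2"
    then show ?thesis by (auto simp: sg_def)
  qed (use that(1) in \<open>auto simp: sg_def\<close>)
  then show ?thesis using assms that unfolding tm_stepH_def by (elim exE conjE disjE) metis+
qed

lemma mod4:
  "4 * a + 2 \<noteq> 4 * b + (3::nat)" "4 * a + 2 \<noteq> 4 * b + (4::nat)" "4 * a + 2 \<noteq> 4 * b + (5::nat)"
  "4 * a + 3 \<noteq> 4 * b + (2::nat)" "4 * a + 3 \<noteq> 4 * b + (4::nat)" "4 * a + 3 \<noteq> 4 * b + (5::nat)"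
  "4 * a + 4 \<noteq> 4 * b + (2::nat)" "4 * a + 4 \<noteq> 4 * b + (3::nat)" "4 * a + 4 \<noteq> 4 * b + (5::nat)"
  "4 * a + 5 \<noteq> 4 * b + (2::nat)" "4 * a + 5 \<noteq> 4 * b + (3::nat)" "4 * a + 5 \<noteq> 4 * b + (4::nat)"
  "4 * a + 5 \<noteq> (1::nat)" "(1::nat) \<noteq> 4 * a + 5"
  by presburger+

lemma ok0: assumes "okH S" shows "tupn 0 j k (tcode t) y \<in> S \<Longrightarrow> y = tcode (F0 j k t)"
proof (induction t arbitrary: y)
  have st: "tm_stepH S j k x y" if "tupn 0 j k x y \<in> S" for x y
    using assms that unfolding okH_def by fastforce
  { case (Var x) from st[OF this] show ?case
      by (cases rule: tm_stepE) (simp_all only: tcode.simps mod4, auto)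
  next case Zero from st[OF this] show ?case by (cases rule: tm_stepE) auto
  next case Unit from st[OF this] show ?case by (cases rule: tm_stepE) auto
  next case (Add t u) from st[OF Add.prems] show ?case
      by (cases rule: tm_stepE) (simp_all only: tcode.simps mod4, auto dest: Add.IH)
  next case (Mul t u) from st[OF Mul.prems] show ?case
      by (cases rule: tm_stepE) (simp_all only: tcode.simps mod4, auto dest: Mul.IH)
  next case (Exp2 t) from st[OF Exp2.prems] show ?case
      by (cases rule: tm_stepE) (simp_all only: tcode.simps mod4, auto dest: Exp2.IH)
  }
qed

lemma okD:
  assumes "okH S"
  shows "tupn 0 j k x y \<in> S \<Longrightarrow> tm_stepH S j k x y"
    "tupn 1 j k x y \<in> S \<Longrightarrow> fm_stepH S j k x y"
    "tupn 2 j k x y \<in> S \<Longrightarrow> fmS_stepH S j k x y"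
  using assms unfolding okH_def by fastforce+

lemma ok0': "okH S \<Longrightarrow> tupn 0 j k a b \<in> S \<Longrightarrow> b = tcode (F0 j k (tdec a))"
  using ok0[of S j k "tdec a" b] by simp

lemma jl_eq: "okH S \<Longrightarrow> j = t + 1 \<Longrightarrow> tupn 0 0 0 t t' \<in> S \<Longrightarrow> t' + 1 = jl j"
  using ok0'[of S 0 0 t t'] by (simp add: jl_def sg0)

lemma code_mod7 [simp]:
  "(7 * a + 1) mod 7 = (1::nat)" "(7 * a + 2) mod 7 = (2::nat)" "(7 * a + 3) mod 7 = (3::nat)"
  "(7 * a + 4) mod 7 = (4::nat)" "(7 * a + 5) mod 7 = (5::nat)" "(7 * a + 6) mod 7 = (6::nat)"
  "Suc (7 * a) mod 7 = 1" "Suc (Suc (7 * a)) mod 7 = 2"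
  by presburger+

lemma cases7:
  "code (t \<^bold>= u) = 7 * p + i \<Longrightarrow> i < 7 \<Longrightarrow> i = 0 \<and> p = prod_encode (tcode t, tcode u)"
  "code (t \<^bold>< u) = 7 * p + i \<Longrightarrow> i < 7 \<Longrightarrow> i = 1 \<and> p = prod_encode (tcode t, tcode u)"
  "code (t \<^bold>\<in> n) = 7 * p + i \<Longrightarrow> i < 7 \<Longrightarrow> i = 2 \<and> p = prod_encode (tcode t, n)"
  "code (\<^bold>\<not> A) = 7 * p + i \<Longrightarrow> i < 7 \<Longrightarrow> i = 3 \<and> p = code A"
  "code (A \<^bold>\<and> B) = 7 * p + i \<Longrightarrow> i < 7 \<Longrightarrow> i = 4 \<and> p = prod_encode (code A, code B)"
  "code (\<^bold>\<forall> A) = 7 * p + i \<Longrightarrow> i < 7 \<Longrightarrow> i = 5 \<and> p = code A"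
  "code (\<^bold>\<forall>\<^sub>2 A) = 7 * p + i \<Longrightarrow> i < 7 \<Longrightarrow> i = 6 \<and> p = code A"
  by (simp_all, presburger+)

lemma fm_stepE:
  assumes "fm_stepH S j k x y"
  obtains (mem) a a' b where "tupn 0 j k a b \<in> S" "x = 7 * prod_encode (a, a') + 2" "y = 7 * prod_encode (b, a') + 2"
  | (eq) a a' b b' where "tupn 0 j k a b \<in> S" "tupn 0 j k a' b' \<in> S" "x = 7 * prod_encode (a, a') + 0" "y = 7 * prod_encode (b, b')"
  | (less) a a' b b' where "tupn 0 j k a b \<in> S" "tupn 0 j k a' b' \<in> S" "x = 7 * prod_encode (a, a') + 1" "y = 7 * prod_encode (b, b') + 1"
  | (neg) a b where "tupn 1 j k a b \<in> S" "x = 7 * a + 3" "y = 7 * b + 3"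
  | (allS) a b where "tupn 1 j k a b \<in> S" "x = 7 * a + 6" "y = 7 * b + 6"
  | (conj) a a' b b' where "tupn 1 j k a b \<in> S" "tupn 1 j k a' b' \<in> S" "x = 7 * prod_encode (a, a') + 4" "y = 7 * prod_encode (b, b') + 4"
  | (all0) a b where "x = 7 * a + 5" "y = 7 * b + 5" "j = 0" "tupn 1 j (k + 1) a b \<in> S"
  | (all1) a b t t' where "x = 7 * a + 5" "y = 7 * b + 5" "j = t + 1" "tupn 0 0 0 t t' \<in> S" "tupn 1 (t' + 1) (k + 1) a b \<in> S"
  using assms unfolding fm_stepH_def by (elim exE conjE disjE) simp_all

lemma fmS_stepE:
  assumes "fmS_stepH S j k x y"
  obtains (atom) a a' where "y = x" "x = 7 * prod_encode (a, a') \<or> x = 7 * prod_encode (a, a') + 1"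
  | (mem) a a' b' where "x = 7 * prod_encode (a, a') + 2" "y = 7 * prod_encode (a, b') + 2" "b' = rh j k a'"
  | (neg) a b where "tupn 2 j k a b \<in> S" "x = 7 * a + 3" "y = 7 * b + 3"
  | (all) a b where "tupn 2 j k a b \<in> S" "x = 7 * a + 5" "y = 7 * b + 5"
  | (conj) a a' b b' where "tupn 2 j k a b \<in> S" "tupn 2 j k a' b' \<in> S" "x = 7 * prod_encode (a, a') + 4" "y = 7 * prod_encode (b, b') + 4"
  | (allS) a b where "x = 7 * a + 6" "y = 7 * b + 6" "tupn 2 (if j = 0 then 0 else Suc j) (k + 1) a b \<in> S"
  using assms unfolding fmS_stepH_def
  apply (elim exE conjE disjE)
           apply (rule that(1), assumption, blast)
          apply (rule that(1), assumption, blast)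
         apply (rule that(2), assumption, assumption, simp add: rh_def)
        apply (rule that(2), assumption, assumption, simp add: rh_def)
       apply (rule that(2), assumption, assumption, simp add: rh_def)
      apply (rule that(2), assumption, assumption, simp add: rh_def)
     apply (rule that(3); assumption)
    apply (rule that(4); assumption)
   apply (rule that(5); assumption)
  apply (rule that(6), assumption, assumption, simp)
  apply (rule that(6), assumption, assumption, simp)
  done

lemma ok1: assumes ok: "okH S" shows "tupn 1 j k (code A) y \<in> S \<Longrightarrow> y = code (F1 j k A)"
proof (induction A arbitrary: j k y)
  case (Eq t u) from okD(2)[OF ok this] show ?case
  proof (cases rule: fm_stepE)
    case (eq a a' b b')
    then have "a = tcode t" "a' = tcode u" using cases7(1)[of t u "prod_encode (a, a')" 0] by simp_all
    then show ?thesis using eq ok0[OF ok, of j k t b] ok0[OF ok, of j k u b'] by simp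
  qed (drule arg_cong[where f="\<lambda>x. x mod 7"], simp)+
next
  case (Less t u) from okD(2)[OF ok this] show ?case
  proof (cases rule: fm_stepE)
    case (less a a' b b')
    then have "a = tcode t" "a' = tcode u" using cases7(2)[of t u "prod_encode (a, a')" 1] by simp_all
    then show ?thesis using less ok0[OF ok, of j k t b] ok0[OF ok, of j k u b'] by simp
  qed (drule arg_cong[where f="\<lambda>x. x mod 7"], simp)+
next
  case (Mem t n) from okD(2)[OF ok this] show ?case
  proof (cases rule: fm_stepE)
    case (mem a a' b)
    then have "a = tcode t" "a' = n" using cases7(3)[of t n "prod_encode (a, a')" 2] by simp_all
    then show ?thesis using mem ok0[OF ok, of j k t b] by simp
  qed (drule arg_cong[where f="\<lambda>x. x mod 7"], simp)+
next
  case (Neg A) from okD(2)[OF ok Neg.prems] show ?case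
  proof (cases rule: fm_stepE)
    case (neg a b)
    then have "a = code A" using cases7(4)[of A a 3] by simp
    then show ?thesis using neg Neg.IH[of j k b] by simp
  qed (drule arg_cong[where f="\<lambda>x. x mod 7"], simp)+
next
  case (And A B) from okD(2)[OF ok And.prems] show ?case
  proof (cases rule: fm_stepE)
    case (conj a a' b b')
    then have "a = code A" "a' = code B" using cases7(5)[of A B "prod_encode (a, a')" 4] by simp_all
    then show ?thesis using conj And.IH(1)[of j k b] And.IH(2)[of j k b'] by simp
  qed (drule arg_cong[where f="\<lambda>x. x mod 7"], simp)+
next
  case (AllS A) from okD(2)[OF ok AllS.prems] show ?case
  proof (cases rule: fm_stepE)
    case (allS a b)
    then have "a = code A" using cases7(7)[of A a 6] by simp
    then show ?thesis using allS AllS.IH[of j k b] by (simp add: id_up)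
  qed (drule arg_cong[where f="\<lambda>x. x mod 7"], simp)+
next
  case (All A)
  from okD(2)[OF ok All.prems] show ?case
  proof (cases rule: fm_stepE)
    case (all0 a b)
    then have "a = code A" using cases7(6)[of A a 5] by simp
    then show ?thesis using all0 All.IH[of j "k+1" b] by (simp add: sg_up jl_def)
  next
    case (all1 a b t t')
    then have "a = code A" using cases7(6)[of A a 5] by simp
    then show ?thesis using all1 All.IH[of "t'+1" "k+1" b] jl_eq[OF ok all1(3,4)] by (simp add: sg_up)
  qed (drule arg_cong[where f="\<lambda>x. x mod 7"], simp)+
qed

lemma ok2: assumes ok: "okH S" shows "tupn 2 j k (code A) y \<in> S \<Longrightarrow> y = code (F2 j k A)"
proof (induction A arbitrary: j k y)
  case (Eq t u) from okD(3)[OF ok this] show ?case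
  proof (cases rule: fmS_stepE)
    case atom then show ?thesis by (simp add: subst_Var)
  qed (drule arg_cong[where f="\<lambda>x. x mod 7"], simp)+
next
  case (Less t u) from okD(3)[OF ok this] show ?case
  proof (cases rule: fmS_stepE)
    case atom then show ?thesis by (simp add: subst_Var)
  qed (drule arg_cong[where f="\<lambda>x. x mod 7"], simp)+
next
  case (Mem t n) from okD(3)[OF ok this] show ?case
  proof (cases rule: fmS_stepE)
    case (atom a a')
    from atom(2) show ?thesis
      by (elim disjE; drule_tac f="\<lambda>x. x mod 7" in arg_cong; simp)
  next
    case (mem a a' b')
    then have "a = tcode t" "a' = n" using cases7(3)[of t n "prod_encode (a, a')" 2] by simp_all
    then show ?thesis using mem by (simp add: subst_Var)
  qed (drule arg_cong[where f="\<lambda>x. x mod 7"], simp)+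
next
  case (Neg A) from okD(3)[OF ok Neg.prems] show ?case
  proof (cases rule: fmS_stepE)
    case (atom a a')
    from atom(2) show ?thesis
      by (elim disjE; drule_tac f="\<lambda>x. x mod 7" in arg_cong; simp)
  next
    case (neg a b)
    then have "a = code A" using cases7(4)[of A a 3] by simp
    then show ?thesis using neg Neg.IH[of j k b] by simp
  qed (drule arg_cong[where f="\<lambda>x. x mod 7"], simp)+
next
  case (And A B) from okD(3)[OF ok And.prems] show ?case
  proof (cases rule: fmS_stepE)
    case (atom a a')
    from atom(2) show ?thesis
      by (elim disjE; drule_tac f="\<lambda>x. x mod 7" in arg_cong; simp)
  next
    case (conj a a' b b')
    then have "a = code A" "a' = code B" using cases7(5)[of A B "prod_encode (a, a')" 4] by simp_all
    then show ?thesis using conj And.IH(1)[of j k b] And.IH(2)[of j k b'] by simp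
  qed (drule arg_cong[where f="\<lambda>x. x mod 7"], simp)+
next
  case (All A) from okD(3)[OF ok All.prems] show ?case
  proof (cases rule: fmS_stepE)
    case (atom a a')
    from atom(2) show ?thesis
      by (elim disjE; drule_tac f="\<lambda>x. x mod 7" in arg_cong; simp)
  next
    case (all a b)
    then have "a = code A" using cases7(6)[of A a 5] by simp
    then show ?thesis using all All.IH[of j k b] by (simp add: id_up)
  qed (drule arg_cong[where f="\<lambda>x. x mod 7"], simp)+
next
  case (AllS A) from okD(3)[OF ok AllS.prems] show ?case
  proof (cases rule: fmS_stepE)
    case (atom a a')
    from atom(2) show ?thesis
      by (elim disjE; drule_tac f="\<lambda>x. x mod 7" in arg_cong; simp)
  next
    case (allS a b)
    then have "a = code A" using cases7(7)[of A a 6] by simp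
    then show ?thesis using allS AllS.IH[of "if j = 0 then 0 else Suc j" "k + 1" b] by (simp add: rh_up)
  qed (drule arg_cong[where f="\<lambda>x. x mod 7"], simp)+
qed

lemma mem_set_encode: "finite S \<Longrightarrow> u \<in> S \<Longrightarrow> u < set_encode S"
  using set_decode_less[of u "set_encode S"] by (simp add: set_encode_inverse)

lemma fm_stepH_iff: "finite S \<Longrightarrow> fm_stepH S j k x y \<longleftrightarrow>
    (\<exists>a\<le>x+y. \<exists>a'\<le>x+y. \<exists>b\<le>x+y. \<exists>b'\<le>x+y.
      (tupn 0 j k a b \<in> S \<and>
       ((x = 7 * prod_encode (a, a') + 2 \<and> y = 7 * prod_encode (b, a') + 2) \<or>
        (tupn 0 j k a' b' \<in> S \<and>
         ((x = 7 * prod_encode (a, a') \<and> y = 7 * prod_encode (b, b')) \<or>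
          (x = 7 * prod_encode (a, a') + 1 \<and> y = 7 * prod_encode (b, b') + 1))))) \<or>
      (tupn 1 j k a b \<in> S \<and>
       ((x = 7 * a + 3 \<and> y = 7 * b + 3) \<or>
        (x = 7 * a + 6 \<and> y = 7 * b + 6) \<or>
        (tupn 1 j k a' b' \<in> S \<and>
          x = 7 * prod_encode (a, a') + 4 \<and> y = 7 * prod_encode (b, b') + 4))) \<or>
      (x = 7 * a + 5 \<and> y = 7 * b + 5 \<and>
       ((j = 0 \<and> tupn 1 j (k + 1) a b \<in> S) \<or>
        (\<exists>t t'. j = t + 1 \<and> tupn 0 0 0 t t' \<in> S \<and> tupn 1 (t' + 1) (k + 1) a b \<in> S))))"
proof -
  assume S: "finite S"
  have "(\<exists>t\<le>set_encode S. \<exists>t'\<le>set_encode S. j = t + 1 \<and> tupn 0 0 0 t t' \<in> S \<and> Q t t')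
     \<longleftrightarrow> (\<exists>t t'. j = t + 1 \<and> tupn 0 0 0 t t' \<in> S \<and> Q t t')" for Q :: "nat \<Rightarrow> nat \<Rightarrow> bool"
  proof (intro iffI, blast, elim exE conjE)
    fix t t' assume t: "j = t + 1" "tupn 0 0 0 t t' \<in> S" "Q t t'"
    then have "t \<le> set_encode S" "t' \<le> set_encode S"
      using mem_set_encode[OF S t(2)] tupn_ge(3)[of t 0 0 0 t'] tupn_ge(4)[of t' 0 0 0 t] by linarith+
    then show "\<exists>t\<le>set_encode S. \<exists>t'\<le>set_encode S. j = t + 1 \<and> tupn 0 0 0 t t' \<in> S \<and> Q t t'" using t by blast
  qed
  then show ?thesis unfolding fm_stepH_def by (simp only:)
qed

lemma step_mono:
  assumes "S \<subseteq> S'" "finite S'"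
  shows "tm_stepH S j k x y \<Longrightarrow> tm_stepH S' j k x y"
    "fm_stepH S j k x y \<Longrightarrow> fm_stepH S' j k x y"
    "fmS_stepH S j k x y \<Longrightarrow> fmS_stepH S' j k x y"
proof -
  have *: "u \<in> S \<Longrightarrow> u \<in> S'" for u using assms by blast
  have f: "finite S" using assms finite_subset by blast
  have m: "(P \<longrightarrow> P') \<Longrightarrow> (Q \<longrightarrow> Q') \<Longrightarrow> P \<and> Q \<longrightarrow> P' \<and> Q'"
    "(P \<longrightarrow> P') \<Longrightarrow> (Q \<longrightarrow> Q') \<Longrightarrow> P \<or> Q \<longrightarrow> P' \<or> Q'" for P P' Q Q' by auto
  have e: "(\<And>a. P a \<longrightarrow> P' a) \<Longrightarrow> (\<exists>a. P a) \<longrightarrow> (\<exists>a. P' a)" for P P' :: "nat \<Rightarrow> bool" by blast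
  have t: "u \<in> S \<longrightarrow> u \<in> S'" for u using * by blast
  show "tm_stepH S j k x y \<Longrightarrow> tm_stepH S' j k x y"
    unfolding tm_stepH_def by (erule rev_mp) (intro m e t imp_refl)
  show "fm_stepH S j k x y \<Longrightarrow> fm_stepH S' j k x y"
    unfolding fm_stepH_iff[OF f] fm_stepH_iff[OF assms(2)] by (erule rev_mp) (intro m e t imp_refl)
  show "fmS_stepH S j k x y \<Longrightarrow> fmS_stepH S' j k x y"
    unfolding fmS_stepH_def by (erule rev_mp) (intro m e t imp_refl)
qed

lemma okH_Un: assumes "okH S" "okH S'" "finite S" "finite S'" shows "okH (S \<union> S')"
  unfolding okH_def
proof
  fix u assume "u \<in> S \<union> S'"
  then obtain R where R: "R \<subseteq> S \<union> S'" "okH R" "u \<in> R" using assms by blast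
  have "finite (S \<union> S')" using assms by simp
  with R show "\<exists>j k x y. u = tupn 0 j k x y \<and> tm_stepH (S \<union> S') j k x y \<or>
    u = tupn 1 j k x y \<and> fm_stepH (S \<union> S') j k x y \<or> u = tupn 2 j k x y \<and> fmS_stepH (S \<union> S') j k x y"
    unfolding okH_def using step_mono[OF R(1)] by meson
qed

lemma okH_insert: assumes "okH S" "finite S"
  "tm_stepH S j k x y \<and> i = 0 \<or> fm_stepH S j k x y \<and> i = 1 \<or> fmS_stepH S j k x y \<and> i = 2"
  shows "okH (insert (tupn i j k x y) S)"
proof -
  define S' where "S' = insert (tupn i j k x y) S"
  have mono: "S \<subseteq> S'" "finite S'" using assms by (auto simp: S'_def)
  have "\<exists>j k x y. (u = tupn 0 j k x y \<and> tm_stepH S' j k x y) \<or>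
    (u = tupn 1 j k x y \<and> fm_stepH S' j k x y) \<or> (u = tupn 2 j k x y \<and> fmS_stepH S' j k x y)"
    if "u \<in> S'" for u
  proof -
    from that consider "u = tupn i j k x y" | "u \<in> S" by (auto simp: S'_def)
    then show ?thesis
    proof cases
      case 1
      have "(u = tupn 0 j k x y \<and> tm_stepH S' j k x y) \<or>
        (u = tupn 1 j k x y \<and> fm_stepH S' j k x y) \<or> (u = tupn 2 j k x y \<and> fmS_stepH S' j k x y)"
        using 1 assms(3) step_mono[OF mono, of j k x y] by blast
      then show ?thesis by blast
    next
      case 2 then show ?thesis using assms(1) step_mono[OF mono] unfolding okH_def by meson
    qed
  qed
  then show ?thesis unfolding okH_def S'_def by blast
qed

definition good :: "nat set \<Rightarrow> bool" where "good S \<longleftrightarrow> finite S \<and> okH S"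

lemma good_empty: "good {}" by (simp add: good_def okH_def)
lemma good_Un: "good S \<Longrightarrow> good S' \<Longrightarrow> good (S \<union> S')" by (simp add: good_def okH_Un)
lemma good_add: "good S \<Longrightarrow>
  tm_stepH S j k x y \<and> i = 0 \<or> fm_stepH S j k x y \<and> i = 1 \<or> fmS_stepH S j k x y \<and> i = 2
  \<Longrightarrow> \<exists>S. good S \<and> tupn i j k x y \<in> S"
proof -
  assume "good S" and a: "tm_stepH S j k x y \<and> i = 0 \<or> fm_stepH S j k x y \<and> i = 1 \<or> fmS_stepH S j k x y \<and> i = 2"
  then have "okH S" "finite S" by (simp_all add: good_def)
  from okH_insert[OF this a] \<open>finite S\<close> have "good (insert (tupn i j k x y) S)" unfolding good_def by blast
  then show ?thesis by blast
qed

lemma two: "\<exists>S. good S \<and> u \<in> S \<Longrightarrow> \<exists>S. good S \<and> v \<in> S \<Longrightarrow> \<exists>S. good S \<and> u \<in> S \<and> v \<in> S"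
  using good_Un by blast

lemma bd: "a \<le> 7 * prod_encode (a, b) + i" "b \<le> 7 * prod_encode (a, b) + i" "a \<le> 7 * a + i"
  "a \<le> 4 * prod_encode (a, b) + i" "b \<le> 4 * prod_encode (a, b) + i" "a \<le> 4 * a + i"
  using prod_encode_ge(1)[of a b] prod_encode_ge(2)[of b a] by linarith+

lemma ex4: "a \<le> (x::nat) \<Longrightarrow> a' \<le> x \<Longrightarrow> b \<le> y \<Longrightarrow> b' \<le> y \<Longrightarrow> P a a' b b' \<Longrightarrow>
  \<exists>a\<le>x+y. \<exists>a'\<le>x+y. \<exists>b\<le>x+y. \<exists>b'\<le>x+y. P a a' b b'"
  by (meson trans_le_add1 trans_le_add2)

lemma tm_stepI:
  "tupn 0 j k a b \<in> S \<Longrightarrow> tm_stepH S j k (4 * a + 3) (4 * b + 3)"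
  "tupn 0 j k a b \<in> S \<Longrightarrow> tupn 0 j k a' b' \<in> S \<Longrightarrow>
    tm_stepH S j k (4 * prod_encode (a, a') + 4) (4 * prod_encode (b, b') + 4)"
  "tupn 0 j k a b \<in> S \<Longrightarrow> tupn 0 j k a' b' \<in> S \<Longrightarrow>
    tm_stepH S j k (4 * prod_encode (a, a') + 5) (4 * prod_encode (b, b') + 5)"
  unfolding tm_stepH_def
  subgoal by (intro disjI2, rule ex4[of a _ 0 b _ 0]) (simp_all add: bd)
  subgoal by (intro disjI2, rule ex4[of a _ a' b _ b']) (simp_all only: bd simp_thms)
  subgoal by (intro disjI2, rule ex4[of a _ a' b _ b']) (simp_all only: bd simp_thms)
  done

lemma fm_stepI:
  assumes "finite S"
  shows
  "tupn 0 j k a b \<in> S \<Longrightarrow> fm_stepH S j k (7 * prod_encode (a, a') + 2) (7 * prod_encode (b, a') + 2)"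
  "tupn 0 j k a b \<in> S \<Longrightarrow> tupn 0 j k a' b' \<in> S \<Longrightarrow>
    fm_stepH S j k (7 * prod_encode (a, a')) (7 * prod_encode (b, b'))"
  "tupn 0 j k a b \<in> S \<Longrightarrow> tupn 0 j k a' b' \<in> S \<Longrightarrow>
    fm_stepH S j k (7 * prod_encode (a, a') + 1) (7 * prod_encode (b, b') + 1)"
  "tupn 1 j k a b \<in> S \<Longrightarrow> fm_stepH S j k (7 * a + 3) (7 * b + 3)"
  "tupn 1 j k a b \<in> S \<Longrightarrow> fm_stepH S j k (7 * a + 6) (7 * b + 6)"
  "tupn 1 j k a b \<in> S \<Longrightarrow> tupn 1 j k a' b' \<in> S \<Longrightarrow>
    fm_stepH S j k (7 * prod_encode (a, a') + 4) (7 * prod_encode (b, b') + 4)"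
  "j = 0 \<and> tupn 1 j (k + 1) a b \<in> S \<or>
    (\<exists>t t'. j = t + 1 \<and> tupn 0 0 0 t t' \<in> S \<and> tupn 1 (t' + 1) (k + 1) a b \<in> S) \<Longrightarrow>
    fm_stepH S j k (7 * a + 5) (7 * b + 5)"
  unfolding fm_stepH_iff[OF assms]
  subgoal by (rule ex4[of a _ a' b _ 0]) (simp_all only: bd simp_thms le0)
  subgoal by (rule ex4[of a _ a' b _ b']) (simp_all only: bd bd[where i = 0, simplified] simp_thms)
  subgoal by (rule ex4[of a _ a' b _ b']) (simp_all only: bd simp_thms)
  subgoal by (rule ex4[of a _ 0 b _ 0]) (simp_all only: bd simp_thms le0)
  subgoal by (rule ex4[of a _ 0 b _ 0]) (simp_all only: bd simp_thms le0)
  subgoal by (rule ex4[of a _ a' b _ b']) (simp_all only: bd simp_thms)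
  subgoal by (rule ex4[of a _ 0 b _ 0]) (simp_all only: bd simp_thms le0)
  done

lemma fmS_stepI:
  "fmS_stepH S j k (7 * prod_encode (a, a')) (7 * prod_encode (a, a'))"
  "fmS_stepH S j k (7 * prod_encode (a, a') + 1) (7 * prod_encode (a, a') + 1)"
  "fmS_stepH S j k (7 * prod_encode (a, a') + 2) (7 * prod_encode (a, rh j k a') + 2)"
  "tupn 2 j k a b \<in> S \<Longrightarrow> fmS_stepH S j k (7 * a + 3) (7 * b + 3)"
  "tupn 2 j k a b \<in> S \<Longrightarrow> fmS_stepH S j k (7 * a + 5) (7 * b + 5)"
  "tupn 2 j k a b \<in> S \<Longrightarrow> tupn 2 j k a' b' \<in> S \<Longrightarrow>
    fmS_stepH S j k (7 * prod_encode (a, a') + 4) (7 * prod_encode (b, b') + 4)"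
  "tupn 2 (if j = 0 then 0 else Suc j) (k + 1) a b \<in> S \<Longrightarrow> fmS_stepH S j k (7 * a + 6) (7 * b + 6)"
  unfolding fmS_stepH_def
  subgoal by (rule ex4[of a _ a' 0 _ 0]) (simp_all only: bd bd[where i = 0, simplified] simp_thms le0)
  subgoal by (rule ex4[of a _ a' 0 _ 0]) (simp_all only: bd simp_thms le0)
  subgoal by (rule ex4[of a _ a' 0 _ "rh j k a'"]) (simp_all only: bd simp_thms le0, auto simp: rh_def)
  subgoal by (rule ex4[of a _ 0 b _ 0]) (simp_all only: bd simp_thms le0)
  subgoal by (rule ex4[of a _ 0 b _ 0]) (simp_all only: bd simp_thms le0)
  subgoal by (rule ex4[of a _ a' b _ b']) (simp_all only: bd simp_thms)
  subgoal by (rule ex4[of a _ 0 b _ 0]) (simp_all add: bd split: if_splits)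
  done

lemma ex0: "\<exists>S. good S \<and> tupn 0 j k (tcode t) (tcode (F0 j k t)) \<in> S"
proof (induction t)
  case (Var i)
  have "sg j k i = Var i \<and> i < k \<or> sg j k i = Var (Suc i) \<and> j = 0 \<and> \<not> i < k \<or>
    tcode (sg j k i) = j - 1 \<and> j \<noteq> 0 \<and> i = k \<or> sg j k i = Var (i - 1) \<and> j \<noteq> 0 \<and> k < i"
    by (auto simp: sg_def)
  then have "tm_stepH {} j k (tcode (Var i)) (tcode (F0 j k (Var i)))"
    unfolding tm_stepH_def by (intro disjI2 disjI1 exI[of _ i]) auto
  then show ?case using good_add[OF good_empty] by blast
next
  case Zero
  have "tm_stepH {} j k (tcode Zero) (tcode (F0 j k Zero))" by (simp add: tm_stepH_def)
  then show ?case using good_add[OF good_empty] by blast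
next
  case Unit
  have "tm_stepH {} j k (tcode Unit) (tcode (F0 j k Unit))" by (simp add: tm_stepH_def)
  then show ?case using good_add[OF good_empty] by blast
next
  case (Add t u)
  obtain S where S: "good S" "tupn 0 j k (tcode t) (tcode (F0 j k t)) \<in> S" "tupn 0 j k (tcode u) (tcode (F0 j k u)) \<in> S"
    using two[OF Add.IH] by blast
  show ?case using good_add[OF S(1)] tm_stepI(2)[OF S(2,3)] by simp
next
  case (Mul t u)
  obtain S where S: "good S" "tupn 0 j k (tcode t) (tcode (F0 j k t)) \<in> S" "tupn 0 j k (tcode u) (tcode (F0 j k u)) \<in> S"
    using two[OF Mul.IH] by blast
  show ?case using good_add[OF S(1)] tm_stepI(3)[OF S(2,3)] by simp
next
  case (Exp2 t)
  then obtain S where S: "good S" "tupn 0 j k (tcode t) (tcode (F0 j k t)) \<in> S" by blast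
  show ?case using good_add[OF S(1)] tm_stepI(1)[OF S(2)] by simp
qed

lemma goodD: "good S \<Longrightarrow> finite S" by (simp add: good_def)
lemmas add1 = good_add[OF _ disjI2, OF _ disjI1, OF _ conjI, OF _ _ refl]
lemmas add2 = good_add[OF _ disjI2, OF _ disjI2, OF _ conjI, OF _ _ refl]

lemma ex1: "\<exists>S. good S \<and> tupn 1 j k (code A) (code (F1 j k A)) \<in> S"
proof (induction A arbitrary: j k)
  case (Eq t u)
  obtain S where S: "good S" "tupn 0 j k (tcode t) (tcode (F0 j k t)) \<in> S" "tupn 0 j k (tcode u) (tcode (F0 j k u)) \<in> S"
    using two[OF ex0 ex0] by blast
  show ?case using add1[OF S(1) fm_stepI(2)[OF goodD[OF S(1)] S(2,3)]] by simp
next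
  case (Less t u)
  obtain S where S: "good S" "tupn 0 j k (tcode t) (tcode (F0 j k t)) \<in> S" "tupn 0 j k (tcode u) (tcode (F0 j k u)) \<in> S"
    using two[OF ex0 ex0] by blast
  show ?case using add1[OF S(1) fm_stepI(3)[OF goodD[OF S(1)] S(2,3)]] by simp
next
  case (Mem t n)
  obtain S where S: "good S" "tupn 0 j k (tcode t) (tcode (F0 j k t)) \<in> S" using ex0 by blast
  show ?case using add1[OF S(1) fm_stepI(1)[OF goodD[OF S(1)] S(2), of n]] by simp
next
  case (Neg A)
  obtain S where S: "good S" "tupn 1 j k (code A) (code (F1 j k A)) \<in> S" using Neg by blast
  show ?case using add1[OF S(1) fm_stepI(4)[OF goodD[OF S(1)] S(2)]] by simp
next
  case (And A B)
  obtain S where S: "good S" "tupn 1 j k (code A) (code (F1 j k A)) \<in> S" "tupn 1 j k (code B) (code (F1 j k B)) \<in> S"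
    using two[OF And.IH(1) And.IH(2)] by blast
  show ?case using add1[OF S(1) fm_stepI(6)[OF goodD[OF S(1)] S(2,3)]] by simp
next
  case (AllS A)
  obtain S where S: "good S" "tupn 1 j k (code A) (code (F1 j k A)) \<in> S" using AllS by blast
  show ?case using add1[OF S(1) fm_stepI(5)[OF goodD[OF S(1)] S(2)]] by (simp add: id_up)
next
  case (All A)
  obtain S where S: "good S" "tupn 0 0 0 (j - 1) (tcode (F0 0 0 (tdec (j - 1)))) \<in> S"
     "tupn 1 (jl j) (k + 1) (code A) (code (F1 (jl j) (k + 1) A)) \<in> S"
    using two[OF ex0[of 0 0 "tdec (j - 1)"] All.IH] by auto
  have "j = 0 \<and> tupn 1 j (k + 1) (code A) (code (F1 (jl j) (k + 1) A)) \<in> S \<or>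
    (\<exists>t t'. j = t + 1 \<and> tupn 0 0 0 t t' \<in> S \<and> tupn 1 (t' + 1) (k + 1) (code A) (code (F1 (jl j) (k + 1) A)) \<in> S)"
  proof (cases "j = 0")
    case True then show ?thesis using S(3) by (simp add: jl_def)
  next
    case False
    have "j = (j - 1) + 1" using False by simp
    moreover have "jl j = tcode (F0 0 0 (tdec (j - 1))) + 1" using False by (simp add: jl_def sg0)
    ultimately show ?thesis using S(2,3) by metis
  qed
  from add1[OF S(1) fm_stepI(7)[OF goodD[OF S(1)] this]] show ?case by (simp add: sg_up)
qed

lemma ex2: "\<exists>S. good S \<and> tupn 2 j k (code A) (code (F2 j k A)) \<in> S"
proof (induction A arbitrary: j k)
  case (Eq t u)
  show ?case using add2[OF good_empty fmS_stepI(1)] by (simp add: subst_Var)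
next
  case (Less t u)
  show ?case using add2[OF good_empty fmS_stepI(2)] by (simp add: subst_Var)
next
  case (Mem t n)
  show ?case using add2[OF good_empty fmS_stepI(3)] by (simp add: subst_Var)
next
  case (Neg A)
  obtain S where S: "good S" "tupn 2 j k (code A) (code (F2 j k A)) \<in> S" using Neg by blast
  show ?case using add2[OF S(1) fmS_stepI(4)[OF S(2)]] by simp
next
  case (And A B)
  obtain S where S: "good S" "tupn 2 j k (code A) (code (F2 j k A)) \<in> S" "tupn 2 j k (code B) (code (F2 j k B)) \<in> S"
    using two[OF And.IH(1) And.IH(2)] by blast
  show ?case using add2[OF S(1) fmS_stepI(6)[OF S(2,3)]] by simp
next
  case (All A)
  obtain S where S: "good S" "tupn 2 j k (code A) (code (F2 j k A)) \<in> S" using All by blast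
  show ?case using add2[OF S(1) fmS_stepI(5)[OF S(2)]] by (simp add: id_up)
next
  case (AllS A)
  obtain S where S: "good S" "tupn 2 (if j = 0 then 0 else Suc j) (k + 1) (code A) (code (F2 (if j = 0 then 0 else Suc j) (k + 1) A)) \<in> S"
    using AllS by blast
  show ?case using add2[OF S(1) fmS_stepI(7)[OF S(2)]] by (simp add: rh_up)
qed

definition impn :: "nat \<Rightarrow> nat \<Rightarrow> nat" where
  "impn a b = 7 * (7 * prod_encode (a, 7 * b + 3) + 4) + 3"

lemma code_Imp: "code (A \<^bold>\<longrightarrow> B) = impn (code A) (code B)" by (simp add: impn_def)

definition schemeP where
  "schemeP S y a b c t u \<longleftrightarrow>
    y = impn a (impn b a) \<or>
    y = impn (impn a (impn b c)) (impn (impn a b) (impn a c)) \<or>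
    y = impn (impn (7 * a + 3) (7 * b + 3)) (impn b a) \<or>
    y = impn (7 * prod_encode (a, b) + 4) a \<or>
    y = impn (7 * prod_encode (a, b) + 4) b \<or>
    y = impn a (impn b (7 * prod_encode (a, b) + 4)) \<or>
    (y = impn (7 * a + 5) b \<and> tupn 1 (t + 1) 0 a b \<in> S) \<or>
    y = impn (7 * impn a b + 5) (impn (7 * a + 5) (7 * b + 5)) \<or>
    (y = impn a (7 * b + 5) \<and> tupn 1 0 0 a b \<in> S) \<or>
    (y = impn (7 * a + 6) b \<and> tupn 2 (t + 1) 0 a b \<in> S) \<or>
    y = impn (7 * impn a b + 6) (impn (7 * a + 6) (7 * b + 6)) \<or>
    (y = impn a (7 * b + 6) \<and> tupn 2 0 0 a b \<in> S) \<or>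
    y = 7 * prod_encode (t, t) + 0 \<or>
    (y = impn (7 * prod_encode (t, u) + 0) (impn b c) \<and>
      tupn 1 (t + 1) 0 a b \<in> S \<and> tupn 1 (u + 1) 0 a c \<in> S)"

definition schemeH where
  "schemeH S y \<longleftrightarrow> (\<exists>a\<le>set_encode S + y. \<exists>b\<le>set_encode S + y. \<exists>c\<le>set_encode S + y.
     \<exists>t\<le>set_encode S + y. \<exists>u\<le>set_encode S + y. schemeP S y a b c t u)"

lemma e7: "(3::nat) \<noteq> 0" by simp

lemma sat_is_scheme: "sat e E (is_scheme w y) \<longleftrightarrow> schemeH (set_decode (eval e w)) (eval e y)"
  unfolding is_scheme_def schemeH_def schemeP_def impn_def
  by (simp only: sat_only de_Morgan_conj not_not de_Morgan_disj set_decode_inverse)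

definition "cdec = inv code"
lemma cdec [simp]: "cdec (code t) = t" "code (cdec n) = n"
  using bij_code by (simp_all add: cdec_def bij_is_inj bij_is_surj surj_f_inv_f)

lemma ok1': "okH S \<Longrightarrow> tupn 1 j k (code A) (code B) \<in> S \<Longrightarrow> B = F1 j k A"
  using ok1[of S j k A] by fastforce
lemma ok2': "okH S \<Longrightarrow> tupn 2 j k (code A) (code B) \<in> S \<Longrightarrow> B = F2 j k A"
  using ok2[of S j k A] by fastforce

lemma schemeH_sound: assumes ok: "okH S" and "schemeH S y" shows "scheme (cdec y)"
proof -
  obtain a b c t u where P: "schemeP S y a b c t u" using assms(2) unfolding schemeH_def by blast
  define A B C where "A = cdec a" "B = cdec b" "C = cdec c"
  define t' u' where "t' = tdec t" "u' = tdec u"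
  have eqs: "a = code A" "b = code B" "c = code C" "t = tcode t'" "u = tcode u'"
    by (simp_all add: A_B_C_def t'_u'_def)
  have "\<exists>X. y = code X \<and> scheme X"
    using P unfolding schemeP_def eqs
  proof (elim disjE conjE)
    assume "y = impn (7 * code A + 5) (code B)" "tupn 1 (tcode t' + 1) 0 (code A) (code B) \<in> S"
    with ok1'[OF ok this(2)] show ?thesis using scheme.intros(7)[of A t']
      by (intro exI[of _ "(\<^bold>\<forall> A) \<^bold>\<longrightarrow> inst t' A"]) (simp add: code_Imp[symmetric] sg0 impn_def)
  next
    assume "y = impn (code A) (7 * code B + 5)" "tupn 1 0 0 (code A) (code B) \<in> S"
    with ok1'[OF ok this(2)] show ?thesis using scheme.intros(9)[of A]
      by (intro exI[of _ "A \<^bold>\<longrightarrow> (\<^bold>\<forall> lift A)"]) (simp add: sg0 impn_def)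
  next
    assume "y = impn (7 * code A + 6) (code B)" "tupn 2 (tcode t' + 1) 0 (code A) (code B) \<in> S"
    with ok2'[OF ok this(2)] show ?thesis using scheme.intros(10)[of A "tcode t'"]
      by (intro exI[of _ "(\<^bold>\<forall>\<^sub>2 A) \<^bold>\<longrightarrow> instS (tcode t') A"]) (simp add: sg0 impn_def)
  next
    assume "y = impn (code A) (7 * code B + 6)" "tupn 2 0 0 (code A) (code B) \<in> S"
    with ok2'[OF ok this(2)] show ?thesis using scheme.intros(12)[of A]
      by (intro exI[of _ "A \<^bold>\<longrightarrow> (\<^bold>\<forall>\<^sub>2 liftS A)"]) (simp add: sg0 impn_def)
  next
    assume "y = impn (7 * prod_encode (tcode t', tcode u') + 0) (impn (code B) (code C))"
      "tupn 1 (tcode t' + 1) 0 (code A) (code B) \<in> S" "tupn 1 (tcode u' + 1) 0 (code A) (code C) \<in> S"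
    with ok1'[OF ok this(2)] ok1'[OF ok this(3)] show ?thesis using scheme.intros(14)[of t' u' A]
      by (intro exI[of _ "t' \<^bold>= u' \<^bold>\<longrightarrow> inst t' A \<^bold>\<longrightarrow> inst u' A"]) (simp add: sg0 impn_def)
  next
    assume y: "y = impn (code A) (impn (code B) (code A))"
    show ?thesis using y scheme.intros(1)[of A B] by (metis code_Imp)
  next
    assume y: "y = impn (impn (code A) (impn (code B) (code C))) (impn (impn (code A) (code B)) (impn (code A) (code C)))"
    show ?thesis using y scheme.intros(2)[of A B C] by (metis code_Imp)
  next
    assume y: "y = impn (impn (7 * code A + 3) (7 * code B + 3)) (impn (code B) (code A))"
    show ?thesis using y scheme.intros(3)[of A B] by (metis code_Imp code.simps(4))
  next
    assume y: "y = impn (7 * prod_encode (code A, code B) + 4) (code A)"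
    show ?thesis using y scheme.intros(4)[of A B] by (metis code_Imp code.simps(5))
  next
    assume y: "y = impn (7 * prod_encode (code A, code B) + 4) (code B)"
    show ?thesis using y scheme.intros(5)[of A B] by (metis code_Imp code.simps(5))
  next
    assume y: "y = impn (code A) (impn (code B) (7 * prod_encode (code A, code B) + 4))"
    show ?thesis using y scheme.intros(6)[of A B] by (metis code_Imp code.simps(5))
  next
    assume y: "y = impn (7 * impn (code A) (code B) + 5) (impn (7 * code A + 5) (7 * code B + 5))"
    show ?thesis using y scheme.intros(8)[of A B] by (metis code_Imp code.simps(6))
  next
    assume y: "y = impn (7 * impn (code A) (code B) + 6) (impn (7 * code A + 6) (7 * code B + 6))"
    show ?thesis using y scheme.intros(11)[of A B] by (metis code_Imp code.simps(7))
  next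
    assume y: "y = 7 * prod_encode (tcode t', tcode t') + 0"
    show ?thesis using y scheme.intros(13)[of t'] by (metis code.simps(1) add_0_right)
  qed
  then show ?thesis by auto
qed

lemma impn_ge: "a \<le> impn a b" "b \<le> impn a b"
  unfolding impn_def using prod_encode_ge(1)[of a "7 * b + 3"] prod_encode_ge(2)[of "7 * b + 3" a] by simp_all

lemma ib: "x \<le> a \<Longrightarrow> x \<le> impn a b" "x \<le> b \<Longrightarrow> x \<le> impn a b" "x \<le> a \<Longrightarrow> x \<le> 7 * a + i"
  "x \<le> a \<Longrightarrow> x \<le> 7 * prod_encode (a, b) + i" "x \<le> b \<Longrightarrow> x \<le> 7 * prod_encode (a, b) + i"
  using impn_ge(1)[of a b] impn_ge(2)[of b a] bd(1)[of a b i] bd(2)[of b a i] by linarith+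

lemma schemeI: "schemeP S y a b c t u \<Longrightarrow> a \<le> set_encode S + y \<Longrightarrow> b \<le> set_encode S + y \<Longrightarrow> c \<le> set_encode S + y
  \<Longrightarrow> t \<le> set_encode S + y \<Longrightarrow> u \<le> set_encode S + y \<Longrightarrow> schemeH S y"
  unfolding schemeH_def by blast

lemma tup_le: assumes "good S" "tupn i (t + 1) k a b \<in> S"
  shows "t \<le> set_encode S + y" "a \<le> set_encode S + y" "b \<le> set_encode S + y"
proof -
  have "tupn i (t + 1) k a b < set_encode S" using mem_set_encode[OF goodD[OF assms(1)] assms(2)] .
  with tupn_ge(1)[of "t+1" i k a b] tupn_ge(3)[of a i "t+1" k b] tupn_ge(4)[of b i "t+1" k a]
  show "t \<le> set_encode S + y" "a \<le> set_encode S + y" "b \<le> set_encode S + y" by linarith+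
qed

lemma tup_le': assumes "good S" "tupn i j k a b \<in> S"
  shows "a \<le> set_encode S + y" "b \<le> set_encode S + y"
proof -
  have "tupn i j k a b < set_encode S" using mem_set_encode[OF goodD[OF assms(1)] assms(2)] .
  with tupn_ge(3)[of a i j k b] tupn_ge(4)[of b i j k a]
  show "a \<le> set_encode S + y" "b \<le> set_encode S + y" by linarith+
qed

lemma scheme_complete: "scheme X \<Longrightarrow> \<exists>S. good S \<and> schemeH S (code X)"
proof (induction rule: scheme.induct)
  case (1 A B) show ?case unfolding code_Imp
    by (intro exI[of _ "{}"] conjI good_empty, rule schemeI[of _ _ "code A" "code B" 0 0 0])
       (auto simp: schemeP_def intro: ib trans_le_add2)
next
  case (2 A B C) show ?case unfolding code_Imp
    by (intro exI[of _ "{}"] conjI good_empty, rule schemeI[of _ _ "code A" "code B" "code C" 0 0])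
       (auto simp: schemeP_def intro: ib trans_le_add2)
next
  case (3 A B) show ?case unfolding code_Imp unfolding code.simps
    by (intro exI[of _ "{}"] conjI good_empty, rule schemeI[of _ _ "code A" "code B" 0 0 0])
       (auto simp: schemeP_def intro: ib trans_le_add2)
next
  case (4 A B) show ?case unfolding code_Imp unfolding code.simps
    by (intro exI[of _ "{}"] conjI good_empty, rule schemeI[of _ _ "code A" "code B" 0 0 0])
       (auto simp: schemeP_def intro: ib trans_le_add2)
next
  case (5 A B) show ?case unfolding code_Imp unfolding code.simps
    by (intro exI[of _ "{}"] conjI good_empty, rule schemeI[of _ _ "code A" "code B" 0 0 0])
       (auto simp: schemeP_def intro: ib trans_le_add2)
next
  case (6 A B) show ?case unfolding code_Imp unfolding code.simps
    by (intro exI[of _ "{}"] conjI good_empty, rule schemeI[of _ _ "code A" "code B" 0 0 0])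
       (auto simp: schemeP_def intro: ib trans_le_add2)
next
  case (7 A t)
  obtain S where S: "good S" "tupn 1 (tcode t + 1) 0 (code A) (code (inst t A)) \<in> S"
    using ex1[of "tcode t + 1" 0 A] by (auto simp: sg0)
  show ?case unfolding code_Imp unfolding code.simps
    by (intro exI[of _ S] conjI S(1), rule schemeI[of _ _ "code A" "code (inst t A)" 0 "tcode t" 0])
       (simp_all only: schemeP_def tup_le[OF S] S simp_thms le0)
next
  case (8 A B) show ?case unfolding code_Imp unfolding code.simps(6,7) unfolding code_Imp
    by (intro exI[of _ "{}"] conjI good_empty, rule schemeI[of _ _ "code A" "code B" 0 0 0])
       (auto simp: schemeP_def intro: ib trans_le_add2)
next
  case (9 A)
  obtain S where S: "good S" "tupn 1 0 0 (code A) (code (lift A)) \<in> S"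
    using ex1[of 0 0 A] by (auto simp: sg0)
  show ?case unfolding code_Imp unfolding code.simps
    by (intro exI[of _ S] conjI S(1), rule schemeI[of _ _ "code A" "code (lift A)" 0 0 0])
       (simp_all only: schemeP_def tup_le'[OF S] S simp_thms le0)
next
  case (10 A n)
  obtain S where S: "good S" "tupn 2 (n + 1) 0 (code A) (code (instS n A)) \<in> S"
    using ex2[of "n + 1" 0 A] by (auto simp: sg0)
  show ?case unfolding code_Imp unfolding code.simps
    by (intro exI[of _ S] conjI S(1), rule schemeI[of _ _ "code A" "code (instS n A)" 0 n 0])
       (simp_all only: schemeP_def tup_le[OF S] S simp_thms le0)
next
  case (11 A B) show ?case unfolding code_Imp unfolding code.simps(6,7) unfolding code_Imp
    by (intro exI[of _ "{}"] conjI good_empty, rule schemeI[of _ _ "code A" "code B" 0 0 0])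
       (auto simp: schemeP_def intro: ib trans_le_add2)
next
  case (12 A)
  obtain S where S: "good S" "tupn 2 0 0 (code A) (code (liftS A)) \<in> S"
    using ex2[of 0 0 A] by (auto simp: sg0)
  show ?case unfolding code_Imp unfolding code.simps
    by (intro exI[of _ S] conjI S(1), rule schemeI[of _ _ "code A" "code (liftS A)" 0 0 0])
       (simp_all only: schemeP_def tup_le'[OF S] S simp_thms le0)
next
  case (13 t) show ?case unfolding code.simps
    by (intro exI[of _ "{}"] conjI good_empty, rule schemeI[of _ _ 0 0 0 "tcode t" 0])
       (auto simp: schemeP_def intro: trans_le_add2 bd(1)[where i = 0, simplified])
next
  case (14 t u A)
  obtain S where S: "good S" "tupn 1 (tcode t + 1) 0 (code A) (code (inst t A)) \<in> S"
     "tupn 1 (tcode u + 1) 0 (code A) (code (inst u A)) \<in> S"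
    using two[OF ex1[of "tcode t + 1" 0 A] ex1[of "tcode u + 1" 0 A]] by (auto simp: sg0)
  show ?case unfolding code_Imp unfolding code.simps
    by (intro exI[of _ S] conjI S(1), rule schemeI[of _ _ "code A" "code (inst t A)" "code (inst u A)" "tcode t" "tcode u"])
       (simp_all only: schemeP_def tup_le[OF S(1,2)] tup_le[OF S(1,3)] S simp_thms le0 add_0_right)
qed

definition logH where
  "logH S L \<longleftrightarrow> (\<forall>y\<in>L. schemeH S y \<or> (\<exists>z\<le>y. z \<in> L \<and> (y = 7 * z + 5 \<or> y = 7 * z + 6)))"

lemma sat_logic_ok: "sat e E (logic_ok w s) \<longleftrightarrow> logH (set_decode (eval e w)) (set_decode (eval e s))"
proof -
  have "sat e E (logic_ok w s) \<longleftrightarrow> (\<forall>y<eval e s. y \<in> set_decode (eval e s) \<longrightarrow>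
     schemeH (set_decode (eval e w)) y \<or>
     (\<exists>z\<le>y. z \<in> set_decode (eval e s) \<and> (y = 7 * z + 5 \<or> y = 7 * z + 6)))"
    unfolding logic_ok_def
    by (simp only: sat_only sat_BAll sat_is_scheme) blast
  also have "\<dots> \<longleftrightarrow> logH (set_decode (eval e w)) (set_decode (eval e s))"
    unfolding logH_def using set_decode_less by blast
  finally show ?thesis .
qed

lemma logH_sound: assumes "okH S" "logH S L" shows "y \<in> L \<Longrightarrow> logical_axiom (cdec y)"
proof (induction y rule: less_induct)
  case (less y)
  then consider "schemeH S y" | z where "z \<in> L" "y = 7 * z + 5" | z where "z \<in> L" "y = 7 * z + 6"
    using assms(2) unfolding logH_def by blast
  then show ?case
  proof cases
    case 1 then show ?thesis using schemeH_sound[OF assms(1)] logical_axiom.intros(1) by blast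
  next
    case 2
    then have "logical_axiom (\<^bold>\<forall> cdec z)" using less.IH[of z] logical_axiom.intros(2) by simp
    moreover have "y = code (\<^bold>\<forall> cdec z)" using 2 by simp
    ultimately show ?thesis by (metis cdec(1))
  next
    case 3
    then have "logical_axiom (\<^bold>\<forall>\<^sub>2 cdec z)" using less.IH[of z] logical_axiom.intros(3) by simp
    moreover have "y = code (\<^bold>\<forall>\<^sub>2 cdec z)" using 3 by simp
    ultimately show ?thesis by (metis cdec(1))
  qed
qed

lemma schemeH_mono: assumes "S \<subseteq> S'" "finite S'" "schemeH S y" shows "schemeH S' y"
proof -
  have le: "set_encode S \<le> set_encode S'" unfolding set_encode_def
    using assms by (intro sum_mono2) auto
  obtain a b c t u where b: "a \<le> set_encode S + y" "b \<le> set_encode S + y" "c \<le> set_encode S + y"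
    "t \<le> set_encode S + y" "u \<le> set_encode S + y" and P: "schemeP S y a b c t u"
    using assms(3) unfolding schemeH_def by blast
  have "schemeP S' y a b c t u" using P assms(1) unfolding schemeP_def subset_eq by meson
  then show ?thesis using b le by (intro schemeI) auto
qed

lemma logH_Un: assumes "logH S L" "logH S' L'" "finite S" "finite S'" shows "logH (S \<union> S') (L \<union> L')"
  using assms schemeH_mono[of S "S \<union> S'"] schemeH_mono[of S' "S \<union> S'"] unfolding logH_def by blast

lemma logH_insert: assumes "logH S L" "z \<in> L" "y = 7 * z + 5 \<or> y = 7 * z + 6" shows "logH S (insert y L)"
proof -
  have "z \<le> y" using assms(3) by auto
  then have "\<exists>z\<le>y. z \<in> insert y L \<and> (y = 7 * z + 5 \<or> y = 7 * z + 6)" using assms(2,3) by blast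
  then show ?thesis using assms(1) unfolding logH_def by blast
qed

lemma logic_complete: "logical_axiom A \<Longrightarrow> \<exists>S L. good S \<and> finite L \<and> logH S L \<and> code A \<in> L"
proof (induction rule: logical_axiom.induct)
  case (1 A)
  obtain S where "good S" "schemeH S (code A)" using scheme_complete[OF 1] by blast
  then show ?case by - (rule exI[of _ S], rule exI[of _ "{code A}"], simp add: logH_def)
next
  case (2 A)
  then obtain S L where "good S" "finite L" "logH S L" "code A \<in> L" by blast
  then show ?case by - (rule exI[of _ S], rule exI[of _ "insert (code (\<^bold>\<forall> A)) L"], simp add: logH_insert)
next
  case (3 A)
  then obtain S L where "good S" "finite L" "logH S L" "code A \<in> L" by blast
  then show ?case by - (rule exI[of _ S], rule exI[of _ "insert (code (\<^bold>\<forall>\<^sub>2 A)) L"], simp add: logH_insert)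
qed

definition lineH where
  "lineH T L P v \<longleftrightarrow> (\<exists>i y. v = pairn i y \<and> (cdec y \<in> T \<or> y \<in> L \<or>
     (\<exists>j k z. j < i \<and> k < i \<and> pairn j z \<in> P \<and> pairn k (impn z y) \<in> P)))"
definition proofH where "proofH T L P \<longleftrightarrow> (\<forall>v\<in>P. lineH T L P v)"
lemmas proofH_unfold = proofH_def[unfolded lineH_def]
lemma line_mono: assumes "lineH T L P v" "L \<subseteq> L'" "P \<subseteq> P'" shows "lineH T L' P' v"
proof -
  obtain i y where v: "v = pairn i y" and "cdec y \<in> T \<or> y \<in> L \<or>
     (\<exists>j k z. j < i \<and> k < i \<and> pairn j z \<in> P \<and> pairn k (impn z y) \<in> P)"
    using assms(1) unfolding lineH_def by blast
  then have "cdec y \<in> T \<or> y \<in> L' \<or>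
     (\<exists>j k z. j < i \<and> k < i \<and> pairn j z \<in> P' \<and> pairn k (impn z y) \<in> P')"
    using assms(2,3) by blast
  then show ?thesis using v unfolding lineH_def by blast
qed

lemma sat_proof_ok:
  assumes "presentation \<tau> T"
  shows "sat e E (proof_ok \<tau> s p) \<longleftrightarrow> proofH T (set_decode (eval e s)) (set_decode (eval e p))"
proof -
  have \<tau>: "sat e' E' (app \<tau> [y] []) \<longleftrightarrow> cdec (eval e' y) \<in> T" for e' E' y
  proof -
    have "closed_fm 1 0 \<tau>" using assms by (simp add: presentation_def)
    from sat_closed[OF this, of _ "\<lambda>_. eval e' y"]
    have "sat e' E' (app \<tau> [y] []) \<longleftrightarrow> sat (\<lambda>_. eval e' y) (\<lambda>_. {}) \<tau>"
      unfolding app_def sat_subst by simp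
    also have "\<dots> \<longleftrightarrow> cdec (eval e' y) \<in> T" using assms by (simp add: presentation_def)
    finally show ?thesis .
  qed
  let ?P = "set_decode (eval e p)" and ?L = "set_decode (eval e s)" and ?p = "eval e p"
  have "sat e E (proof_ok \<tau> s p) \<longleftrightarrow> (\<forall>v<?p. v \<in> ?P \<longrightarrow> (\<exists>i\<le>v. \<exists>y\<le>v. v = pairn i y \<and>
     (cdec y \<in> T \<or> y \<in> ?L \<or> (\<exists>j\<le>?p. \<exists>k\<le>?p. \<exists>z\<le>?p. \<exists>c\<le>?p. j < i \<and> k < i \<and> c = impn z y \<and>
       pairn j z \<in> ?P \<and> pairn k c \<in> ?P))))"
    unfolding proof_ok_def impn_def
    by (simp only: sat_only sat_BAll \<tau> e7 de_Morgan_conj not_not de_Morgan_disj imp_conv_disj)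
  also have "\<dots> \<longleftrightarrow> (\<forall>v\<in>?P. \<exists>i\<le>v. \<exists>y\<le>v. v = pairn i y \<and>
     (cdec y \<in> T \<or> y \<in> ?L \<or> (\<exists>j\<le>?p. \<exists>k\<le>?p. \<exists>z\<le>?p. \<exists>c\<le>?p. j < i \<and> k < i \<and> c = impn z y \<and>
       pairn j z \<in> ?P \<and> pairn k c \<in> ?P)))" using set_decode_less by blast
  also have "\<dots> \<longleftrightarrow> proofH T ?L ?P"
  proof -
    have *: "(\<exists>j\<le>?p. \<exists>k\<le>?p. \<exists>z\<le>?p. \<exists>c\<le>?p. j < i \<and> k < i \<and> c = impn z y \<and>
       pairn j z \<in> ?P \<and> pairn k c \<in> ?P) \<longleftrightarrow>
      (\<exists>j k z. j < i \<and> k < i \<and> pairn j z \<in> ?P \<and> pairn k (impn z y) \<in> ?P)" for i y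
    proof (intro iffI; elim exE conjE)
      fix j k z assume h: "j < i" "k < i" "pairn j z \<in> ?P" "pairn k (impn z y) \<in> ?P"
      have "j \<le> ?p" "z \<le> ?p" "k \<le> ?p" "impn z y \<le> ?p"
        using set_decode_less[OF h(3)] set_decode_less[OF h(4)] pairn_ge(1)[of j z] pairn_ge(2)[of z j]
         pairn_ge(1)[of k "impn z y"] pairn_ge(2)[of "impn z y" k] by linarith+
      then show "\<exists>j\<le>?p. \<exists>k\<le>?p. \<exists>z\<le>?p. \<exists>c\<le>?p. j < i \<and> k < i \<and> c = impn z y \<and>
       pairn j z \<in> ?P \<and> pairn k c \<in> ?P" using h by blast
    qed blast
    have **: "(\<exists>i\<le>v. \<exists>y\<le>v. v = pairn i y \<and> Q i y) \<longleftrightarrow> (\<exists>i y. v = pairn i y \<and> Q i y)" for v Q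
      using pairn_ge by blast
    show ?thesis unfolding proofH_unfold * ** ..
  qed
  finally show ?thesis .
qed

lemma proofH_sound: assumes "okH S" "logH S L" "proofH T L P"
  shows "pairn i y \<in> P \<Longrightarrow> T \<turnstile> cdec y"
proof (induction i arbitrary: y rule: less_induct)
  case (less i)
  then consider "cdec y \<in> T" | "y \<in> L" |
     j k z where "j < i" "k < i" "pairn j z \<in> P" "pairn k (impn z y) \<in> P"
    using assms(3) unfolding proofH_unfold by fastforce
  then show ?case
  proof cases
    case 1 then show ?thesis by (rule derives.hyp)
  next
    case 2 then show ?thesis using logH_sound[OF assms(1,2)] derives.logic by blast
  next
    case 3
    then have "T \<turnstile> cdec z" "T \<turnstile> cdec (impn z y)" using less.IH by blast+
    moreover have "impn z y = code (cdec z \<^bold>\<longrightarrow> cdec y)" unfolding code_Imp by simp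
    ultimately show ?thesis using derives.mp by (metis cdec(1))
  qed
qed

lemma proofH_Un: "proofH T L P \<Longrightarrow> proofH T L' P' \<Longrightarrow> proofH T (L \<union> L') (P \<union> P')"
  unfolding proofH_def using line_mono[of T L P _ "L \<union> L'" "P \<union> P'"] line_mono[of T L' P' _ "L \<union> L'" "P \<union> P'"] by blast

lemma proof_complete: "T \<turnstile> A \<Longrightarrow>
  \<exists>S L P i. good S \<and> finite L \<and> finite P \<and> logH S L \<and> proofH T L P \<and> pairn i (code A) \<in> P"
proof (induction rule: derives.induct)
  case (hyp A)
  then show ?case
    by - (rule exI[of _ "{}"], rule exI[of _ "{}"], rule exI[of _ "{pairn 0 (code A)}"], rule exI[of _ 0], auto simp: good_empty logH_def proofH_unfold)
next
  case (logic A)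
  then obtain S L where "good S" "finite L" "logH S L" "code A \<in> L" using logic_complete by blast
  then show ?case
    by - (rule exI[of _ S], rule exI[of _ L], rule exI[of _ "{pairn 0 (code A)}"], rule exI[of _ 0], auto simp: proofH_unfold)
next
  case (mp A B)
  then obtain S L P i S' L' P' i' where
    h: "good S" "finite L" "finite P" "logH S L" "proofH T L P" "pairn i (code (A \<^bold>\<longrightarrow> B)) \<in> P"
      "good S'" "finite L'" "finite P'" "logH S' L'" "proofH T L' P'" "pairn i' (code A) \<in> P'"
    by blast
  let ?n = "Suc (max i i')" and ?P = "P \<union> P'"
  have u: "proofH T (L \<union> L') ?P" using h proofH_Un by blast
  have "proofH T (L \<union> L') (insert (pairn ?n (code B)) ?P)"
    unfolding proofH_def
  proof
    fix v assume "v \<in> insert (pairn ?n (code B)) ?P"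
    then consider "v = pairn ?n (code B)" | "v \<in> ?P" by blast
    then show "lineH T (L \<union> L') (insert (pairn ?n (code B)) ?P) v"
    proof cases
      case 1
      have "i' < ?n" "i < ?n" by auto
      moreover have "pairn i' (code A) \<in> insert (pairn ?n (code B)) ?P"
         "pairn i (impn (code A) (code B)) \<in> insert (pairn ?n (code B)) ?P"
        using h unfolding code_Imp by blast+
      ultimately show ?thesis using 1 unfolding lineH_def by blast
    next
      case 2 
      have "lineH T (L \<union> L') ?P v" using u 2 unfolding proofH_def by blast
      then show ?thesis by (rule line_mono) auto
    qed
  qed
  moreover have "good (S \<union> S')" "finite (L \<union> L')" "finite (insert (pairn ?n (code B)) ?P)" "logH (S \<union> S') (L \<union> L')"
    using h good_Un logH_Un goodD by simp_all
  ultimately show ?case by blast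
qed

theorem sat_box:
  assumes "presentation \<tau> T"
  shows "sat e E (box \<tau> x) \<longleftrightarrow> (T \<turnstile> cdec (eval e x))"
proof -
  have "sat e E (box \<tau> x) \<longleftrightarrow> (\<exists>w s p. okH (set_decode w) \<and> logH (set_decode w) (set_decode s) \<and>
     proofH T (set_decode s) (set_decode p) \<and> (\<exists>i\<le>p. pairn i (eval e x) \<in> set_decode p))"
    unfolding box_def
    by (simp only: sat_only sat_subst_ok sat_logic_ok sat_proof_ok[OF assms] add_0_right) (simp only: not_all not_not)
  also have "\<dots> \<longleftrightarrow> (T \<turnstile> cdec (eval e x))"
  proof
    assume "T \<turnstile> cdec (eval e x)"
    then obtain S L P i where h: "good S" "finite L" "finite P" "logH S L" "proofH T L P" "pairn i (eval e x) \<in> P"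
      using proof_complete by (metis cdec(2))
    have "i \<le> set_encode P" using mem_set_encode[OF h(3,6)] pairn_ge(1)[of i "eval e x"] by linarith
    with h show "\<exists>w s p. okH (set_decode w) \<and> logH (set_decode w) (set_decode s) \<and>
     proofH T (set_decode s) (set_decode p) \<and> (\<exists>i\<le>p. pairn i (eval e x) \<in> set_decode p)"
      by - (rule exI[of _ "set_encode S"], rule exI[of _ "set_encode L"], rule exI[of _ "set_encode P"], auto simp: good_def set_encode_inverse)
  qed (use proofH_sound in blast)
  finally show ?thesis .
qed

definition numH where
  "numH s \<longleftrightarrow> (\<forall>v\<in>s. v = pairn 0 0 \<or> (\<exists>i x y. v = pairn (i + 1) y \<and> pairn i x \<in> s \<and> y = 4 * prod_encode (x, 1) + 4))"

lemma sat_is_num: "sat e E (is_num m u) \<longleftrightarrow> eval e u = tcode (num (eval e m))"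
proof -
  have "sat e E (is_num m u) \<longleftrightarrow> (\<exists>s. pairn (eval e m) (eval e u) \<in> set_decode s \<and>
    (\<forall>v<s. v \<in> set_decode s \<longrightarrow> v = pairn 0 0 \<or> (\<exists>i\<le>v. \<exists>x\<le>v. \<exists>y\<le>v. v = pairn (i + 1) y \<and> pairn i x \<in> set_decode s \<and>
       y = 4 * prod_encode (x, 1) + 4)))"
    unfolding is_num_def by (simp only: sat_only sat_BAll de_Morgan_conj de_Morgan_disj imp_conv_disj) (simp only: not_all not_ex not_not de_Morgan_conj de_Morgan_disj)
  also have "\<dots> \<longleftrightarrow> (\<exists>s. pairn (eval e m) (eval e u) \<in> set_decode s \<and> numH (set_decode s))"
  proof -
    have *: "(\<exists>i\<le>v. \<exists>x\<le>v. \<exists>y\<le>v. v = pairn (i + 1) y \<and> pairn i x \<in> s \<and> y = 4 * prod_encode (x, 1) + 4) \<longleftrightarrow>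
      (\<exists>i x y. v = pairn (i + 1) y \<and> pairn i x \<in> s \<and> y = 4 * prod_encode (x, 1) + 4)" for v s
    proof (intro iffI; elim exE conjE)
      fix i x y assume h: "v = pairn (i + 1) y" "pairn i x \<in> s" "y = 4 * prod_encode (x, 1) + 4"
      have "i \<le> v" "y \<le> v" "x \<le> y" using pairn_ge(1)[of "i+1" y] pairn_ge(2)[of y "i+1"] bd(4)[of x 1 4] h by linarith+
      then show "\<exists>i\<le>v. \<exists>x\<le>v. \<exists>y\<le>v. v = pairn (i + 1) y \<and> pairn i x \<in> s \<and> y = 4 * prod_encode (x, 1) + 4"
        using h le_trans[OF \<open>x \<le> y\<close> \<open>y \<le> v\<close>] by blast
    qed blast
    show ?thesis unfolding * numH_def using set_decode_less by blast
  qed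
  also have "\<dots> \<longleftrightarrow> eval e u = tcode (num (eval e m))"
  proof
    have "numH s \<Longrightarrow> pairn n u \<in> s \<Longrightarrow> u = tcode (num n)" for s n u
    proof (induction n arbitrary: u)
      case 0 then show ?case unfolding numH_def by fastforce
    next
      case (Suc n)
      then obtain x where "pairn n x \<in> s" "u = 4 * prod_encode (x, 1) + 4" unfolding numH_def by fastforce
      with Suc.IH[OF Suc.prems(1)] show ?case by simp
    qed
    then show "\<exists>s. pairn (eval e m) (eval e u) \<in> set_decode s \<and> numH (set_decode s) \<Longrightarrow> eval e u = tcode (num (eval e m))"
      by blast
  next
    assume u: "eval e u = tcode (num (eval e m))"
    have "\<exists>s. finite s \<and> pairn n (tcode (num n)) \<in> s \<and> numH s" for n
    proof (induction n)
      case 0 show ?case by - (rule exI[of _ "{pairn 0 0}"], simp add: numH_def)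
    next
      case (Suc n)
      then obtain s where "finite s" "pairn n (tcode (num n)) \<in> s" "numH s" by blast
      then show ?case
        by - (rule exI[of _ "insert (pairn (Suc n) (tcode (num (Suc n)))) s"], auto simp: numH_def)
    qed
    then show "\<exists>s. pairn (eval e m) (eval e u) \<in> set_decode s \<and> numH (set_decode s)"
      unfolding u by (metis set_encode_inverse)
  qed
  finally show ?thesis .
qed

lemma sat_is_dotted: "sat e E (is_dotted A a b z) \<longleftrightarrow>
   eval e z = code (inst (num (eval e b)) (inst (num (eval e a)) A))"
proof -
  have "sat e E (is_dotted A a b z) \<longleftrightarrow> (\<exists>w x u v. u = tcode (num (eval e a)) \<and> v = tcode (num (eval e b)) \<and>
     okH (set_decode w) \<and> tupn 1 (u + 1) 0 (code A) x \<in> set_decode w \<and> tupn 1 (v + 1) 0 x (eval e z) \<in> set_decode w)"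
    unfolding is_dotted_def by (simp only: sat_only sat_subst_ok sat_is_num) (simp only: not_all not_not)
  also have "\<dots> \<longleftrightarrow> eval e z = code (inst (num (eval e b)) (inst (num (eval e a)) A))"
  proof
    assume "\<exists>w x u v. u = tcode (num (eval e a)) \<and> v = tcode (num (eval e b)) \<and>
     okH (set_decode w) \<and> tupn 1 (u + 1) 0 (code A) x \<in> set_decode w \<and> tupn 1 (v + 1) 0 x (eval e z) \<in> set_decode w"
    then obtain S x where h: "okH S" "tupn 1 (tcode (num (eval e a)) + 1) 0 (code A) x \<in> S"
      "tupn 1 (tcode (num (eval e b)) + 1) 0 x (eval e z) \<in> S" by blast
    have "x = code (inst (num (eval e a)) A)" using ok1[OF h(1,2)] by (simp add: sg0)
    with h(3) show "eval e z = code (inst (num (eval e b)) (inst (num (eval e a)) A))"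
      using ok1[OF h(1)] by (fastforce simp: sg0)
  next
    assume z: "eval e z = code (inst (num (eval e b)) (inst (num (eval e a)) A))"
    obtain S where S: "good S" "tupn 1 (tcode (num (eval e a)) + 1) 0 (code A) (code (inst (num (eval e a)) A)) \<in> S"
      "tupn 1 (tcode (num (eval e b)) + 1) 0 (code (inst (num (eval e a)) A)) (eval e z) \<in> S"
      using two[OF ex1[of "tcode (num (eval e a)) + 1" 0 A] ex1[of "tcode (num (eval e b)) + 1" 0 "inst (num (eval e a)) A"]]
      unfolding z by (auto simp: sg0)
    have "set_decode (set_encode S) = S" "okH S" using S(1) by (simp_all add: good_def set_encode_inverse)
    with S(2,3) show "\<exists>w x u v. u = tcode (num (eval e a)) \<and> v = tcode (num (eval e b)) \<and>
     okH (set_decode w) \<and> tupn 1 (u + 1) 0 (code A) x \<in> set_decode w \<and> tupn 1 (v + 1) 0 x (eval e z) \<in> set_decode w"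
      by metis
  qed
  finally show ?thesis .
qed

theorem sat_box_imp:
  assumes "presentation \<tau> T"
  shows "sat e E (box_imp \<tau> A a b f) \<longleftrightarrow>
    (T \<turnstile> inst (num (eval e b)) (inst (num (eval e a)) A) \<^bold>\<longrightarrow> cdec (eval e f))"
proof -
  let ?A = "inst (num (eval e b)) (inst (num (eval e a)) A)"
  have "sat e E (box_imp \<tau> A a b f) \<longleftrightarrow> (\<exists>z c. z = code ?A \<and> c = impn z (eval e f) \<and> (T \<turnstile> cdec c))"
    unfolding box_imp_def impn_def by (simp only: sat_only sat_is_dotted sat_box[OF assms] e7) (simp only: not_all not_not)
  also have "\<dots> \<longleftrightarrow> (T \<turnstile> cdec (code (?A \<^bold>\<longrightarrow> cdec (eval e f))))" unfolding code_Imp by simp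
  finally show ?thesis by (simp del: code.simps)
qed

lemma delta00_BEx: "delta00 A \<Longrightarrow> delta00 (BEx t A)"
  unfolding BEx_def by (simp add: delta00.intros)
lemma delta00_bexs: "delta00 A \<Longrightarrow> delta00 (bexs n t A)"
  by (induction n arbitrary: t) (simp_all add: bexs.simps delta00_BEx)
lemma delta00_is_code: "delta00 (is_code n c z)"
  by (induction c arbitrary: n z) (simp_all add: is_code.simps delta00.intros delta00_bexs)
lemma delta00_elt: "delta00 (x \<^bold>\<epsilon> s)"
  unfolding elt_def by (simp add: delta00.intros delta00_BEx)
lemma delta00_subst: "delta00 A \<Longrightarrow> delta00 (subst \<sigma> \<rho> A)"
proof (induction A arbitrary: \<sigma> \<rho> rule: delta00.induct)
  case (6 A t)
  have "subst_tm (case_nat (Var 0) (\<lambda>i. lift_tm (\<sigma> i))) (lift_tm t) = lift_tm (subst_tm \<sigma> t)" for t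
    by (induction t) auto
  then have "subst \<sigma> \<rho> (BAll t A) = BAll (subst_tm \<sigma> t) (subst (case_nat (Var 0) (\<lambda>i. lift_tm (\<sigma> i))) \<rho> A)"
    by (simp add: BAll_def)
  then show ?case using 6 by (simp add: delta00.intros)
qed (simp_all add: delta00.intros)
lemmas delta00_all = delta00.intros delta00_bexs delta00_is_code delta00_elt delta00_subst

theorem sigma01_box: "delta00 \<tau> \<Longrightarrow> sigma01 (box \<tau> x)"
proof -
  have 1: "delta00 (tm_step w j k x y)" "delta00 (fm_step w j k x y)" "delta00 (fmS_step w j k x y)" for w j k x y
    unfolding tm_step_def fm_step_def fmS_step_def Let_def by (intro delta00_all)+
  have 2: "delta00 (subst_ok w)" for w
    unfolding subst_ok_def Let_def by (intro delta00_all 1)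
  have 3: "delta00 (logic_ok w s)" for w s
    unfolding logic_ok_def is_scheme_def Let_def by (intro delta00_all)
  have 4: "delta00 \<tau> \<Longrightarrow> delta00 (proof_ok \<tau> s p)" for s p
    unfolding proof_ok_def app_def Let_def by (intro delta00_all)
  assume "delta00 \<tau>"
  then show ?thesis unfolding box_def Let_def
    by (intro sigma01.intros delta00_all 2 3 4)
qed

declare tdec [simp del] cdec [simp del] peq [simp del] code_mod7 [simp del]

end

theory Submission
  imports Defs
begin

text \<open>
  \<open>oracle_fm imc\<close> and \<open>mdia imc (Var 0) (Var 1)\<close> are the same formula, so no reasoning about
  provability is needed: it suffices that \<open>\<langle>\<alpha>, \<phi>\<rangle> \<in> X\<close> is equivalent to \<open>[\<alpha>] \<phi>\<close> for the given
  class \<open>X\<close> and all \<open>\<alpha> \<preceq> \<beta>\<close>, for then the theorem is the defining equation of \<open>X\<close> at \<open>\<alpha>\<close>.  Since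
  \<open>X\<close> is a class for every \<open>\<alpha> \<preceq> \<beta>\<close> as well, this amounts to the uniqueness of iterated classes.
  If two classes for \<open>\<gamma> \<preceq> \<beta>\<close> differ at some level \<open>\<preceq> \<gamma>\<close>, then by arithmetical comprehension and
  \<open>wo(\<beta>)\<close> there is a least such level, and the defining equations make the classes agree there.

  The formal derivation is replaced by an argument in a term model: by Henkin's theorem an
  underivable formula is avoided by a maximal consistent set \<open>M\<close> with witnesses, in which
  quantifiers range over terms and set variables.  Equality is just a further relation of \<open>M\<close>,
  because the argument uses no equality axioms.
\<close>

section \<open>Substitution and derivability\<close>

lemma subst_tm_comp: "subst_tm \<sigma>' (subst_tm \<sigma> t) = subst_tm (\<lambda>i. subst_tm \<sigma>' (\<sigma> i)) t"
  by (induction t) auto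

lemma subst_comp:
  "subst \<sigma>' \<rho>' (subst \<sigma> \<rho> A) = subst (\<lambda>i. subst_tm \<sigma>' (\<sigma> i)) (\<lambda>n. \<rho>' (\<rho> n)) A"
proof (induction A arbitrary: \<sigma> \<rho> \<sigma>' \<rho>')
  case (All A)
  have "(\<lambda>i. subst_tm (case_nat (Var 0) (\<lambda>i. lift_tm (\<sigma>' i))) (case_nat (Var 0) (\<lambda>i. lift_tm (\<sigma> i)) i)) =
      case_nat (Var 0) (\<lambda>i. lift_tm (subst_tm \<sigma>' (\<sigma> i)))"
    by (rule ext) (simp add: subst_tm_comp split: nat.split)
  then show ?case by (simp add: All)
next
  case (AllS A)
  have "(\<lambda>n. case_nat 0 (\<lambda>n. Suc (\<rho>' n)) (case_nat 0 (\<lambda>n. Suc (\<rho> n)) n)) = case_nat 0 (\<lambda>n. Suc (\<rho>' (\<rho> n)))"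
    by (rule ext) (simp split: nat.split)
  then show ?case by (simp add: AllS)
qed (simp_all add: subst_tm_comp)

lemma subst_tm_closed:
  "closed_tm m t \<Longrightarrow> (\<And>i. i < m \<Longrightarrow> \<sigma> i = \<sigma>' i) \<Longrightarrow> subst_tm \<sigma> t = subst_tm \<sigma>' t"
  by (induction t) auto

text \<open>Makes two substitutions interchangeable when they differ only off the free variables:
  sentences become invariant, and renaming a fresh variable acts on the hypotheses as a mere
  lifting.\<close>

lemma subst_closed:
  "closed_fm m k A \<Longrightarrow> (\<And>i. i < m \<Longrightarrow> \<sigma> i = \<sigma>' i) \<Longrightarrow> (\<And>n. n < k \<Longrightarrow> \<rho> n = \<rho>' n) \<Longrightarrow>
    subst \<sigma> \<rho> A = subst \<sigma>' \<rho>' A"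
proof (induction A arbitrary: m k \<sigma> \<sigma>' \<rho> \<rho>')
  case (All A)
  show ?case unfolding subst.simps fm.inject
    by (rule All.IH[OF All.prems(1)[unfolded closed_fm.simps]])
      (use All.prems in \<open>auto split: nat.split\<close>)
next
  case (AllS A)
  show ?case unfolding subst.simps fm.inject
    by (rule AllS.IH[OF AllS.prems(1)[unfolded closed_fm.simps]])
      (use AllS.prems in \<open>auto split: nat.split\<close>)
next
  case (Neg A)
  show ?case unfolding subst.simps fm.inject
    by (rule Neg.IH) (use Neg.prems in auto)
next
  case (And A B)
  show ?case unfolding subst.simps fm.inject
    by (intro conjI; rule And.IH) (use And.prems in auto)
qed (auto intro: subst_tm_closed)

lemma subst_id: "subst Var (\<lambda>n. n) A = A"
proof (induction A)
  case (AllS A)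
  have "case_nat 0 Suc = (\<lambda>n. n)" by (rule ext) (simp split: nat.split)
  with AllS show ?case by simp
next
  case (All A)
  have "case_nat (Var 0) (\<lambda>i. Var (Suc i)) = Var" by (rule ext) (simp split: nat.split)
  with All show ?case by simp
qed (simp_all add: subst_Var)

lemma subst_sentence: "sentence A \<Longrightarrow> subst \<sigma> \<rho> A = A"
  using subst_closed[of 0 0 A \<sigma> Var \<rho> "\<lambda>n. n"] by (simp add: subst_id)

lemma subst_inst:
  "subst \<sigma> \<rho> (inst t A) = inst (subst_tm \<sigma> t) (subst (case_nat (Var 0) (\<lambda>i. lift_tm (\<sigma> i))) \<rho> A)"
proof -
  have "(\<lambda>i. subst_tm \<sigma> (case_nat t Var i)) =
      (\<lambda>i. subst_tm (case_nat (subst_tm \<sigma> t) Var) (case_nat (Var 0) (\<lambda>i. lift_tm (\<sigma> i)) i))"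
    by (rule ext) (simp add: subst_tm_comp subst_Var split: nat.split)
  then show ?thesis by (simp add: subst_comp)
qed

lemma subst_instS:
  "subst \<sigma> \<rho> (instS n A) = instS (\<rho> n) (subst \<sigma> (case_nat 0 (\<lambda>n. Suc (\<rho> n))) A)"
proof -
  have "(\<lambda>m. \<rho> (case_nat n (\<lambda>m. m) m)) = (\<lambda>m. case_nat (\<rho> n) (\<lambda>m. m) (case_nat 0 (\<lambda>n. Suc (\<rho> n)) m))"
    by (rule ext) (simp split: nat.split)
  then show ?thesis by (simp add: subst_comp subst_Var)
qed

lemma subst_lift: "subst (case_nat (Var 0) (\<lambda>i. lift_tm (\<sigma> i))) \<rho> (lift A) = lift (subst \<sigma> \<rho> A)"
  by (simp add: subst_comp)

lemma subst_liftS: "subst \<sigma> (case_nat 0 (\<lambda>n. Suc (\<rho> n))) (liftS A) = liftS (subst \<sigma> \<rho> A)"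
  by (simp add: subst_comp subst_Var)

text \<open>Only the schemes with an instance or a lifting need work, and substitution commutes with
  both once it is itself lifted under the binder.\<close>

lemma scheme_subst: "scheme A \<Longrightarrow> scheme (subst \<sigma> \<rho> A)"
  by (induction rule: scheme.induct)
    (simp_all add: subst_inst subst_instS subst_lift subst_liftS scheme.intros
      del: One_nat_def)

lemma logical_axiom_subst: "logical_axiom A \<Longrightarrow> logical_axiom (subst \<sigma> \<rho> A)"
  by (induction arbitrary: \<sigma> \<rho> rule: logical_axiom.induct) (simp_all add: logical_axiom.intros scheme_subst)

lemma derives_subst: "\<Gamma> \<turnstile> A \<Longrightarrow> subst \<sigma> \<rho> ` \<Gamma> \<turnstile> subst \<sigma> \<rho> A"
proof (induction rule: derives.induct)
  case (mp A B) then show ?case by (simp) (rule derives.mp)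
qed (simp_all add: derives.hyp derives.logic logical_axiom_subst)

section \<open>Deduction theorem, reductio and generalisation in the Hilbert calculus\<close>

lemma derives_mono: "\<Gamma> \<turnstile> A \<Longrightarrow> \<Gamma> \<subseteq> \<Delta> \<Longrightarrow> \<Delta> \<turnstile> A"
  by (induction rule: derives.induct) (auto intro: derives.intros)

lemma derives_scheme: "scheme A \<Longrightarrow> \<Gamma> \<turnstile> A"
  by (intro derives.logic logical_axiom.intros)

lemma derives_scheme_mp: "scheme (A \<^bold>\<longrightarrow> B) \<Longrightarrow> \<Gamma> \<turnstile> A \<Longrightarrow> \<Gamma> \<turnstile> B"
  by (rule derives.mp[OF derives_scheme])

lemma derives_refl: "\<Gamma> \<turnstile> A \<^bold>\<longrightarrow> A"
  by (rule derives.mp[OF derives_scheme_mp, OF scheme.intros(2), of _ _ "A \<^bold>\<longrightarrow> A"])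
    (rule derives_scheme, rule scheme.intros)+

text \<open>No restriction on free variables arises: generalisation is built into the logical axioms
  and modus ponens is the only rule.\<close>

lemma deduction: "insert A \<Gamma> \<turnstile> B \<Longrightarrow> \<Gamma> \<turnstile> A \<^bold>\<longrightarrow> B"
proof (induction rule: derives.induct)
  case (hyp B)
  then show ?case
    using derives_refl derives_scheme_mp[OF scheme.intros(1)] derives.hyp by blast
next
  case (logic B)
  then show ?case using derives_scheme_mp[OF scheme.intros(1)] derives.logic by blast
next
  case (mp B C)
  then show ?case using derives.mp[OF derives_scheme_mp[OF scheme.intros(2)]] by blast
qed

lemma explosion: "\<Gamma> \<turnstile> \<^bold>\<not> A \<Longrightarrow> \<Gamma> \<turnstile> A \<Longrightarrow> \<Gamma> \<turnstile> B"
  by (rule derives.mp[OF derives_scheme_mp[OF scheme.intros(3)]], rule derives_scheme_mp[OF scheme.intros(1)])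

text \<open>Consequentia mirabilis. The contraposition scheme is applied to a provable formula
  \<open>?C\<close>, whose negation follows from \<not> \<open>A\<close> by explosion.\<close>

lemma clavius: assumes "insert (\<^bold>\<not> A) \<Gamma> \<turnstile> A" shows "\<Gamma> \<turnstile> A"
proof -
  let ?C = "A \<^bold>\<longrightarrow> A"
  have "insert (\<^bold>\<not> A) \<Gamma> \<turnstile> \<^bold>\<not> ?C"
    by (rule explosion[OF derives.hyp assms]) simp
  then have "\<Gamma> \<turnstile> \<^bold>\<not> A \<^bold>\<longrightarrow> \<^bold>\<not> ?C" by (rule deduction)
  then have "\<Gamma> \<turnstile> ?C \<^bold>\<longrightarrow> A" by (rule derives_scheme_mp[OF scheme.intros(3)])
  then show ?thesis using derives_refl derives.mp by blast
qed

text \<open>Lifted hypotheses do not mention variable \<open>0\<close>, so they generalise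
  vacuously. Logical axioms are closed under generalisation, and the universal quantifier
  distributes over modus ponens.\<close>

lemma generalise: "lift ` \<Gamma> \<turnstile> A \<Longrightarrow> \<Gamma> \<turnstile> (\<^bold>\<forall> A)"
proof (induction rule: derives.induct)
  case (hyp A)
  then show ?case using derives_scheme_mp[OF scheme.intros(9)] derives.hyp by blast
next
  case (logic A)
  then show ?case by (intro derives.logic logical_axiom.intros(2))
next
  case (mp A B)
  then show ?case using derives.mp[OF derives_scheme_mp[OF scheme.intros(8)]] by blast
qed

lemma generaliseS: "liftS ` \<Gamma> \<turnstile> A \<Longrightarrow> \<Gamma> \<turnstile> (\<^bold>\<forall>\<^sub>2 A)"
proof (induction rule: derives.induct)
  case (hyp A)
  then show ?case using derives_scheme_mp[OF scheme.intros(12)] derives.hyp by blast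
next
  case (logic A)
  then show ?case by (intro derives.logic logical_axiom.intros(3))
next
  case (mp A B)
  then show ?case using derives.mp[OF derives_scheme_mp[OF scheme.intros(11)]] by blast
qed

lemma fresh_generalise:
  assumes "\<forall>C\<in>\<Gamma>. closed_fm m k C" "closed_fm m k (\<^bold>\<forall> A)" "\<Gamma> \<turnstile> inst (Var m) A"
  shows "\<Gamma> \<turnstile> (\<^bold>\<forall> A)"
proof -
  \<comment> \<open>This renaming brings the fresh variable \<open>m\<close> to index
    \<open>0\<close> and moves all smaller ones up, so that it turns the instance back into
    \<open>A\<close> and the hypotheses into their liftings.\<close>
  define \<sigma> where "\<sigma> i = (if i < m then Var (Suc i) else Var 0)" for i
  have "subst \<sigma> (\<lambda>n. n) ` \<Gamma> = lift ` \<Gamma>"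
    by (intro image_cong refl, rule subst_closed[OF bspec[OF assms(1)]]) (simp_all add: \<sigma>_def)
  moreover have "subst \<sigma> (\<lambda>n. n) (inst (Var m) A) = subst Var (\<lambda>n. n) A"
    unfolding subst_comp
    by (rule subst_closed[OF assms(2)[unfolded closed_fm.simps]]) (auto simp: \<sigma>_def split: nat.split)
  ultimately have "lift ` \<Gamma> \<turnstile> A"
    using derives_subst[OF assms(3), of \<sigma> "\<lambda>n. n"] by (simp only: subst_id)
  then show ?thesis by (rule generalise)
qed

lemma fresh_generaliseS:
  assumes "\<forall>C\<in>\<Gamma>. closed_fm m k C" "closed_fm m k (\<^bold>\<forall>\<^sub>2 A)" "\<Gamma> \<turnstile> instS k A"
  shows "\<Gamma> \<turnstile> (\<^bold>\<forall>\<^sub>2 A)"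
proof -
  define \<rho> where "\<rho> n = (if n < k then Suc n else 0)" for n
  have "subst Var \<rho> ` \<Gamma> = liftS ` \<Gamma>"
    by (intro image_cong refl, rule subst_closed[OF bspec[OF assms(1)]]) (simp_all add: \<rho>_def)
  moreover have "subst Var \<rho> (instS k A) = subst Var (\<lambda>n. n) A"
    unfolding subst_comp
    by (rule subst_closed[OF assms(2)[unfolded closed_fm.simps]]) (auto simp: \<rho>_def split: nat.split)
  ultimately have "liftS ` \<Gamma> \<turnstile> A"
    using derives_subst[OF assms(3), of Var \<rho>] by (simp only: subst_id)
  then show ?thesis by (rule generaliseS)
qed

lemma subst_app:
  assumes "closed_fm (length ts) (length ns) A"
  shows "subst \<sigma> \<rho> (app A ts ns) = app A (map (subst_tm \<sigma>) ts) (map \<rho> ns)"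
  unfolding app_def subst_comp by (rule subst_closed[OF assms]) auto

section \<open>Henkin extensions\<close>

lemma closed_tm_mono: "closed_tm m t \<Longrightarrow> m \<le> m' \<Longrightarrow> closed_tm m' t"
  by (induction t) auto

lemma closed_fm_mono: "closed_fm m k A \<Longrightarrow> m \<le> m' \<Longrightarrow> k \<le> k' \<Longrightarrow> closed_fm m' k' A"
  by (induction A arbitrary: m k m' k') (auto intro: closed_tm_mono)

lemma ex_closed_tm: "\<exists>m. closed_tm m t"
proof (induction t)
  case (Add t u)
  then obtain m m' where "closed_tm m t" "closed_tm m' u" by blast
  then show ?case by (intro exI[of _ "max m m'"]) (simp add: closed_tm_mono[OF _ max.cobounded1] closed_tm_mono[OF _ max.cobounded2])
next
  case (Mul t u)
  then obtain m m' where "closed_tm m t" "closed_tm m' u" by blast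
  then show ?case by (intro exI[of _ "max m m'"]) (simp add: closed_tm_mono[OF _ max.cobounded1] closed_tm_mono[OF _ max.cobounded2])
qed (auto intro: lessI)

text \<open>A bound for the whole set leaves variables that occur nowhere in it; they serve as
  Henkin witnesses, so the language need not be extended.\<close>

definition bounded :: "fm set \<Rightarrow> bool" where
  "bounded \<Gamma> \<longleftrightarrow> (\<exists>m k. \<forall>A\<in>\<Gamma>. closed_fm m k A)"

lemma bounded_Un: assumes "bounded \<Gamma>" "bounded \<Delta>" shows "bounded (\<Gamma> \<union> \<Delta>)"
proof -
  obtain m k m' k' where "\<forall>A\<in>\<Gamma>. closed_fm m k A" "\<forall>A\<in>\<Delta>. closed_fm m' k' A"
    using assms unfolding bounded_def by blast
  then have "\<forall>A\<in>\<Gamma> \<union> \<Delta>. closed_fm (max m m') (max k k') A"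
    by (auto intro: closed_fm_mono)
  then show ?thesis unfolding bounded_def by blast
qed

lemma bounded_singleton: "bounded {A}"
proof (induction A)
  case (Eq t u)
  obtain m m' where "closed_tm m t" "closed_tm m' u" using ex_closed_tm by blast
  then show ?case unfolding bounded_def
    by (intro exI[of _ "max m m'"] exI[of _ 0]) (auto intro: closed_tm_mono)
next
  case (Less t u)
  obtain m m' where "closed_tm m t" "closed_tm m' u" using ex_closed_tm by blast
  then show ?case unfolding bounded_def
    by (intro exI[of _ "max m m'"] exI[of _ 0]) (auto intro: closed_tm_mono)
next
  case (Mem t n)
  obtain m where "closed_tm m t" using ex_closed_tm by blast
  then show ?case unfolding bounded_def by (intro exI[of _ m] exI[of _ "Suc n"]) auto
next
  case (Neg A) then show ?case unfolding bounded_def by simp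
next
  case (And A B)
  show ?case using bounded_Un[OF And] unfolding bounded_def by (simp add: conj_commute)
next
  case (All A)
  then obtain m k where "closed_fm m k A" unfolding bounded_def by blast
  then show ?case unfolding bounded_def
    by (intro exI[of _ m] exI[of _ k]) (auto intro: closed_fm_mono)
next
  case (AllS A)
  then obtain m k where "closed_fm m k A" unfolding bounded_def by blast
  then show ?case unfolding bounded_def
    by (intro exI[of _ m] exI[of _ k]) (auto intro: closed_fm_mono)
qed

lemma bounded_insert: "bounded \<Gamma> \<Longrightarrow> bounded (insert A \<Gamma>)"
  using bounded_Un[OF bounded_singleton] by simp

text \<open>If every instance led to \<open>G\<close>, so would the one at a fresh variable.
  Reductio then derives that instance, hence the universal formula, against its negation in
  \<Gamma>.\<close>

lemma ex_fresh:
  assumes "bounded \<Gamma>" "\<not> (\<Gamma> \<turnstile> G)" "(\<^bold>\<not> (\<^bold>\<forall> A)) \<in> \<Gamma>"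
  shows "\<exists>t. \<not> (insert (\<^bold>\<not> inst t A) \<Gamma> \<turnstile> G)"
proof (rule ccontr)
  assume *: "\<not> ?thesis"
  \<comment> \<open>With \<not> \<open>G\<close> as a hypothesis, \<open>G\<close> acts as
    absurdity. The bound is taken over this larger set because the variable must be fresh for
    \<open>G\<close> as well.\<close>
  let ?\<Delta> = "insert (\<^bold>\<not> G) \<Gamma>"
  obtain m k where mk: "\<forall>C\<in>?\<Delta>. closed_fm m k C"
    using bounded_insert[OF assms(1)] unfolding bounded_def by blast
  have "closed_fm m k (\<^bold>\<not> (\<^bold>\<forall> A))" by (rule bspec[OF mk]) (simp add: assms(3))
  then have cA: "closed_fm m k (\<^bold>\<forall> A)" by simp
  have "insert (\<^bold>\<not> inst (Var m) A) \<Gamma> \<turnstile> G" using * by simp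
  then have "insert (\<^bold>\<not> inst (Var m) A) ?\<Delta> \<turnstile> G" by (rule derives_mono) blast
  then have "insert (\<^bold>\<not> inst (Var m) A) ?\<Delta> \<turnstile> inst (Var m) A"
    by (rule explosion[rotated]) (simp add: derives.hyp)
  then have "?\<Delta> \<turnstile> inst (Var m) A" by (rule clavius)
  then have "?\<Delta> \<turnstile> (\<^bold>\<forall> A)" by (rule fresh_generalise[OF mk cA])
  then have "?\<Delta> \<turnstile> G" by (rule explosion[rotated]) (simp add: derives.hyp assms(3))
  then show False using clavius assms(2) by blast
qed

lemma ex_freshS:
  assumes "bounded \<Gamma>" "\<not> (\<Gamma> \<turnstile> G)" "(\<^bold>\<not> (\<^bold>\<forall>\<^sub>2 A)) \<in> \<Gamma>"
  shows "\<exists>n. \<not> (insert (\<^bold>\<not> instS n A) \<Gamma> \<turnstile> G)"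
proof (rule ccontr)
  assume *: "\<not> ?thesis"
  let ?\<Delta> = "insert (\<^bold>\<not> G) \<Gamma>"
  obtain m k where mk: "\<forall>C\<in>?\<Delta>. closed_fm m k C"
    using bounded_insert[OF assms(1)] unfolding bounded_def by blast
  have "closed_fm m k (\<^bold>\<not> (\<^bold>\<forall>\<^sub>2 A))" by (rule bspec[OF mk]) (simp add: assms(3))
  then have cA: "closed_fm m k (\<^bold>\<forall>\<^sub>2 A)" by simp
  have "insert (\<^bold>\<not> instS k A) \<Gamma> \<turnstile> G" using * by simp
  then have "insert (\<^bold>\<not> instS k A) ?\<Delta> \<turnstile> G" by (rule derives_mono) blast
  then have "insert (\<^bold>\<not> instS k A) ?\<Delta> \<turnstile> instS k A"
    by (rule explosion[rotated]) (simp add: derives.hyp)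
  then have "?\<Delta> \<turnstile> instS k A" by (rule clavius)
  then have "?\<Delta> \<turnstile> (\<^bold>\<forall>\<^sub>2 A)" by (rule fresh_generaliseS[OF mk cA])
  then have "?\<Delta> \<turnstile> G" by (rule explosion[rotated]) (simp add: derives.hyp assms(3))
  then show False using clavius assms(2) by blast
qed

text \<open>Consistency is relative to \<open>G\<close>: a formula is rejected only if it yields
  \<open>G\<close> over the current stage. An accepted negated universal receives its counterexample
  at once.\<close>

definition henkin_step :: "fm \<Rightarrow> fm \<Rightarrow> fm set \<Rightarrow> fm set \<Rightarrow> bool" where
  "henkin_step G A \<Gamma> \<Delta> \<longleftrightarrow> \<Gamma> \<subseteq> \<Delta> \<and> bounded \<Delta> \<and> \<not> (\<Delta> \<turnstile> G) \<and>
    (A \<in> \<Delta> \<or> (insert A \<Gamma> \<turnstile> G)) \<and>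
    (\<forall>B. A = (\<^bold>\<not> (\<^bold>\<forall> B)) \<longrightarrow> A \<in> \<Delta> \<longrightarrow> (\<exists>t. (\<^bold>\<not> inst t B) \<in> \<Delta>)) \<and>
    (\<forall>B. A = (\<^bold>\<not> (\<^bold>\<forall>\<^sub>2 B)) \<longrightarrow> A \<in> \<Delta> \<longrightarrow> (\<exists>n. (\<^bold>\<not> instS n B) \<in> \<Delta>))"

lemma ex_henkin_step:
  assumes "bounded \<Gamma>" "\<not> (\<Gamma> \<turnstile> G)"
  shows "\<exists>\<Delta>. henkin_step G A \<Gamma> \<Delta>"
proof (cases "insert A \<Gamma> \<turnstile> G")
  case True
  \<comment> \<open>The stage stays as it is. Absence of \<open>A\<close> makes both witness clauses
    vacuous.\<close>
  then have "A \<notin> \<Gamma>" using assms(2) by (metis insert_absorb)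
  with True assms show ?thesis unfolding henkin_step_def by blast
next
  case False
  note b = bounded_insert[OF assms(1), of A]
  consider B where "A = (\<^bold>\<not> (\<^bold>\<forall> B))" | B where "A = (\<^bold>\<not> (\<^bold>\<forall>\<^sub>2 B))" |
    "\<forall>B. A \<noteq> (\<^bold>\<not> (\<^bold>\<forall> B)) \<and> A \<noteq> (\<^bold>\<not> (\<^bold>\<forall>\<^sub>2 B))" by blast
  then show ?thesis
  proof cases
    case (1 B)
    then obtain t where "\<not> (insert (\<^bold>\<not> inst t B) (insert A \<Gamma>) \<turnstile> G)" using ex_fresh[OF b False] by blast
    with 1 bounded_insert[OF b] show ?thesis unfolding henkin_step_def
      by (intro exI[of _ "insert (\<^bold>\<not> inst t B) (insert A \<Gamma>)"]) auto
  next
    case (2 B)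
    then obtain n where "\<not> (insert (\<^bold>\<not> instS n B) (insert A \<Gamma>) \<turnstile> G)" using ex_freshS[OF b False] by blast
    with 2 bounded_insert[OF b] show ?thesis unfolding henkin_step_def
      by (intro exI[of _ "insert (\<^bold>\<not> instS n B) (insert A \<Gamma>)"]) auto
  next
    case 3
    with b False show ?thesis unfolding henkin_step_def by (intro exI[of _ "insert A \<Gamma>"]) auto
  qed
qed

text \<open>Compactness: a derivation uses finitely many hypotheses, which lie in one member of the
  chain.\<close>

lemma derives_chain:
  fixes M :: "nat \<Rightarrow> fm set"
  assumes "mono M" "(\<Union>n. M n) \<turnstile> A"
  shows "\<exists>n. M n \<turnstile> A"
  using assms(2)
proof (induction rule: derives.induct)
  case (hyp A) then show ?case using derives.hyp by blast
next
  case (logic A) then show ?case using derives.logic by blast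
next
  case (mp A B)
  then obtain i j where "M i \<turnstile> A \<^bold>\<longrightarrow> B" "M j \<turnstile> A" by blast
  then have "M (max i j) \<turnstile> A \<^bold>\<longrightarrow> B" "M (max i j) \<turnstile> A"
    using monoD[OF assms(1)] derives_mono max.cobounded1 max.cobounded2 by metis+
  then show ?case using derives.mp by blast
qed

definition henkin :: "fm set \<Rightarrow> bool" where
  "henkin M \<longleftrightarrow>
    (\<forall>A. (\<^bold>\<not> A) \<in> M \<longleftrightarrow> A \<notin> M) \<and>
    (\<forall>A B. (A \<^bold>\<and> B) \<in> M \<longleftrightarrow> A \<in> M \<and> B \<in> M) \<and>
    (\<forall>A. (\<^bold>\<forall> A) \<in> M \<longleftrightarrow> (\<forall>t. inst t A \<in> M)) \<and>
    (\<forall>A. (\<^bold>\<forall>\<^sub>2 A) \<in> M \<longleftrightarrow> (\<forall>n. instS n A \<in> M))"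

text \<open>Lindenbaum's construction. Stage \<open>n\<close> decides the formula with code
  \<open>n\<close>; since every formula has a code, each is decided at some stage.\<close>

theorem henkin_extension:
  assumes "bounded \<Gamma>" "\<not> (\<Gamma> \<turnstile> G)"
  obtains M where "henkin M" "\<And>A. \<Gamma> \<turnstile> A \<Longrightarrow> A \<in> M" "G \<notin> M"
proof -
  have "\<exists>F. \<forall>n. (bounded (F n) \<and> \<not> (F n \<turnstile> G) \<and> \<Gamma> \<subseteq> F n) \<and> henkin_step G (cdec n) (F n) (F (Suc n))"
  proof (rule dependent_nat_choice)
    show "\<exists>\<Delta>. bounded \<Delta> \<and> \<not> (\<Delta> \<turnstile> G) \<and> \<Gamma> \<subseteq> \<Delta>" using assms by blast
  next
    fix \<Delta> n assume "bounded \<Delta> \<and> \<not> (\<Delta> \<turnstile> G) \<and> \<Gamma> \<subseteq> \<Delta>"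
    then show "\<exists>\<Delta>'. (bounded \<Delta>' \<and> \<not> (\<Delta>' \<turnstile> G) \<and> \<Gamma> \<subseteq> \<Delta>') \<and> henkin_step G (cdec n) \<Delta> \<Delta>'"
      using ex_henkin_step[of \<Delta> G "cdec n"] unfolding henkin_step_def by blast
  qed
  then obtain F where F: "\<And>n. \<not> (F n \<turnstile> G)" "\<And>n. \<Gamma> \<subseteq> F n" "\<And>n. henkin_step G (cdec n) (F n) (F (Suc n))"
    by blast
  have step: "henkin_step G A (F (code A)) (F (Suc (code A)))" for A using F(3)[of "code A"] by (simp add: cdec)
  define M where "M = (\<Union>n. F n)"
  have inc: "mono F" unfolding mono_iff_le_Suc using F(3) unfolding henkin_step_def by blast
  have nG: "\<not> (M \<turnstile> G)" using derives_chain[OF inc] F(1) unfolding M_def by blast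
  have FM: "F n \<subseteq> M" for n unfolding M_def by blast
  have dec: "A \<in> M \<or> (M \<turnstile> A \<^bold>\<longrightarrow> G)" for A
    using step[of A] FM derives_mono[OF _ FM] deduction unfolding henkin_step_def by blast
  have closed: "A \<in> M" if "M \<turnstile> A" for A
    using dec[of A] derives.mp[OF _ that] nG by blast
  have in_iff: "A \<in> M \<longleftrightarrow> (M \<turnstile> A)" for A using closed derives.hyp by blast
  have neg: "(\<^bold>\<not> A) \<in> M \<longleftrightarrow> A \<notin> M" for A
  proof
    assume "(\<^bold>\<not> A) \<in> M"
    then show "A \<notin> M" using explosion nG in_iff by blast
  next
    assume "A \<notin> M"
    show "(\<^bold>\<not> A) \<in> M"
    proof (rule ccontr)
      assume "\<not> ?thesis"
      \<comment> \<open>Both \<open>A\<close> and its negation are rejected, so each implies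
        \<open>G\<close>; reasoning by cases, done through two uses of \<open>clavius\<close>, would
        derive \<open>G\<close> itself.\<close>
      then have 1: "M \<turnstile> \<^bold>\<not> A \<^bold>\<longrightarrow> G" and 2: "M \<turnstile> A \<^bold>\<longrightarrow> G" using dec \<open>A \<notin> M\<close> by blast+
      let ?M = "insert (\<^bold>\<not> G) M"
      have m: "M \<subseteq> ?M" "M \<subseteq> insert (\<^bold>\<not> A) ?M" by blast+
      have "insert (\<^bold>\<not> A) ?M \<turnstile> G" by (rule derives.mp[OF derives_mono[OF 1 m(2)] derives.hyp]) simp
      then have "insert (\<^bold>\<not> A) ?M \<turnstile> A" by (rule explosion[rotated]) (simp add: derives.hyp)
      then have "?M \<turnstile> A" by (rule clavius)
      then have "?M \<turnstile> G" by (rule derives.mp[OF derives_mono[OF 2 m(1)]])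
      then show False using clavius nG by blast
    qed
  qed
  have "(A \<^bold>\<and> B) \<in> M \<longleftrightarrow> A \<in> M \<and> B \<in> M" for A B
    unfolding in_iff
    using derives_scheme_mp[OF scheme.intros(4)] derives_scheme_mp[OF scheme.intros(5)]
      derives.mp[OF derives_scheme_mp[OF scheme.intros(6)]] by blast
  moreover have "(\<^bold>\<forall> A) \<in> M \<longleftrightarrow> (\<forall>t. inst t A \<in> M)" for A
  proof
    assume "(\<^bold>\<forall> A) \<in> M"
    then show "\<forall>t. inst t A \<in> M" unfolding in_iff using derives_scheme_mp[OF scheme.intros(7)] by blast
  next
    assume *: "\<forall>t. inst t A \<in> M"
    show "(\<^bold>\<forall> A) \<in> M"
    proof (rule ccontr)
      assume "\<not> ?thesis"
      then have "(\<^bold>\<not> (\<^bold>\<forall> A)) \<in> M" using neg by blast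
      \<comment> \<open>No stage can have rejected a formula that is in \<open>M\<close>, so this
        one was accepted at its own stage, together with a witness.\<close>
      moreover have "\<not> (insert (\<^bold>\<not> (\<^bold>\<forall> A)) (F n) \<turnstile> G)" for n
        using nG derives_mono[of "insert (\<^bold>\<not> (\<^bold>\<forall> A)) (F n)" G M] FM calculation by blast
      ultimately obtain t where "(\<^bold>\<not> inst t A) \<in> M"
        using step[of "\<^bold>\<not> (\<^bold>\<forall> A)"] FM unfolding henkin_step_def by blast
      then show False using * neg by blast
    qed
  qed
  moreover have "(\<^bold>\<forall>\<^sub>2 A) \<in> M \<longleftrightarrow> (\<forall>n. instS n A \<in> M)" for A
  proof
    assume "(\<^bold>\<forall>\<^sub>2 A) \<in> M"
    then show "\<forall>n. instS n A \<in> M" unfolding in_iff using derives_scheme_mp[OF scheme.intros(10)] by blast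
  next
    assume *: "\<forall>n. instS n A \<in> M"
    show "(\<^bold>\<forall>\<^sub>2 A) \<in> M"
    proof (rule ccontr)
      assume "\<not> ?thesis"
      then have "(\<^bold>\<not> (\<^bold>\<forall>\<^sub>2 A)) \<in> M" using neg by blast
      moreover have "\<not> (insert (\<^bold>\<not> (\<^bold>\<forall>\<^sub>2 A)) (F n) \<turnstile> G)" for n
        using nG derives_mono[of "insert (\<^bold>\<not> (\<^bold>\<forall>\<^sub>2 A)) (F n)" G M] FM calculation by blast
      ultimately obtain n where "(\<^bold>\<not> instS n A) \<in> M"
        using step[of "\<^bold>\<not> (\<^bold>\<forall>\<^sub>2 A)"] FM unfolding henkin_step_def by blast
      then show False using * neg by blast
    qed
  qed
  ultimately have "henkin M" unfolding henkin_def using neg by blast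
  moreover have "A \<in> M" if "\<Gamma> \<turnstile> A" for A
    using derives_mono[OF that, of M] F(2)[of 0] FM[of 0] closed by blast
  ultimately show ?thesis using that nG derives.hyp by blast
qed

section \<open>Substitution in the provability predicate\<close>

text \<open>The effect of \<sigma> below \<open>n\<close> number quantifiers, that is, the
  \<open>n\<close>-fold iterate of the lifting in the quantifier clause of
  \<open>subst\<close>.\<close>

definition up :: "nat \<Rightarrow> (nat \<Rightarrow> tm) \<Rightarrow> nat \<Rightarrow> tm" where
  "up n \<sigma> i = (if i < n then Var i else shift n (\<sigma> (i - n)))"

lemma up_Var: "i < n \<Longrightarrow> up n \<sigma> i = Var i"
  by (simp add: up_def)

lemma up_shift: "subst_tm (up n \<sigma>) (shift n t) = shift n (subst_tm \<sigma> t)"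
  by (simp add: subst_tm_comp up_def)

lemma up_lift: "subst_tm (up 1 \<sigma>) (lift_tm t) = lift_tm (subst_tm \<sigma> t)"
  using up_shift[of 1 \<sigma> t] by simp

lemma up_0: "up 0 \<sigma> = \<sigma>"
  by (rule ext) (simp add: up_def subst_Var)

lemma up_up: "up m (up n \<sigma>) = up (n + m) \<sigma>"
  by (rule ext) (auto simp: up_def subst_tm_comp add.assoc add.commute[of m n])

lemma subst_All_up: "subst \<sigma> \<rho> (\<^bold>\<forall> A) = (\<^bold>\<forall> subst (up 1 \<sigma>) \<rho> A)"
proof -
  have "case_nat (Var 0) (\<lambda>i. lift_tm (\<sigma> i)) = up 1 \<sigma>"
    by (rule ext) (simp add: up_def split: nat.split)
  then show ?thesis by simp
qed

lemma subst_BAll: "subst \<sigma> \<rho> (BAll t A) = BAll (subst_tm \<sigma> t) (subst (up 1 \<sigma>) \<rho> A)"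
  unfolding BAll_def subst_All_up subst.simps up_lift by (simp add: up_def)

lemma subst_BEx: "subst \<sigma> \<rho> (BEx t A) = BEx (subst_tm \<sigma> t) (subst (up 1 \<sigma>) \<rho> A)"
  unfolding BEx_def subst.simps subst_BAll ..

lemma subst_bexs: "subst \<sigma> \<rho> (bexs n t A) = bexs n (subst_tm \<sigma> t) (subst (up n \<sigma>) \<rho> A)"
  by (induction n arbitrary: t \<sigma>) (simp_all add: bexs.simps subst_BEx up_0 up_up up_lift[simplified])

lemma subst_num: "subst_tm \<sigma> (num n) = num n"
  by (induction n) auto

primrec subst_ce :: "(nat \<Rightarrow> tm) \<Rightarrow> code_exp \<Rightarrow> code_exp" where
  "subst_ce \<sigma> (Tm t) = Tm (subst_tm \<sigma> t)"
| "subst_ce \<sigma> (Unary a b c) = Unary a b (subst_ce \<sigma> c)"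
| "subst_ce \<sigma> (Binary a b c d) = Binary a b (subst_ce \<sigma> c) (subst_ce \<sigma> d)"

text \<open>The terms in \<open>c\<close> live outside the \<open>n\<close> binders already passed
  and are shifted only when used, so they receive \<sigma>; \<open>z\<close> lives inside and
  receives \<open>up n \<sigma>\<close>.\<close>

lemma subst_is_code:
  "subst (up n \<sigma>) \<rho> (is_code n c z) = is_code n (subst_ce \<sigma> c) (subst_tm (up n \<sigma>) z)"
proof (induction c arbitrary: n z)
  case (Tm t) show ?case by (simp add: is_code.simps up_shift)
next
  case (Unary a b c)
  have z: "subst_tm (up (n + 1) \<sigma>) (shift 1 z) = shift 1 (subst_tm (up n \<sigma>) z)" for z
    unfolding up_up[symmetric] up_shift ..
  show ?case
    unfolding is_code.simps subst_bexs up_up subst.simps Unary subst_tm.simps subst_num z subst_ce.simps is_code.simps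
    by (simp add: up_Var)
next
  case (Binary a b c d)
  have z: "subst_tm (up (n + 2) \<sigma>) (shift 2 z) = shift 2 (subst_tm (up n \<sigma>) z)" for z
    unfolding up_up[symmetric] up_shift ..
  show ?case
    unfolding is_code.simps subst_bexs up_up subst.simps Binary subst_tm.simps subst_num z subst_ce.simps is_code.simps
    by (simp add: up_Var)
qed

lemma subst_has_code: "subst \<sigma> \<rho> (z \<^bold>\<equiv> c) = (subst_tm \<sigma> z \<^bold>\<equiv> subst_ce \<sigma> c)"
  using subst_is_code[of 0 \<sigma> \<rho> c z] by (simp add: up_0)

lemma subst_pr: "subst_tm \<sigma> (pr t u) = pr (subst_tm \<sigma> t) (subst_tm \<sigma> u)"
  by (simp add: pr_def)

lemma subst_tup: "subst_tm \<sigma> (tup i j k x y) = tup i (subst_tm \<sigma> j) (subst_tm \<sigma> k) (subst_tm \<sigma> x) (subst_tm \<sigma> y)"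
  by (simp add: tup_def subst_pr subst_num)

lemma up_shift_2: "subst_tm (up 1 (up 1 \<sigma>)) (shift 2 t) = shift 2 (subst_tm \<sigma> t)"
  unfolding up_up using up_shift[of 2 \<sigma> t] by (simp add: numeral_2_eq_2)

lemma subst_elt: "subst \<sigma> \<rho> (x \<^bold>\<epsilon> s) = (subst_tm \<sigma> x \<^bold>\<epsilon> subst_tm \<sigma> s)"
  unfolding elt_def subst_BEx subst.simps subst_tm.simps up_shift up_shift_2 subst_num
  by (simp add: up_def)

lemmas subst_rules = subst_BAll subst_bexs subst_has_code subst_elt subst_ce.simps subst.simps(1-5)
  subst_tm.simps subst_num subst_pr subst_tup up_shift

section \<open>Invariance of the arithmetised syntax under substitution\<close>

lemma subst_tm_step: "subst \<sigma> \<rho> (tm_step w j k x y) =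
   tm_step (subst_tm \<sigma> w) (subst_tm \<sigma> j) (subst_tm \<sigma> k) (subst_tm \<sigma> x) (subst_tm \<sigma> y)"
  unfolding tm_step_def Let_def subst_rules by (simp add: up_def)

lemma subst_fm_step: "subst \<sigma> \<rho> (fm_step w j k x y) =
   fm_step (subst_tm \<sigma> w) (subst_tm \<sigma> j) (subst_tm \<sigma> k) (subst_tm \<sigma> x) (subst_tm \<sigma> y)"
  unfolding fm_step_def Let_def subst_rules by (simp add: up_def)

lemma subst_fmS_step: "subst \<sigma> \<rho> (fmS_step w j k x y) =
   fmS_step (subst_tm \<sigma> w) (subst_tm \<sigma> j) (subst_tm \<sigma> k) (subst_tm \<sigma> x) (subst_tm \<sigma> y)"
  unfolding fmS_step_def Let_def subst_rules by (simp add: up_def)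

lemma subst_subst_ok: "subst \<sigma> \<rho> (subst_ok w) = subst_ok (subst_tm \<sigma> w)"
  unfolding subst_ok_def Let_def subst_rules subst_tm_step subst_fm_step subst_fmS_step
  by (simp add: up_def)

lemma subst_logic_ok: "subst \<sigma> \<rho> (logic_ok w s) = logic_ok (subst_tm \<sigma> w) (subst_tm \<sigma> s)"
  unfolding logic_ok_def is_scheme_def Let_def subst_rules by (simp add: up_def)

lemma subst_proof_ok:
  assumes "closed_fm 1 0 \<tau>"
  shows "subst \<sigma> \<rho> (proof_ok \<tau> s p) = proof_ok \<tau> (subst_tm \<sigma> s) (subst_tm \<sigma> p)"
proof -
  have *: "subst \<sigma> \<rho> (app \<tau> [y] []) = app \<tau> [subst_tm \<sigma> y] []" for \<sigma> \<rho> y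
    using subst_app[of "[y]" "[]"] assms by simp
  show ?thesis
    unfolding proof_ok_def Let_def subst_rules * by (simp add: up_def)
qed

lemma up_1_shift_3: "subst_tm (up 1 (up 1 (up 1 \<sigma>))) (shift 3 t) = shift 3 (subst_tm \<sigma> t)"
  unfolding up_up using up_shift[of 3 \<sigma> t] by (simp add: eval_nat_numeral)

lemma up_1_shift_4: "subst_tm (up 1 (up 1 (up 1 (up 1 \<sigma>)))) (shift 4 t) = shift 4 (subst_tm \<sigma> t)"
  unfolding up_up using up_shift[of 4 \<sigma> t] by (simp add: eval_nat_numeral)

text \<open>Lets the term model treat provability as an atomic predicate of its argument, without
  ever opening its definition.\<close>

lemma subst_box: "closed_fm 1 0 \<tau> \<Longrightarrow> subst \<sigma> \<rho> (box \<tau> x) = box \<tau> (subst_tm \<sigma> x)"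
  unfolding box_def Let_def subst_All_up subst_rules subst_subst_ok subst_logic_ok subst_proof_ok up_1_shift_3
  by (simp add: up_def numeral_2_eq_2 numeral_3_eq_3)

lemma subst_is_num: "subst \<sigma> \<rho> (is_num m u) = is_num (subst_tm \<sigma> m) (subst_tm \<sigma> u)"
  unfolding is_num_def Let_def subst_All_up subst_rules by (simp add: up_def)

text \<open>Substitution leaves \<open>A\<close> alone because it enters only through the numeral of
  its code; its free variables are not free here.\<close>

lemma subst_is_dotted: "subst \<sigma> \<rho> (is_dotted A a b z) = is_dotted A (subst_tm \<sigma> a) (subst_tm \<sigma> b) (subst_tm \<sigma> z)"
  unfolding is_dotted_def Let_def subst_All_up subst_rules subst_is_num subst_subst_ok up_1_shift_4
  by (simp add: up_def numeral_2_eq_2 numeral_3_eq_3)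

lemma subst_box_imp:
  "closed_fm 1 0 \<tau> \<Longrightarrow> subst \<sigma> \<rho> (box_imp \<tau> A a b f) = box_imp \<tau> A (subst_tm \<sigma> a) (subst_tm \<sigma> b) (subst_tm \<sigma> f)"
  unfolding box_imp_def Let_def subst_All_up subst_rules subst_is_dotted subst_box up_shift_2
  by (simp add: up_def)

section \<open>The term model\<close>

text \<open>Satisfaction in the term model: number variables take terms as values, set variables
  take indices of set variables.\<close>

definition holds :: "fm set \<Rightarrow> (nat \<Rightarrow> tm) \<Rightarrow> (nat \<Rightarrow> nat) \<Rightarrow> fm \<Rightarrow> bool" where
  "holds M \<sigma> \<rho> A \<longleftrightarrow> subst \<sigma> \<rho> A \<in> M"

lemma holds_Var: "holds M Var (\<lambda>n. n) A \<longleftrightarrow> A \<in> M"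
  by (simp add: holds_def subst_id)

lemma holds_simps:
  assumes "henkin M"
  shows "holds M \<sigma> \<rho> (\<^bold>\<not> A) \<longleftrightarrow> \<not> holds M \<sigma> \<rho> A"
    and "holds M \<sigma> \<rho> (A \<^bold>\<and> B) \<longleftrightarrow> holds M \<sigma> \<rho> A \<and> holds M \<sigma> \<rho> B"
    and "holds M \<sigma> \<rho> (\<^bold>\<forall> A) \<longleftrightarrow> (\<forall>t. holds M (case_nat t \<sigma>) \<rho> A)"
    and "holds M \<sigma> \<rho> (\<^bold>\<forall>\<^sub>2 A) \<longleftrightarrow> (\<forall>n. holds M \<sigma> (case_nat n \<rho>) A)"
proof -
  have "(\<lambda>i. subst_tm (case_nat t Var) (case_nat (Var 0) (\<lambda>i. lift_tm (\<sigma> i)) i)) = case_nat t \<sigma>" for t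
    by (rule ext) (simp add: subst_tm_comp subst_Var split: nat.split)
  then show "holds M \<sigma> \<rho> (\<^bold>\<forall> A) \<longleftrightarrow> (\<forall>t. holds M (case_nat t \<sigma>) \<rho> A)"
    using assms by (simp add: holds_def henkin_def subst_comp)
  have "(\<lambda>m. case_nat n (\<lambda>m. m) (case_nat 0 (\<lambda>n. Suc (\<rho> n)) m)) = case_nat n \<rho>" for n
    by (rule ext) (simp split: nat.split)
  then show "holds M \<sigma> \<rho> (\<^bold>\<forall>\<^sub>2 A) \<longleftrightarrow> (\<forall>n. holds M \<sigma> (case_nat n \<rho>) A)"
    using assms by (simp add: holds_def henkin_def subst_comp subst_Var)
qed (use assms in \<open>simp_all add: holds_def henkin_def\<close>)

lemma holds_subst:
  "holds M \<sigma>' \<rho>' (subst \<sigma> \<rho> A) \<longleftrightarrow> holds M (\<lambda>i. subst_tm \<sigma>' (\<sigma> i)) (\<lambda>n. \<rho>' (\<rho> n)) A"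
  by (simp add: holds_def subst_comp)

section \<open>Axioms and their consequences in the term model\<close>

lemma sentence_All_pow: "closed_fm m k A \<Longrightarrow> closed_fm 0 k ((All ^^ m) A)"
proof (induction m arbitrary: A)
  case (Suc m)
  then show ?case unfolding funpow_Suc_right by simp
qed simp

lemma sentence_AllS_pow: "closed_fm 0 k A \<Longrightarrow> sentence ((AllS ^^ k) A)"
proof (induction k arbitrary: A)
  case (Suc k)
  then show ?case unfolding funpow_Suc_right by simp
qed simp

lemma sentence_closures: "A \<in> closures \<A> \<Longrightarrow> sentence A"
  unfolding closures_def by (auto intro: sentence_AllS_pow sentence_All_pow)

lemma holds_All_pow:
  assumes "henkin M"
  shows "(\<And>\<sigma> \<rho>. holds M \<sigma> \<rho> ((All ^^ m) A)) \<Longrightarrow> holds M \<sigma> \<rho> A"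
proof (induction m arbitrary: A \<sigma> \<rho>)
  case (Suc m)
  have "holds M \<sigma> \<rho> (\<^bold>\<forall> A)" for \<sigma> \<rho>
    using Suc unfolding funpow_Suc_right by simp
  \<comment> \<open>The environment is split into its head, which instantiates the quantifier, and
    its tail, at which the quantified formula is used.\<close>
  then have "holds M (case_nat (\<sigma> 0) (\<lambda>i. \<sigma> (Suc i))) \<rho> A" unfolding holds_simps[OF assms] by blast
  moreover have "case_nat (\<sigma> 0) (\<lambda>i. \<sigma> (Suc i)) = \<sigma>" by (rule ext) (simp split: nat.split)
  ultimately show ?case by simp
qed simp

lemma holds_AllS_pow:
  assumes "henkin M"
  shows "(\<And>\<sigma> \<rho>. holds M \<sigma> \<rho> ((AllS ^^ k) A)) \<Longrightarrow> holds M \<sigma> \<rho> A"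
proof (induction k arbitrary: A \<sigma> \<rho>)
  case (Suc k)
  have "holds M \<sigma> \<rho> (\<^bold>\<forall>\<^sub>2 A)" for \<sigma> \<rho>
    using Suc unfolding funpow_Suc_right by simp
  then have "holds M \<sigma> (case_nat (\<rho> 0) (\<lambda>i. \<rho> (Suc i))) A" unfolding holds_simps[OF assms] by blast
  moreover have "case_nat (\<rho> 0) (\<lambda>i. \<rho> (Suc i)) = \<rho>" by (rule ext) (simp split: nat.split)
  ultimately show ?case by simp
qed simp

lemma holds_closures:
  assumes "henkin M" "closures \<A> \<subseteq> M" "A \<in> \<A>"
  shows "holds M \<sigma> \<rho> A"
proof -
  obtain m k where mk: "closed_fm m k A" using bounded_singleton unfolding bounded_def by blast
  let ?C = "(AllS ^^ k) ((All ^^ m) A)"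
  have C: "?C \<in> closures \<A>" unfolding closures_def using mk assms(3) by blast
  then have "holds M \<sigma> \<rho> ?C" for \<sigma> \<rho>
    using sentence_closures[OF C] assms(2) by (auto simp: holds_def subst_sentence)
  then show ?thesis using holds_AllS_pow[OF assms(1)] holds_All_pow[OF assms(1)] by blast
qed

text \<open>The axioms are sentences, so substituting in a derivation changes only its conclusion,
  whose free variables may therefore take any values.\<close>

lemma holds_derivable:
  assumes "closures \<A> \<turnstile> A" "\<And>B. closures \<A> \<turnstile> B \<Longrightarrow> B \<in> M"
  shows "holds M \<sigma> \<rho> A"
proof -
  have "subst \<sigma> \<rho> ` closures \<A> = closures \<A>"
    using sentence_closures subst_sentence by (force simp: image_def)
  then show ?thesis using derives_subst[OF assms(1), of \<sigma> \<rho>] assms(2) by (simp add: holds_def)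
qed

lemma arithmetical_delta00: "delta00 A \<Longrightarrow> arithmetical A"
  by (induction rule: delta00.induct) (simp_all add: BAll_def)

lemma ECA0_subset_ACA0: "ECA0 \<subseteq> ACA0"
  unfolding ECA0_def ACA0_def closures_def using arithmetical_delta00 by blast

lemma bounded_ACA0: "bounded ACA0"
  unfolding bounded_def ACA0_def using sentence_closures by blast

lemma subst_neg_tm: "subst_tm \<sigma> (neg_tm p) = neg_tm (subst_tm \<sigma> p)"
  by (simp add: neg_tm_def subst_num)

text \<open>The existential set quantifier abbreviates a negated universal one, and the negated
  conjunction below it is the implication in \<open>mbox\<close>, so unfolding gives the same
  syntax.\<close>

lemma oracle_fm_eq_mdia: "oracle_fm imc = mdia imc (Var 0) (Var 1)"
  by (simp add: oracle_fm_def mdia_def mbox_def)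

lemma subst_preceq: "closed_fm 2 0 le \<Longrightarrow> subst \<sigma> \<rho> (preceq le s t) = preceq le (subst_tm \<sigma> s) (subst_tm \<sigma> t)"
  using subst_app[of "[s, t]" "[]"] by (simp add: preceq_def numeral_2_eq_2)

lemma subst_IMC: "closed_fm 1 1 imc \<Longrightarrow> subst \<sigma> \<rho> (IMC imc X a) = IMC imc (\<rho> X) (subst_tm \<sigma> a)"
  using subst_app[of "[a]" "[X]"] by (simp add: IMC_def)

section \<open>Uniqueness of iterated classes and the defining equation\<close>

theorem theorem7p4:
  fixes T :: "fm set" and \<tau> le imc :: fm
  assumes "presentation \<tau> T"
    and "\<forall>A\<in>ECA0. T \<turnstile> A"
    and "ordinal_notation le"
    and "IMC_formula \<tau> le imc"
  shows "let \<beta> = Var 0 in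
    ACA0 \<union> {wo le \<beta>, \<^bold>\<exists>\<^sub>2 IMC imc 0 \<beta>} \<turnstile>
    (\<^bold>\<forall> (let \<alpha> = Var 0; \<beta> = Var 1; \<phi> = Var 2 in preceq le \<alpha> \<beta> \<^bold>\<longrightarrow>
      (mbox imc \<alpha> \<phi> \<^bold>\<longleftrightarrow>
        box \<tau> \<phi> \<^bold>\<or>
        (\<^bold>\<exists> \<^bold>\<exists> (let \<gamma> = Var 0; \<psi> = Var 1; \<alpha> = Var 2; \<phi> = Var 4 in
          prec le \<gamma> \<alpha> \<^bold>\<and> mdia imc \<gamma> \<psi> \<^bold>\<and>
          box_imp \<tau> (mdia imc (Var 0) (Var 1)) \<gamma> \<psi> \<phi>)))))"
  (is "let \<beta> = Var 0 in ?\<Gamma> \<beta> \<turnstile> ?G")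
proof -
  have c\<tau>: "closed_fm 1 0 \<tau>" using assms(1) by (simp add: presentation_def)
  have cle: "closed_fm 2 0 le"
    and refl_ax: "ECA0 \<turnstile> preceq le (Var 0) (Var 1) \<^bold>\<longrightarrow> preceq le (Var 0) (Var 0) \<^bold>\<and> preceq le (Var 1) (Var 1)"
    and trans_ax: "ECA0 \<turnstile> preceq le (Var 0) (Var 1) \<^bold>\<and> preceq le (Var 1) (Var 2) \<^bold>\<longrightarrow> preceq le (Var 0) (Var 2)"
    using assms(3) by (simp_all add: ordinal_notation_def Let_def)
  have cimc: "closed_fm 1 1 imc" and IMC_ax: "ECA0 \<turnstile> IMC imc 0 (Var 0) \<^bold>\<longleftrightarrow> IMC_rhs \<tau> le imc"
    using assms(4) by (simp_all add: IMC_formula_def)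
  have "?\<Gamma> (Var 0) \<turnstile> ?G"
  proof (rule ccontr)
    assume not: "\<not> ?thesis"
    have "bounded (?\<Gamma> (Var 0))"
      by (intro bounded_Un bounded_ACA0 bounded_insert bounded_singleton)
    then obtain M where M: "henkin M" and \<Gamma>M: "\<And>A. ?\<Gamma> (Var 0) \<turnstile> A \<Longrightarrow> A \<in> M" and "?G \<notin> M"
      using henkin_extension[OF _ not] by blast
    define L where "L s t \<longleftrightarrow> preceq le s t \<in> M" for s t
    define I where "I X a \<longleftrightarrow> IMC imc X a \<in> M" for X a
    define B where "B f \<longleftrightarrow> box \<tau> f \<in> M" for f
    define D where "D b q f \<longleftrightarrow> box_imp \<tau> (oracle_fm imc) b q f \<in> M" for b q f
    define E where "E t X \<longleftrightarrow> (t \<^bold>\<in> X) \<in> M" for t X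
    define Q where "Q s t \<longleftrightarrow> (s \<^bold>= t) \<in> M" for s t
    \<comment> \<open>These formulas commute with substitution and so serve as atoms of the model;
      all further reasoning takes place in the metalogic.\<close>
    have atoms:
      "holds M \<sigma> \<rho> (preceq le s t) \<longleftrightarrow> L (subst_tm \<sigma> s) (subst_tm \<sigma> t)"
      "holds M \<sigma> \<rho> (IMC imc X a) \<longleftrightarrow> I (\<rho> X) (subst_tm \<sigma> a)"
      "holds M \<sigma> \<rho> (box \<tau> f) \<longleftrightarrow> B (subst_tm \<sigma> f)"
      "holds M \<sigma> \<rho> (box_imp \<tau> (oracle_fm imc) b q f) \<longleftrightarrow> D (subst_tm \<sigma> b) (subst_tm \<sigma> q) (subst_tm \<sigma> f)"
      "holds M \<sigma> \<rho> (t \<^bold>\<in> X) \<longleftrightarrow> E (subst_tm \<sigma> t) (\<rho> X)"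
      "holds M \<sigma> \<rho> (s \<^bold>= t) \<longleftrightarrow> Q (subst_tm \<sigma> s) (subst_tm \<sigma> t)" for \<sigma> \<rho> s t X a f b q
      unfolding holds_def subst_preceq[OF cle] subst_IMC[OF cimc] subst_box[OF c\<tau>] subst_box_imp[OF c\<tau>]
        L_def I_def B_def D_def E_def Q_def by simp_all
    note H = holds_simps[OF M] atoms subst_pr subst_neg_tm
    have ECA: "holds M \<sigma> \<rho> A" if "ECA0 \<turnstile> A" for \<sigma> \<rho> A
    proof (rule holds_derivable[OF that[unfolded ECA0_def]])
      fix C assume "closures (basic_axioms \<union> comprehension ` {A. delta00 A}) \<turnstile> C"
      then show "C \<in> M"
        using derives_mono[of ECA0 C "?\<Gamma> (Var 0)"] ECA0_subset_ACA0 \<Gamma>M by (auto simp: ECA0_def)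
    qed
    have L_trans: "L x z" if "L x y" "L y z" for x y z
      using ECA[OF trans_ax, of "case_nat x (case_nat y (\<lambda>_. z))"] that by (simp add: H)
    have L_refl: "L x x" if "L x y" for x y
      using ECA[OF refl_ax, of "case_nat x (\<lambda>_. y)"] that by (simp add: H)
    have I_iff: "I X g \<longleftrightarrow> (\<forall>a. L a g \<longrightarrow> (\<forall>f. E (pr a f) X \<longleftrightarrow>
        B f \<or> (\<exists>b. (L b a \<and> \<not> Q b a) \<and> (\<exists>q. \<not> E (pr b (neg_tm q)) X \<and> D b q f))))" for X g
      using ECA[OF IMC_ax, of "\<lambda>_. g" "\<lambda>_. X"]
      unfolding IMC_rhs_def Let_def prec_def by (simp add: H) blast
    define \<beta> where "\<beta> = Var 0"
    have "wo le \<beta> \<in> M" "(\<^bold>\<exists>\<^sub>2 IMC imc 0 \<beta>) \<in> M" by (auto intro!: \<Gamma>M derives.hyp simp: \<beta>_def)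
    then have "\<forall>Z. (\<forall>x. L x \<beta> \<longrightarrow> \<not> E x Z) \<or>
        (\<exists>x. L x \<beta> \<and> E x Z \<and> (\<forall>y. L y x \<longrightarrow> L y \<beta> \<longrightarrow> Q y x \<or> \<not> E y Z))"
      unfolding wo_def Let_def prec_def holds_Var[symmetric] by (simp add: H \<beta>_def)
    then have wo: "\<exists>x. E x Z \<and> (\<forall>y. L y \<beta> \<longrightarrow> L y x \<longrightarrow> \<not> Q y x \<longrightarrow> \<not> E y Z)"
        if "L x \<beta>" "E x Z" for x Z
      using that by blast
    have ex_I: "\<exists>X. I X \<beta>"
      using \<open>(\<^bold>\<exists>\<^sub>2 IMC imc 0 \<beta>) \<in> M\<close> unfolding holds_Var[symmetric] by (simp add: H \<beta>_def)
    have comp: "\<exists>Z. \<forall>x. E x Z \<longleftrightarrow> L x g \<and> \<not> (\<forall>f. E (pr x f) X \<longleftrightarrow> E (pr x f) Y)" for g X Y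
    proof -
      \<comment> \<open>The levels up to \<open>g\<close> at which \<open>X\<close> and
        \<open>Y\<close> differ. Disagreement is arithmetical, since it mentions only membership in
        the two given sets. Outside the inner quantifier, number variable \<open>1\<close> stands
        for \<open>g\<close>.\<close>
      let ?A = "preceq le (Var 0) (Var 1) \<^bold>\<and> \<^bold>\<not> (\<^bold>\<forall> pr (Var 1) (Var 0) \<^bold>\<in> 0 \<^bold>\<longleftrightarrow> pr (Var 1) (Var 0) \<^bold>\<in> 1)"
      have ar: "arithmetical (preceq le (Var 0) (Var 1))"
        using assms(3) unfolding ordinal_notation_def preceq_def app_def
        by (intro arithmetical_delta00 delta00_subst) blast
      have "closures (basic_axioms \<union> comprehension ` {A. arithmetical A}) \<subseteq> M"
        using \<Gamma>M derives.hyp unfolding ACA0_def by blast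
      then have "holds M (\<lambda>_. g) (case_nat X (\<lambda>_. Y)) (comprehension ?A)"
        by (rule holds_closures[OF M]) (intro UnI2 imageI CollectI, simp add: ar del: One_nat_def)
      then show ?thesis unfolding comprehension_def by (simp add: H holds_subst) blast
    qed
    have unique: "E (pr a f) X \<longleftrightarrow> E (pr a f) Y"
      if X: "I X g" and Y: "I Y g" and g: "L g \<beta>" and a: "L a g" for X Y g a f
    proof (rule ccontr)
      assume ne: "\<not> ?thesis"
      obtain Z where Z: "\<And>x. E x Z \<longleftrightarrow> L x g \<and> \<not> (\<forall>f. E (pr x f) X \<longleftrightarrow> E (pr x f) Y)" using comp by blast
      then have "L a \<beta>" "E a Z" using ne a g L_trans by blast+
      then obtain x where x: "E x Z" and min: "\<And>y. L y \<beta> \<Longrightarrow> L y x \<Longrightarrow> \<not> Q y x \<Longrightarrow> \<not> E y Z"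
        using wo by blast
      have "L x g" using x Z by blast
      \<comment> \<open>Since \<open>b\<close> lies below \<open>g\<close> by transitivity, its
        absence from \<open>Z\<close> can only mean agreement at \<open>b\<close>.\<close>
      have below: "E (pr b h) X \<longleftrightarrow> E (pr b h) Y" if "L b x" "\<not> Q b x" for b h
        using min[OF _ that] Z[of b] L_trans that(1) g \<open>L x g\<close> by blast
      \<comment> \<open>The equation at \<open>x\<close> consults a class only at levels strictly
        below \<open>x\<close>, where the two agree.\<close>
      have "E (pr x h) X \<longleftrightarrow> E (pr x h) Y" for h
        using X[unfolded I_iff, rule_format, OF \<open>L x g\<close>, of h]
          Y[unfolded I_iff, rule_format, OF \<open>L x g\<close>, of h] below by blast
      then show False using x Z by blast
    qed
    obtain X where X: "I X \<beta>" using ex_I by blast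
    \<comment> \<open>The equation for \<open>g\<close> is demanded only at levels up to
      \<open>g\<close>, and these are levels up to \<beta>.\<close>
    have X_below: "I X g" if "L g \<beta>" for g
      using X L_trans that unfolding I_iff by blast
    \<comment> \<open>By uniqueness all classes for \<open>a\<close> agree with \<open>X\<close> at
      level \<open>a\<close>, which is one of their levels by reflexivity; and \<open>X\<close> is
      itself such a class.\<close>
    have box: "(\<forall>Y. I Y a \<longrightarrow> E (pr a f) Y) \<longleftrightarrow> E (pr a f) X" if "L a \<beta>" for a f
      using unique[OF X_below[OF that]] X_below[OF that] that L_refl by blast
    \<comment> \<open>The equation of \<open>X\<close> at \<open>a\<close>, with membership at
      \<open>a\<close> and at each \<open>b\<close> below it rewritten by
      \<open>box\<close>.\<close>
    have "(\<forall>Y. I Y a \<longrightarrow> E (pr a f) Y) \<longleftrightarrow> B f \<or>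
        (\<exists>q b. (L b a \<and> \<not> Q b a) \<and> \<not> (\<forall>Y. I Y b \<longrightarrow> E (pr b (neg_tm q)) Y) \<and> D b q f)"
      if "L a \<beta>" for a f
      using box L_trans that X[unfolded I_iff, rule_format, OF that, of f] by blast
    \<comment> \<open>In the goal the unquoted diamond also has the arguments \<open>Var 0\<close>
      and \<open>Var 1\<close>, so folding turns it into \<open>oracle_fm imc\<close> along with the
      quoted one; its meaning in the model is supplied here.\<close>
    moreover have "holds M \<sigma> \<rho> (oracle_fm imc) \<longleftrightarrow>
        \<not> (\<forall>Y. I Y (\<sigma> 0) \<longrightarrow> E (pr (\<sigma> 0) (neg_tm (\<sigma> 1))) Y)" for \<sigma> \<rho>
      unfolding oracle_fm_def by (simp add: H)
    ultimately have "?G \<in> M"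
      unfolding holds_Var[symmetric] Let_def prec_def oracle_fm_eq_mdia[symmetric]
      unfolding mbox_def by (simp add: H \<beta>_def) blast
    with \<open>?G \<notin> M\<close> show False ..
  qed
  then show ?thesis by (simp add: Let_def)
qed

end
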